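(* Let $\mathbf{k}$ be an algebraically closed field of characteristic $2$, let $n\ge 1$, and let $a\geq b\geq d\ge 0$ be integers with $a\ge 1$. With $\overline{R}$, $\overline{I}$ and the $2$-truncated Schur polynomials $s^{(2)}_{(\cdot,\cdot)}$ defined as in the context, the character of the $\mathbf{GL}_n(\mathbf{k})$-representation $(\overline{I}^d/\overline{I}^{d+1})_{(a,b)}$ is \[\left[\left(\overline{I}^d/\overline{I}^{d+1}\right)_{(a,b)}\right]=\begin{cases} \sum_{j=1}^a(-1)^{j-1}s^{(2)}_{(a+j,a-j)}&\text{if } a=b=d,\\[4pt] s^{(2)}_{(a,a)}+\sum_{j=2}^a (-1)^j s^{(2)}_{(a+j,a-j)}&\text{if } a-1=b-1=d,\\[4pt] s^{(2)}_{(a+b-d,d)}&\text{otherwise.} \end{cases}\]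
   Context: Let $R=\mathbf{k}[x_1,\ldots,x_n,y_1,\ldots,y_n]$ with bigrading $\deg(x_i)=(1,0)$, $\deg(y_i)=(0,1)$. Let $I\subset R$ be the bihomogeneous ideal generated by the $2\times 2$ minors $x_iy_j-x_jy_i$ of the matrix with rows $(x_1,\ldots,x_n)$ and $(y_1,\ldots,y_n)$. Put $\overline{R}=R/(x_1^2,\ldots,x_n^2,y_1^2,\ldots,y_n^2)$ and $\overline{I}=I\overline{R}$, with $\overline{I}^0=\overline{R}$. A subscript $(a,b)$ denotes the bidegree $(a,b)$ component. The group $\mathbf{GL}_n(\mathbf{k})$ acts on $R$ by acting on the span of $x_1,\ldots,x_n$ and on the span of $y_1,\ldots,y_n$ each as on $\mathbf{k}^n$; this induces an action on $(\overline{I}^d/\overline{I}^{d+1})_{(a,b)}$. The character $[V]\in\mathbf{Z}[t_1,\ldots,t_n]$ of such a representation $V$ is $\sum_{\mu}\dim_{\mathbf k}(V_\mu)\,t_1^{\mu_1}\cdots t_n^{\mu_n}$, where $V_\mu$ is the weight space of weight $\mu$ for the diagonal torus (both $x_i$ and $y_i$ have weight $t_i$). The $2$-truncated complete symmetric polynomials are $h_m^{(2)}=\sum_{i_1+\cdots+i_n=m,\ 0\le i_j<2}t_1^{i_1}\cdots t_n^{i_n}\in\mathbf{Z}[t_1,\ldots,t_n]$ (so $h_m^{(2)}=0$ for $m<0$), and the $2$-truncated Schur polynomials are \[s^{(2)}_{(u,v)}=\det\begin{pmatrix} h^{(2)}_u & h^{(2)}_{u+1}\\ h^{(2)}_{v-1}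 & h^{(2)}_v\end{pmatrix}.\] *)

theory Defs
  imports
    "HOL-Analysis.Determinants"
    "HOL-Library.Poly_Mapping"
    "HOL-Algebra.Algebra"
    "HOL-Algebra.Algebraic_Closure_Type"
begin

section \<open>The ring \<open>R\<close>\<close>

text \<open>
  The index type \<open>'n\<close> plays the role of \<open>{1, ..., n}\<close>, so that \<open>n = CARD('n) \<ge> 1\<close>. The variable
  \<open>x\<^sub>i\<close> is indexed by \<open>Inl i\<close> and \<open>y\<^sub>i\<close> by \<open>Inr i\<close>; a polynomial is a finitely supported
  function from exponent vectors to coefficients, with the convolution product.
\<close>

type_synonym ('k, 'n) xy_poly = "(('n + 'n) \<Rightarrow>\<^sub>0 nat) \<Rightarrow>\<^sub>0 'k"

definition Const :: "'k::comm_ring_1 \<Rightarrow> ('k, 'n) xy_poly"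
  where "Const c = Poly_Mapping.single 0 c"

definition Var :: "'n + 'n \<Rightarrow> ('k::comm_ring_1, 'n) xy_poly"
  where "Var v = Poly_Mapping.single (Poly_Mapping.single v 1) 1"

abbreviation xvar :: "'n \<Rightarrow> ('k::comm_ring_1, 'n) xy_poly"
  where "xvar i \<equiv> Var (Inl i)"

abbreviation yvar :: "'n \<Rightarrow> ('k::comm_ring_1, 'n) xy_poly"
  where "yvar i \<equiv> Var (Inr i)"

definition polyR :: "('k::comm_ring_1, 'n) xy_poly ring"
  where "polyR = ring_of_type_algebra"

definition polyR_comp :: "nat \<Rightarrow> nat \<Rightarrow> ('k::comm_ring_1, 'n::finite) xy_poly set"
  where "polyR_comp a b = {p. \<forall>m\<in>Poly_Mapping.keys p.
    (\<Sum>i\<in>UNIV. Poly_Mapping.lookup m (Inl i)) = a \<and> (\<Sum>i\<in>UNIV. Poly_Mapping.lookup m (Inr i)) = b}"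

definition minors_ideal :: "('k::comm_ring_1, 'n) xy_poly set"
  where "minors_ideal = Idl\<^bsub>polyR\<^esub> {xvar i * yvar j - xvar j * yvar i | i j. True}"


section \<open>The quotient ring \<open>Rbar\<close> and the associated graded ring of \<open>Ibar\<close>\<close>

definition Sq :: "('k::comm_ring_1, 'n) xy_poly set"
  where "Sq = Idl\<^bsub>polyR\<^esub> (range (\<lambda>v. Var v ^ 2))"

definition Rbar :: "('k::comm_ring_1, 'n) xy_poly set ring"
  where "Rbar = polyR Quot Sq"

definition Rbar_comp :: "nat \<Rightarrow> nat \<Rightarrow> ('k::comm_ring_1, 'n::finite) xy_poly set set"
  where "Rbar_comp a b = (\<lambda>p. Sq +>\<^bsub>polyR\<^esub> p) ` polyR_comp a b"

definition Ibar :: "('k::comm_ring_1, 'n) xy_poly set set"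
  where "Ibar = Idl\<^bsub>Rbar\<^esub> ((\<lambda>p. Sq +>\<^bsub>polyR\<^esub> p) ` minors_ideal)"

text \<open>The unit of the multiplicative structure \<^const>\<open>ideals_set\<close> is the whole ring, so \<open>Ibar_pow 0\<close> is \<open>Rbar\<close>.\<close>

definition Ibar_pow :: "nat \<Rightarrow> ('k::comm_ring_1, 'n) xy_poly set set"
  where "Ibar_pow d = Ibar [^]\<^bsub>ideals_set Rbar\<^esub> d"

text \<open>
  The module \<open>Ibar^d / Ibar^(d+1)\<close> is a set of cosets of \<open>Ibar^(d+1)\<close>, hence sits inside the
  quotient ring \<open>Rbar / Ibar^(d+1)\<close>, a \<open>\<k>\<close>-algebra from which it inherits its addition and scalar
  multiplication.
\<close>

type_synonym ('k, 'n) gr_elem = "('k, 'n) xy_poly set set"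

definition gr_ring :: "nat \<Rightarrow> ('k::comm_ring_1, 'n) gr_elem ring"
  where "gr_ring d = Rbar Quot (Ibar_pow (Suc d))"

definition gr_scalar :: "nat \<Rightarrow> 'k::comm_ring_1 \<Rightarrow> ('k, 'n) gr_elem"
  where "gr_scalar d c = Ibar_pow (Suc d) +>\<^bsub>Rbar\<^esub> (Sq +>\<^bsub>polyR\<^esub> Const c)"

definition gr_comp :: "nat \<Rightarrow> nat \<Rightarrow> nat \<Rightarrow> ('k::comm_ring_1, 'n::finite) gr_elem set"
  where "gr_comp d a b = (\<lambda>f. Ibar_pow (Suc d) +>\<^bsub>Rbar\<^esub> f) ` (Ibar_pow d \<inter> Rbar_comp a b)"


section \<open>The action of \<open>GL\<^sub>n\<close> and characters\<close>

text \<open>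
  The standard representation: \<open>g e\<^sub>i = (\<Sum>j. g\<^sub>j\<^sub>i e\<^sub>j)\<close>, applied to the \<open>x\<^sub>i\<close> and to the \<open>y\<^sub>i\<close>, and
  extended to an algebra endomorphism. (It is an action of the group when \<open>g\<close> ranges over invertible matrices.)
\<close>

primrec act_Var :: "'k::comm_ring_1 ^ 'n ^ 'n \<Rightarrow> 'n + 'n \<Rightarrow> ('k, 'n::finite) xy_poly"
  where
    "act_Var g (Inl i) = (\<Sum>j\<in>UNIV. Const (g $ j $ i) * xvar j)"
  | "act_Var g (Inr i) = (\<Sum>j\<in>UNIV. Const (g $ j $ i) * yvar j)"

definition act_R :: "'k::comm_ring_1 ^ 'n ^ 'n \<Rightarrow> ('k, 'n::finite) xy_poly \<Rightarrow> ('k, 'n) xy_poly"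
  where "act_R g p = (\<Sum>m\<in>Poly_Mapping.keys p.
    Const (Poly_Mapping.lookup p m) * (\<Prod>v\<in>UNIV. act_Var g v ^ Poly_Mapping.lookup m v))"

text \<open>
  The induced actions on cosets are by direct image: \<open>g (J + p) = J + g p\<close> as sets, since an
  invertible \<open>g\<close> maps the ideals involved onto themselves. (That \<^const>\<open>Sq\<close> is stable uses \<open>char \<k> = 2\<close>.)
\<close>

definition act_gr :: "'k::comm_ring_1 ^ 'n ^ 'n \<Rightarrow> ('k, 'n::finite) gr_elem \<Rightarrow> ('k, 'n) gr_elem"
  where "act_gr g = (`) ((`) (act_R g))"

definition diag_mat :: "('n \<Rightarrow> 'k::zero) \<Rightarrow> 'k ^ 'n ^ 'n"
  where "diag_mat t = (\<chi> i j. if i = j then t i else 0)"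

text \<open>
  In the next two definitions, \<open>V\<close> is a subspace of a \<open>\<k>\<close>-algebra \<open>A\<close> with structure map \<open>\<iota>\<close>, and \<open>\<rho>\<close> is
  a \<open>GL\<^sub>n\<close>-action preserving \<open>V\<close>. Characters are taken in \<open>\<int>[t\<^sub>1, ..., t\<^sub>n]\<close>, so weights are
  nonnegative; the representations considered here have no others.
\<close>

definition weight_space ::
  "('v, 'c) ring_scheme \<Rightarrow> ('k::field \<Rightarrow> 'v) \<Rightarrow> ('k ^ 'n ^ 'n \<Rightarrow> 'v \<Rightarrow> 'v) \<Rightarrow> 'v set
    \<Rightarrow> ('n::finite \<Rightarrow>\<^sub>0 nat) \<Rightarrow> 'v set"
  where "weight_space A \<iota> \<rho> V \<mu> = {v \<in> V. \<forall>t. (\<forall>i. t i \<noteq> 0) \<longrightarrow>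
    \<rho> (diag_mat t) v = \<iota> (\<Prod>i\<in>UNIV. t i ^ Poly_Mapping.lookup \<mu> i) \<otimes>\<^bsub>A\<^esub> v}"

type_synonym 'n t_poly = "('n \<Rightarrow>\<^sub>0 nat) \<Rightarrow>\<^sub>0 int"

definition gl_character ::
  "('v, 'c) ring_scheme \<Rightarrow> ('k::field \<Rightarrow> 'v) \<Rightarrow> ('k ^ 'n ^ 'n \<Rightarrow> 'v \<Rightarrow> 'v) \<Rightarrow> 'v set
    \<Rightarrow> 'n::finite t_poly"
  where "gl_character A \<iota> \<rho> V = (\<Sum>\<mu> | weight_space A \<iota> \<rho> V \<mu> \<noteq> {\<zero>\<^bsub>A\<^esub>}.
    Poly_Mapping.single \<mu> (int (ring.dim A (range \<iota>) (weight_space A \<iota> \<rho> V \<mu>))))"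


section \<open>Truncated symmetric polynomials\<close>

definition h2 :: "int \<Rightarrow> 'n::finite t_poly"
  where "h2 m = (\<Sum>e | (\<Sum>j\<in>UNIV. int (Poly_Mapping.lookup e j)) = m \<and> (\<forall>j. Poly_Mapping.lookup e j < 2).
    Poly_Mapping.single e 1)"

definition s2 :: "int \<Rightarrow> int \<Rightarrow> 'n::finite t_poly"
  where "s2 u v = det (vector [vector [h2 u, h2 (u + 1)],
                               vector [h2 (v - 1), h2 v]] :: 'n t_poly ^ 2 ^ 2)"

end

theory Submission
  imports Defs
begin

unbundle no fps_syntax

text \<open>
  Write \<open>z\<^sub>i = x\<^sub>i y\<^sub>i\<close>, and \<open>z\<^sub>D\<close>, \<open>x\<^sub>B\<close>, \<open>y\<^sub>B\<close> for products over index sets. Modulo the squares of the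
  variables, a monomial of weight \<open>\<mu>\<close> survives only if all \<open>\<mu>\<^sub>i \<le> 2\<close>, and then it is
  \<open>z\<^sub>D x\<^bsub>S - B\<^esub> y\<^sub>B\<close> with \<open>D = {i. \<mu>\<^sub>i = 2}\<close>, \<open>S = {i. \<mu>\<^sub>i = 1}\<close> and \<open>B \<subseteq> S\<close>. In bidegree \<open>(a, b)\<close> the
  set \<open>B\<close> has \<open>b - |D|\<close> elements, so the weight space of the quotient by the squares is the space of
  functions \<open>f\<close> on the \<open>(b - |D|)\<close>-subsets of \<open>S\<close>. The theorem amounts to finding, for each \<open>d\<close>, the
  functions whose polynomial lies in the \<open>d\<close>-th power of the ideal of minors.

  In characteristic 2 and modulo the squares, the minors \<open>m\<^sub>i\<^sub>j\<close> satisfy \<open>m\<^sub>i\<^sub>l m\<^sub>l\<^sub>j = z\<^sub>l m\<^sub>i\<^sub>j\<close> and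
  \<open>x\<^sub>l m\<^sub>l\<^sub>i = z\<^sub>l x\<^sub>i\<close>. So each factor \<open>z\<^sub>l\<close> counts as a minor, as long as another minor or variable is there
  to absorb it. Hence, if \<open>S\<close> is nonempty, \<open>z\<^sub>D f\<close> lies in the \<open>d\<close>-th power iff \<open>f\<close> is a combination of
  products of \<open>max (d - |D|) 0\<close> minors on disjoint pairs of indices and variables
  (\<open>minors_power_tensor_poly_iff\<close>). If \<open>S\<close> is empty, only \<open>z\<^sub>l z\<^sub>k = y\<^sub>l x\<^sub>k m\<^sub>l\<^sub>k\<close> is available, one minor is
  lost, and \<open>z\<^sub>D\<close> lies in the \<open>d\<close>-th power iff \<open>d < |D|\<close> (\<open>minors_power_z_iff\<close>). This defect is visible
  only if \<open>a = b = |D|\<close>, and it causes the two exceptional cases of the formula.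

  The span of the products of \<open>p\<close> disjoint minors and variables is the space of all \<open>f\<close> with
  \<open>\<Sum>B \<supseteq> T. f B = 0\<close> whenever \<open>|T| < p\<close> (\<open>minor_span_annih\<close>, \<open>annih_minor_span\<close>), and on the
  \<open>c\<close>-subsets of an \<open>s\<close>-element set it has dimension \<open>(s choose c) - (s choose (p - 1))\<close>, where the
  last term is absent for \<open>p = 0\<close>, as long as there is room for \<open>p\<close> minors (\<open>dim_annih\<close>). Over every
  field, in particular in characteristic 2, both facts follow by removing one index at a time. The
  vanishing of the sums is necessary because the substitution \<open>y\<^sub>i \<mapsto> x\<^sub>i + y\<^sub>i\<close> fixes the minors and, in characteristic 2, preserves the ideal of
  squares, whereas elements of the \<open>d\<close>-th power have \<open>y\<close>-degree at least \<open>d\<close> modulo the squares: the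
  sums are the coefficients of \<open>f\<close> after the substitution (\<open>annih_of_minors_power\<close>).

  Two more ingredients complete the proof. The ideals are homogeneous for the weights and the field
  is infinite, so the weight spaces of the graded pieces consist of classes of weight vectors
  (\<open>weight_space_gr_comp\<close>). The coefficient of \<open>s2 u v\<close> at \<open>\<mu>\<close> is
  \<open>(s choose (v - |D|)) - (s choose (v - |D| - 1))\<close> with \<open>s = |S|\<close>, and the alternating sums of these
  numbers telescope (\<open>lookup_s2\<close>, \<open>alternating_sum_int_choose\<close>).
\<close>

section \<open>Multilinear tensors and the span of products of minors\<close>

text \<open>
  A vector \<open>f\<close> indexed by subsets encodes the multilinear polynomial \<open>\<Sum>B. f B * x\<^bsub>S - B\<^esub> * y\<^sub>B\<close>. The set
  \<open>S\<close> is not recorded in the vector, so multiplication by \<open>x\<^sub>i\<close> is the identity on vectors supported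
  away from \<open>i\<close>; on other vectors, \<open>tensor_x i\<close> extracts the part of the polynomial divisible by \<open>x\<^sub>i\<close>.
\<close>

definition tensor_x :: "'n \<Rightarrow> 'k::field ^ 'n set \<Rightarrow> 'k ^ 'n::finite set"
  where "tensor_x i f = (\<chi> B. if i \<in> B then 0 else f $ B)"

definition tensor_y :: "'n \<Rightarrow> 'k::field ^ 'n set \<Rightarrow> 'k ^ 'n::finite set"
  where "tensor_y i f = (\<chi> B. if i \<in> B then f $ (B - {i}) else 0)"

definition tensor_minor :: "'n \<Rightarrow> 'n \<Rightarrow> 'k::field ^ 'n set \<Rightarrow> 'k ^ 'n::finite set"
  where "tensor_minor i j f = tensor_x i (tensor_y j f) - tensor_x j (tensor_y i f)"

definition supported :: "nat \<Rightarrow> 'n set \<Rightarrow> 'k::field ^ 'n::finite set \<Rightarrow> bool"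
  where "supported b S f \<longleftrightarrow> (\<forall>B. f $ B \<noteq> 0 \<longrightarrow> B \<subseteq> S \<and> card B = b)"

text \<open>
  The coefficient at \<open>T\<close> of the encoded polynomial after the substitution \<open>y\<^sub>i \<mapsto> x\<^sub>i + y\<^sub>i\<close>; equivalently,
  the pairing of \<open>f\<close> with the monomial function \<open>B \<mapsto> [T \<subseteq> B]\<close>.
\<close>

definition upsum :: "'n set \<Rightarrow> 'k::field ^ 'n::finite set \<Rightarrow> 'k"
  where "upsum T f = (\<Sum>B | T \<subseteq> B. f $ B)"

text \<open>
  These are the functions on the \<open>b\<close>-subsets of \<open>S\<close> orthogonal to all polynomial functions of degree
  less than \<open>p\<close>.
\<close>

definition annih :: "nat \<Rightarrow> nat \<Rightarrow> 'n set \<Rightarrow> ('k::field ^ 'n::finite set) set"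
  where "annih p b S = {f. supported b S f \<and> (\<forall>T. card T < p \<longrightarrow> upsum T f = 0)}"

text \<open>
  The span of the products of \<open>p\<close> minors on disjoint pairs of indices and one variable for each of the
  remaining indices of \<open>S\<close>, in \<open>y\<close>-degree \<open>b\<close>. The arbitrary constant in the rule \<open>const\<close> makes it closed
  under scalars.
\<close>

inductive minor_span :: "nat \<Rightarrow> nat \<Rightarrow> 'n set \<Rightarrow> 'k::field ^ 'n::finite set \<Rightarrow> bool" where
  zero: "minor_span p b S 0"
| const: "minor_span 0 0 {} (\<chi> B. if B = {} then c else 0)"
| x: "minor_span p b S f \<Longrightarrow> i \<notin> S \<Longrightarrow> minor_span p b (insert i S) (tensor_x i f)"
| y: "minor_span p b S f \<Longrightarrow> i \<notin> S \<Longrightarrow> minor_span p (Suc b) (insert i S) (tensor_y i f)"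
| minor: "minor_span p b S f \<Longrightarrow> i \<notin> S \<Longrightarrow> j \<notin> S \<Longrightarrow> i \<noteq> j
    \<Longrightarrow> minor_span (Suc p) (Suc b) (insert i (insert j S)) (tensor_minor i j f)"
| add: "minor_span p b S f \<Longrightarrow> minor_span p b S g \<Longrightarrow> minor_span p b S (f + g)"

lemma supported_zero [simp]: "supported b S 0"
  by (simp add: supported_def)

lemma supported_add: "supported b S f \<Longrightarrow> supported b S g \<Longrightarrow> supported b S (f + g)"
  unfolding supported_def by (metis add.right_neutral vector_add_component)

lemma supported_diff: "supported b S f \<Longrightarrow> supported b S g \<Longrightarrow> supported b S (f - g)"
  unfolding supported_def by (metis diff_0_right vector_minus_component)

lemma upsum_add: "upsum T (f + g) = upsum T f + upsum T g"
  by (simp add: upsum_def sum.distrib)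

lemma upsum_diff: "upsum T (f - g) = upsum T f - upsum T g"
  by (simp add: upsum_def sum_subtractf)

lemma upsum_zero [simp]: "upsum T 0 = 0"
  by (simp add: upsum_def)

lemma subspace_annih: "vec.subspace (annih p b S)"
  unfolding vec.subspace_def annih_def
  by (auto simp: supported_add upsum_add)
    (auto simp: supported_def upsum_def simp flip: sum_distrib_left)

lemma supported_off: "supported b S f \<Longrightarrow> i \<notin> S \<Longrightarrow> i \<in> B \<Longrightarrow> f $ B = 0"
  unfolding supported_def by blast

lemma supported_tensor_x: "supported b S f \<Longrightarrow> supported b (insert i S) (tensor_x i f)"
  unfolding supported_def tensor_x_def by auto

lemma supported_tensor_y:
  assumes "supported b S f" "i \<notin> S"
  shows "supported (Suc b) (insert i S) (tensor_y i f)"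
  unfolding supported_def
proof (intro allI impI)
  fix B assume "tensor_y i f $ B \<noteq> 0"
  then have i: "i \<in> B" and "f $ (B - {i}) \<noteq> 0"
    by (auto simp: tensor_y_def split: if_splits)
  then have "B - {i} \<subseteq> S \<and> card (B - {i}) = b" using assms by (auto simp: supported_def)
  moreover have "card B = Suc (card (B - {i}))" using i card_Suc_Diff1[of B i] by simp
  ultimately show "B \<subseteq> insert i S \<and> card B = Suc b" by auto
qed

lemma upsum_tensor_x:
  assumes "supported b S f" "i \<notin> S"
  shows "upsum T (tensor_x i f) = (if i \<in> T then 0 else upsum T f)"
proof (cases "i \<in> T")
  case True
  then show ?thesis by (auto simp: upsum_def tensor_x_def intro!: sum.neutral)
next
  case False
  have "tensor_x i f $ B = f $ B" for B
    using supported_off[OF assms] by (simp add: tensor_x_def)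
  then show ?thesis using False by (simp add: upsum_def)
qed

lemma upsum_tensor_y:
  assumes "supported b S f" "i \<notin> S"
  shows "upsum T (tensor_y i f) = upsum (T - {i}) f"
proof -
  have "upsum T (tensor_y i f) = (\<Sum>B | T \<subseteq> B \<and> i \<in> B. f $ (B - {i}))"
    unfolding upsum_def tensor_y_def by (rule sum.mono_neutral_cong_right) auto
  also have "\<dots> = (\<Sum>B | T - {i} \<subseteq> B \<and> i \<notin> B. f $ B)"
    by (rule sum.reindex_bij_witness[where i="insert i" and j="\<lambda>B. B - {i}"]) auto
  also have "\<dots> = upsum (T - {i}) f"
    unfolding upsum_def by (rule sum.mono_neutral_left) (auto intro: supported_off[OF assms])
  finally show ?thesis .
qed

lemma supported_tensor_minor:
  assumes "supported b S f" "i \<notin> S" "j \<notin> S" "i \<noteq> j"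
  shows "supported (Suc b) (insert i (insert j S)) (tensor_minor i j f)"
proof -
  have "supported (Suc b) (insert i (insert j S)) (tensor_x i (tensor_y j f))"
    using assms by (intro supported_tensor_x supported_tensor_y)
  moreover have "supported (Suc b) (insert j (insert i S)) (tensor_x j (tensor_y i f))"
    using assms by (intro supported_tensor_x supported_tensor_y)
  ultimately show ?thesis unfolding tensor_minor_def by (simp add: supported_diff insert_commute)
qed

lemma upsum_tensor_minor:
  assumes "supported b S f" "i \<notin> S" "j \<notin> S" "i \<noteq> j"
  shows "upsum T (tensor_minor i j f) =
    (if i \<in> T then 0 else upsum (T - {j}) f) - (if j \<in> T then 0 else upsum (T - {i}) f)"
proof -
  have "upsum T (tensor_x i (tensor_y j f)) = (if i \<in> T then 0 else upsum (T - {j}) f)"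
    using upsum_tensor_x[OF supported_tensor_y[OF assms(1,3)], of i T] upsum_tensor_y[OF assms(1,3), of T] assms
    by auto
  moreover have "upsum T (tensor_x j (tensor_y i f)) = (if j \<in> T then 0 else upsum (T - {i}) f)"
    using upsum_tensor_x[OF supported_tensor_y[OF assms(1,2)], of j T] upsum_tensor_y[OF assms(1,2), of T] assms
    by auto
  ultimately show ?thesis by (simp add: tensor_minor_def upsum_diff)
qed

text \<open>
  A set \<open>T\<close> with fewer than \<open>p\<close> elements misses one of the \<open>p\<close> disjoint pairs \<open>{i, j}\<close>, and exchanging
  \<open>i\<close> and \<open>j\<close> reverses the sign of the terms in the sum over \<open>B \<supseteq> T\<close>.
\<close>

lemma minor_span_annih: "minor_span p b S f \<Longrightarrow> f \<in> annih p b S"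
proof (induction rule: minor_span.induct)
  case (zero p b S)
  then show ?case by (simp add: annih_def)
next
  case (const c)
  then show ?case by (auto simp: annih_def supported_def)
next
  case (x p b S f i)
  then show ?case
    using supported_tensor_x[of b S f i] upsum_tensor_x[of b S f i] by (auto simp: annih_def)
next
  case (y p b S f i)
  then have "upsum T (tensor_y i f) = 0" if "card T < p" for T
    using upsum_tensor_y[of b S f i T] that le_less_trans[OF card_Diff1_le[of T i]] by (auto simp: annih_def)
  then show ?case using y supported_tensor_y[of b S f i] by (auto simp: annih_def)
next
  case (minor p b S f i j)
  have "upsum T (tensor_minor i j f) = 0" if "card T < Suc p" for T
  proof -
    have "k \<in> T \<Longrightarrow> upsum (T - {k}) f = 0" for k
      using minor.IH that card_Suc_Diff1[of T k] by (auto simp: annih_def)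
    then show ?thesis
      using upsum_tensor_minor[of b S f i j T] minor by (auto simp: annih_def)
  qed
  then show ?case using minor supported_tensor_minor[of b S f i j] by (auto simp: annih_def)
next
  case (add p b S f g)
  then show ?case by (auto simp: annih_def supported_add upsum_add)
qed

text \<open>
  The coefficient of \<open>y\<^sub>i\<close> in the encoded polynomial; the part divisible by \<open>x\<^sub>i\<close> is given by \<open>tensor_x i\<close>.
\<close>

definition y_part :: "'n \<Rightarrow> 'k::field ^ 'n set \<Rightarrow> 'k ^ 'n::finite set"
  where "y_part i f = (\<chi> B. if i \<in> B then 0 else f $ insert i B)"

text \<open>
  Because \<open>p + b < card S\<close>, each generator contains a factor \<open>x\<^sub>i\<close> outside its minors. After
  multiplication by \<open>y\<^sub>s\<close>, replacing \<open>x\<^sub>i y\<^sub>s\<close> by the minor of \<open>i\<close> and \<open>s\<close> changes only terms divisible by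
  \<open>x\<^sub>s\<close>.
\<close>

lemma minor_span_lift:
  assumes "minor_span p b S h" "p + b < card S" "s \<notin> S"
  shows "\<exists>g. minor_span (Suc p) (Suc b) (insert s S) (tensor_y s h - tensor_x s g)"
  using assms
proof (induction rule: minor_span.induct)
  case (zero p b S)
  have "tensor_y s 0 - tensor_x s 0 = 0"
    by (simp add: vec_eq_iff tensor_y_def tensor_x_def)
  then show ?case by (metis minor_span.zero)
next
  case (const c)
  then show ?case by simp
next
  case (x p b S f i)
  have eq: "tensor_y s (tensor_x i f) - tensor_x s (tensor_y i f) = tensor_minor i s f"
    using x by (auto simp: vec_eq_iff tensor_minor_def tensor_y_def tensor_x_def)
  show ?case
    using minor_span.minor[OF x(1), of i s] x eq by (metis insert_iff insert_commute)
next
  case (y p b S f i)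
  then obtain g where "minor_span (Suc p) (Suc b) (insert s S) (tensor_y s f - tensor_x s g)" by auto
  then have "minor_span (Suc p) (Suc (Suc b)) (insert i (insert s S)) (tensor_y i (tensor_y s f - tensor_x s g))"
    using y by (intro minor_span.y) auto
  moreover have "tensor_y i (tensor_y s f - tensor_x s g) = tensor_y s (tensor_y i f) - tensor_x s (tensor_y i g)"
    using y by (auto simp: vec_eq_iff tensor_y_def tensor_x_def Diff_insert2[symmetric] insert_commute)
  ultimately show ?case by (metis insert_commute)
next
  case (minor p b S f i j)
  then obtain g where "minor_span (Suc p) (Suc b) (insert s S) (tensor_y s f - tensor_x s g)" by auto
  then have "minor_span (Suc (Suc p)) (Suc (Suc b)) (insert i (insert j (insert s S)))
      (tensor_minor i j (tensor_y s f - tensor_x s g))"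
    using minor by (intro minor_span.minor) auto
  moreover have "tensor_minor i j (tensor_y s f - tensor_x s g)
      = tensor_y s (tensor_minor i j f) - tensor_x s (tensor_minor i j g)"
    using minor by (auto simp: vec_eq_iff tensor_minor_def tensor_y_def tensor_x_def Diff_insert2[symmetric] insert_commute)
  ultimately show ?case by (metis insert_commute)
next
  case (add p b S f g)
  then obtain f' g' where "minor_span (Suc p) (Suc b) (insert s S) (tensor_y s f - tensor_x s f')"
    "minor_span (Suc p) (Suc b) (insert s S) (tensor_y s g - tensor_x s g')" by auto
  then have "minor_span (Suc p) (Suc b) (insert s S)
      ((tensor_y s f - tensor_x s f') + (tensor_y s g - tensor_x s g'))"
    by (rule minor_span.add)
  moreover have "(tensor_y s f - tensor_x s f') + (tensor_y s g - tensor_x s g')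
    = tensor_y s (f + g) - tensor_x s (f' + g')"
    by (auto simp: vec_eq_iff tensor_y_def tensor_x_def)
  ultimately show ?case by metis
qed

lemma x_y_parts: "f = tensor_y s (y_part s f) + tensor_x s (tensor_x s f)"
  by (auto simp: vec_eq_iff tensor_y_def tensor_x_def y_part_def insert_absorb)

lemma eq_tensor_x:
  assumes "y_part s f = 0"
  shows "f = tensor_x s f"
proof -
  have "f $ B = 0" if "s \<in> B" for B
  proof -
    have "f $ B = y_part s f $ (B - {s})" using that by (simp add: y_part_def insert_absorb)
    then show ?thesis using assms by simp
  qed
  then show ?thesis by (auto simp: vec_eq_iff tensor_x_def)
qed

lemma supported_tensor_x_restrict: "supported b (insert s S) f \<Longrightarrow> supported b S (tensor_x s f)"
  unfolding supported_def tensor_x_def by (auto; blast)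

lemma supported_y_part:
  assumes "supported (Suc b) (insert s S) f" "s \<notin> S"
  shows "supported b S (y_part s f)"
  unfolding supported_def
proof (intro allI impI)
  fix B assume "y_part s f $ B \<noteq> 0"
  then have "s \<notin> B" "f $ insert s B \<noteq> 0" by (auto simp: y_part_def split: if_splits)
  moreover from this have "insert s B \<subseteq> insert s S \<and> card (insert s B) = Suc b"
    using assms by (auto simp: supported_def)
  ultimately show "B \<subseteq> S \<and> card B = b" by auto
qed

lemma y_part_0: "supported 0 S f \<Longrightarrow> y_part s f = 0"
  by (auto simp: vec_eq_iff y_part_def supported_def)

lemma upsum_y_part: "upsum T (y_part s f) = (if s \<in> T then 0 else upsum (insert s T) f)"
proof (cases "s \<in> T")
  case True
  then show ?thesis by (auto simp: upsum_def y_part_def intro!: sum.neutral)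
next
  case False
  have "upsum T (y_part s f) = (\<Sum>B | T \<subseteq> B \<and> s \<notin> B. f $ insert s B)"
    unfolding upsum_def y_part_def by (rule sum.mono_neutral_cong_right) auto
  also have "\<dots> = (\<Sum>B | insert s T \<subseteq> B. f $ B)"
    using False by (intro sum.reindex_bij_witness[where i="\<lambda>B. B - {s}" and j="insert s"]) auto
  finally show ?thesis using False by (simp add: upsum_def)
qed

lemma upsum_tensor_x_restrict: "upsum T (tensor_x s f) = (if s \<in> T then 0 else upsum T f - upsum (insert s T) f)"
proof (cases "s \<in> T")
  case True
  then show ?thesis by (auto simp: upsum_def tensor_x_def intro!: sum.neutral)
next
  case False
  have "upsum T f = sum (($) f) ({B. T \<subseteq> B \<and> s \<notin> B} \<union> {B. insert s T \<subseteq> B})"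
    unfolding upsum_def by (rule sum.cong) auto
  also have "\<dots> = sum (($) f) {B. T \<subseteq> B \<and> s \<notin> B} + upsum (insert s T) f"
    unfolding upsum_def by (rule sum.union_disjoint) auto
  also have "sum (($) f) {B. T \<subseteq> B \<and> s \<notin> B} = upsum T (tensor_x s f)"
    unfolding upsum_def tensor_x_def by (rule sum.mono_neutral_cong_left) auto
  finally show ?thesis using False by simp
qed

lemma annih_y_part:
  assumes "f \<in> annih (Suc p) (Suc b) (insert s S)" "s \<notin> S"
  shows "y_part s f \<in> annih p b S"
  using assms supported_y_part[of b s S f] unfolding annih_def
  by (auto simp: upsum_y_part card_insert_if)

lemma annih_tensor_x:
  assumes "f \<in> annih (Suc p) b (insert s S)"
  shows "tensor_x s f \<in> annih p b S"
  using assms supported_tensor_x_restrict[of b s S f] unfolding annih_def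
  by (auto simp: upsum_tensor_x_restrict card_insert_if)

lemma annih_empty: "f \<in> annih p b {} \<Longrightarrow> p + b > 0 \<Longrightarrow> f = 0"
proof -
  assume f: "f \<in> annih p b {}" and pb: "p + b > 0"
  have "f $ B = 0" for B
  proof (rule ccontr)
    assume *: "f $ B \<noteq> 0"
    then have B: "B = {}" "b = 0" using f by (auto simp: annih_def supported_def)
    then have "upsum {} f = 0" using f pb by (auto simp: annih_def)
    moreover have "upsum {} f = (\<Sum>B\<in>{{}}. f $ B)"
      unfolding upsum_def using f by (intro sum.mono_neutral_right) (auto simp: annih_def supported_def)
    ultimately show False using B * by simp
  qed
  then show ?thesis by (simp add: vec_eq_iff)
qed

lemma annih_support_0: 
  assumes "f \<in> annih (Suc p) 0 S" shows "f = 0"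
proof -
  have "f \<in> annih (Suc p) 0 {}" using assms by (auto simp: annih_def supported_def)
  then show ?thesis using annih_empty by blast
qed

text \<open>
  The hypothesis says that the \<open>x\<close>-degree \<open>card S - b\<close> is less than \<open>p\<close>. Passing to the part divisible by
  \<open>x\<^sub>s\<close> lowers both numbers by one, so that part vanishes by induction. Then adding \<open>s\<close> to \<open>T\<close> does not
  change the sum over \<open>B \<supseteq> T\<close>, and the coefficient of \<open>y\<^sub>s\<close> satisfies the conditions for the same \<open>p\<close>.
\<close>

lemma annih_eq_0:
  assumes "f \<in> annih p b S" "card S < p + b"
  shows "f = 0"
  using finite[of S] assms
proof (induction S arbitrary: f p b rule: finite_induct)
  case empty
  then show ?case using annih_empty by auto
next
  case (insert s S)
  show ?case
  proof (cases p)
    case 0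
    have "f $ B = 0" for B
    proof (rule ccontr)
      assume "f $ B \<noteq> 0"
      then have "B \<subseteq> insert s S" "card B = b" using insert.prems by (auto simp: annih_def supported_def)
      then show False using insert.prems 0 card_mono[of "insert s S" B] by auto
    qed
    then show ?thesis by (simp add: vec_eq_iff)
  next
    case (Suc q)
    have x0: "tensor_x s f = 0"
      using insert.prems insert.hyps Suc
      by (intro insert.IH[OF annih_tensor_x]) auto
    show ?thesis
    proof (cases b)
      case 0
      then show ?thesis using insert.prems Suc annih_support_0 by blast
    next
      case (Suc c)
      have "upsum T (y_part s f) = 0" if "card T < p" for T
      proof (cases "s \<in> T")
        case False
        then have "upsum (insert s T) f = upsum T f" using upsum_tensor_x_restrict[of T s f] x0 by simp
        then show ?thesis using False insert.prems that by (simp add: upsum_y_part annih_def)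
      qed (simp add: upsum_y_part)
      then have "y_part s f \<in> annih p c S"
        using insert supported_y_part[of c s S f] Suc by (simp add: annih_def)
      then have "y_part s f = 0" using insert Suc by (intro insert.IH) auto
      then show ?thesis using x0 eq_tensor_x by metis
    qed
  qed
qed

lemma annih_of_y_part_0:
  assumes "f \<in> annih p b (insert s S)" "y_part s f = 0"
  shows "f \<in> annih p b S"
proof -
  have "supported b S f"
    using supported_tensor_x_restrict[of b s S f] assms eq_tensor_x[OF assms(2)] by (simp add: annih_def)
  then show ?thesis using assms(1) by (simp add: annih_def)
qed

text \<open>
  By induction, the coefficient of \<open>y\<^sub>s\<close> in \<open>f\<close> is a combination of products with \<open>p - 1\<close> minors. A lift
  of it can be subtracted from \<open>f\<close>, and what remains does not contain \<open>y\<^sub>s\<close>. If the \<open>x\<close>-degree is too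
  small for a lift, then \<open>f = 0\<close>.
\<close>

lemma annih_minor_span:
  fixes f :: "'k::field ^ 'n::finite set"
  assumes "f \<in> annih p b S"
  shows "minor_span p b S f"
  using finite[of S] assms
proof (induction S arbitrary: f p b rule: finite_induct)
  case empty
  show ?case
  proof (cases "p + b = 0")
    case True
    then have "f = (\<chi> B. if B = {} then f $ {} else 0)"
      using empty by (auto simp: vec_eq_iff annih_def supported_def)
    then show ?thesis using True minor_span.const by (metis add_is_0)
  next
    case False
    then show ?thesis using annih_empty[OF empty] minor_span.zero by (metis gr0I)
  qed
next
  case (insert s S)
  have xrule: "minor_span p b (insert s S) g" if "g \<in> annih p b S" for g :: "'k ^ 'n set" and p b
  proof -
    have "g = tensor_x s g"
      using that insert.hyps supported_off[of b S g s] by (auto simp: vec_eq_iff tensor_x_def annih_def)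
    then show ?thesis using minor_span.x[OF insert.IH[OF that] insert.hyps(2)] by metis
  qed
  show ?case
  proof (cases p)
    case 0
    have x: "tensor_x s f \<in> annih 0 b S"
      using insert.prems supported_tensor_x_restrict by (auto simp: annih_def)
    have "minor_span 0 b (insert s S) (tensor_y s (y_part s f))"
    proof (cases b)
      case 0
      then have "y_part s f = 0" using insert.prems y_part_0 by (auto simp: annih_def)
      then have "tensor_y s (y_part s f) = 0" by (simp add: vec_eq_iff tensor_y_def)
      then show ?thesis using minor_span.zero by metis
    next
      case (Suc c)
      then have "y_part s f \<in> annih 0 c S"
        using insert supported_y_part[of c s S f] by (auto simp: annih_def)
      then show ?thesis using minor_span.y[OF insert.IH, of "y_part s f" 0 c s] insert Suc by auto
    qed
    then show ?thesis
      using minor_span.add[OF _ minor_span.x[OF insert.IH[OF x] insert.hyps(2)]] x_y_parts[of f s] 0 by metis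
  next
    case (Suc q)
    show ?thesis
    proof (cases b)
      case 0
      then show ?thesis using insert.prems Suc annih_support_0 minor_span.zero by blast
    next
      case (Suc c)
      have y: "y_part s f \<in> annih q c S" using insert annih_y_part Suc \<open>p = Suc q\<close> by blast
      show ?thesis
      proof (cases "q + c < card S")
        case True
        then obtain g where g: "minor_span p b (insert s S) (tensor_y s (y_part s f) - tensor_x s g)" (is "minor_span _ _ _ ?g")
          using minor_span_lift[OF insert.IH[OF y]] insert.hyps Suc \<open>p = Suc q\<close> by blast
        \<comment> \<open>The lift and \<open>f\<close> have the same coefficient of \<open>y\<^sub>s\<close>.\<close>
        have "y_part s (f - ?g) = 0"
          by (auto simp: vec_eq_iff y_part_def tensor_y_def tensor_x_def)
        moreover have "f - ?g \<in> annih p b (insert s S)"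
          using minor_span_annih[OF g] insert.prems subspace_annih vec.subspace_diff by blast
        ultimately have "minor_span p b (insert s S) (f - ?g)"
          using annih_of_y_part_0 xrule by blast
        then show ?thesis using minor_span.add[OF g, of "f - ?g"] by simp
      next
        case False
        then have "f = 0" using insert \<open>p = Suc q\<close> Suc by (intro annih_eq_0) auto
        then show ?thesis using minor_span.zero by simp
      qed
    qed
  qed
qed

lemma y_part_annih_surj:
  assumes "h \<in> annih p b S" "p + b < card S" "s \<notin> S"
  shows "\<exists>f \<in> annih (Suc p) (Suc b) (insert s S). y_part s f = h"
proof -
  obtain g where g: "minor_span (Suc p) (Suc b) (insert s S) (tensor_y s h - tensor_x s g)"
    using minor_span_lift[OF annih_minor_span] assms by blast
  moreover have "y_part s (tensor_y s h - tensor_x s g) = h"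
    using assms supported_off[of b S h s] by (auto simp: vec_eq_iff y_part_def tensor_y_def tensor_x_def annih_def)
  ultimately show ?thesis using minor_span_annih by blast
qed

lemma basis_extension:
  assumes "vec.subspace N" "vec.subspace U" "N \<subseteq> U"
  obtains B C where "B \<inter> C = {}" "vec.independent (B \<union> C)" "vec.span B = N" "vec.span (B \<union> C) = U"
    "card B = vec.dim N" "card C + vec.dim N = vec.dim U"
proof -
  obtain B where B: "B \<subseteq> N" "vec.independent B" "N \<subseteq> vec.span B" "card B = vec.dim N"
    using vec.basis_exists by blast
  obtain B' where B': "B \<subseteq> B'" "B' \<subseteq> U" "vec.independent B'" "U \<subseteq> vec.span B'"
    using vec.maximal_independent_subset_extend[of B U] B assms by blast
  have "finite B'" using B'(3) vec.independent_bound_general by blast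
  have "card B' = vec.dim U" using B' vec.basis_card_eq_dim by blast
  moreover have "card (B' - B) + card B = card B'"
    using B'(1) \<open>finite B'\<close> by (metis card_Diff_subset card_mono finite_subset le_add_diff_inverse2)
  moreover have "vec.span B = N" using B assms vec.span_minimal by blast
  moreover have "vec.span B' = U" using B' assms vec.span_minimal by blast
  ultimately show ?thesis
    using that[of B "B' - B"] B' B by (auto simp: Un_absorb1 Un_Diff_cancel)
qed

lemma dim_kernel_image:
  fixes h :: "'k::field ^ 'm::finite \<Rightarrow> 'k ^ 'l::finite"
  assumes "Vector_Spaces.linear (*s) (*s) h" "vec.subspace U"
  shows "vec.dim U = vec.dim {f \<in> U. h f = 0} + vec.dim (h ` U)"
proof -
  interpret h: Vector_Spaces.linear "(*s)" "(*s)" h by fact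
  let ?N = "{f \<in> U. h f = 0}"
  have N: "vec.subspace ?N"
    using assms(2) by (auto simp: vec.subspace_def h.add h.scale)
  obtain B C where BC: "B \<inter> C = {}" "vec.independent (B \<union> C)" "vec.span B = ?N" "vec.span (B \<union> C) = U"
    "card B = vec.dim ?N" "card C + vec.dim ?N = vec.dim U"
    using basis_extension[OF N assms(2)] by blast
  have indep: "vec.independent B" "vec.independent C"
    using BC(2) vec.independent_mono by blast+
  have U: "U = {x + y |x y. x \<in> vec.span B \<and> y \<in> vec.span C}"
    using vec.span_Un[of B C] BC(4) by auto
  have "vec.dim U + vec.dim (vec.span B \<inter> vec.span C) = vec.dim (vec.span B) + vec.dim (vec.span C)"
    unfolding U by (rule vec.dim_sums_Int) (auto simp: vec.subspace_span)
  then have "vec.dim (vec.span B \<inter> vec.span C) = 0"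
    using BC(5,6) indep by (simp add: vec.dim_eq_card_independent del: vec.dim_eq_0)
  then have "vec.span B \<inter> vec.span C \<subseteq> {0}" by (simp only: vec.dim_eq_0)
  then have "f = 0" if "f \<in> vec.span C" "h f = 0" for f
    using that BC(3,4) vec.span_mono[of C "B \<union> C"] by auto
  then have inj: "inj_on h (vec.span C)"
    by (intro inj_onI) (metis eq_iff_diff_eq_0 h.diff vec.span_diff)
  have "h ` U = h ` vec.span C"
  proof
    show "h ` U \<subseteq> h ` vec.span C"
      unfolding U using BC(3) by (auto simp: h.add)
    show "h ` vec.span C \<subseteq> h ` U"
      using vec.span_mono[of C "B \<union> C"] BC(4) by auto
  qed
  then have "vec.dim (h ` U) = vec.dim (vec.span C)"
    using vec.dim_image_eq[OF assms(1), of "vec.span C"] inj by (simp add: vec.span_span)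
  then show ?thesis using BC(6) indep by (simp add: vec.dim_eq_card_independent)
qed

lemma linear_y_part: "Vector_Spaces.linear (*s) (*s) (y_part s)"
  by unfold_locales (auto simp: vec_eq_iff y_part_def)

lemma dim_annih_empty: "vec.dim (annih 0 0 {} :: ('k::field ^ 'n::finite set) set) = 1"
proof -
  let ?e = "(\<chi> B. if B = {} then 1 else 0) :: 'k ^ 'n set"
  have "annih 0 0 {} = vec.span {?e}"
  proof (intro equalityI subsetI)
    fix f :: "'k ^ 'n set" assume "f \<in> annih 0 0 {}"
    then have "f = f $ {} *s ?e" by (auto simp: vec_eq_iff annih_def supported_def)
    then show "f \<in> vec.span {?e}" by (metis vec.span_base vec.span_scale insertI1)
  next
    have "?e \<in> annih 0 0 {}" by (auto simp: annih_def supported_def)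
    then show "f \<in> annih 0 0 {}" if "f \<in> vec.span {?e}" for f
      using that vec.span_minimal[OF _ subspace_annih, of "{?e}"] by blast
  qed
  moreover have "?e \<noteq> 0" by (auto simp: vec_eq_iff)
  ultimately show ?thesis by (simp add: vec.dim_span)
qed

text \<open>
  Removing an index \<open>s\<close> gives an exact sequence
  \<open>0 \<rightarrow> annih p b S \<rightarrow> annih p b (insert s S) \<rightarrow> annih (p - 1) (b - 1) S \<rightarrow> 0\<close> where the map
  to the third space takes the coefficient of \<open>y\<^sub>s\<close>; the formula is then Pascal's rule. The bounds on \<open>p\<close> include one boundary
  value on each side, where the space is zero and the two binomial coefficients agree.
\<close>

lemma dim_annih:
  assumes "p = 0 \<or> p \<le> Suc b \<and> p + b \<le> Suc (card S)"
  shows "vec.dim (annih p b S :: ('k::field ^ 'n::finite set) set) + (if p = 0 then 0 else card S choose (p - 1))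
    = card S choose b"
  using finite[of S] assms
proof (induction S arbitrary: p b rule: finite_induct)
  case empty
  then consider "p = 0" "b = 0" | "p = 0" "b > 0" | "p = 1" "b = 0" by force
  then show ?case
  proof cases
    case 1
    then show ?thesis using dim_annih_empty by simp
  next
    case 2
    then have "p + b > 0" by simp
    then have "annih p b {} \<subseteq> {0 :: 'k ^ 'n set}" using annih_empty[of _ p b] by blast
    then have "vec.dim (annih p b {} :: ('k ^ 'n set) set) = 0" by (simp only: vec.dim_eq_0)
    then show ?thesis using 2 by (simp del: vec.dim_eq_0)
  next
    case 3
    then have "p + b > 0" by simp
    then have "annih p b {} \<subseteq> {0 :: 'k ^ 'n set}" using annih_empty[of _ p b] by blast
    then have "vec.dim (annih p b {} :: ('k ^ 'n set) set) = 0" by (simp only: vec.dim_eq_0)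
    then show ?thesis using 3 by (simp del: vec.dim_eq_0)
  qed
next
  case (insert s S)
  let ?U = "annih p b (insert s S) :: ('k ^ 'n set) set"
  have cS: "card (insert s S) = Suc (card S)" using insert.hyps by simp
  have ker: "{f \<in> ?U. y_part s f = 0} = annih p b S"
  proof (intro equalityI subsetI)
    fix f :: "'k ^ 'n set" assume f: "f \<in> annih p b S"
    then have "y_part s f = 0"
      using insert.hyps supported_off[of b S f s] by (auto simp: vec_eq_iff y_part_def annih_def)
    then show "f \<in> {f \<in> ?U. y_part s f = 0}" using f by (auto simp: annih_def supported_def)
  qed (use annih_of_y_part_0 in blast)
  have "vec.dim ?U = vec.dim {f \<in> ?U. y_part s f = 0} + vec.dim (y_part s ` ?U)"
    by (rule dim_kernel_image[OF linear_y_part subspace_annih])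
  then have split: "vec.dim ?U = vec.dim (annih p b S :: ('k ^ 'n set) set) + vec.dim (y_part s ` ?U)"
    unfolding ker .
  consider (b0) "b = 0" | (p0) c where "b = Suc c" "p = 0"
    | (lift) q c where "p = Suc q" "b = Suc c" "q + c < card S"
    | (zero) q c where "p = Suc q" "b = Suc c" "\<not> q + c < card S"
    by (metis not0_implies_Suc)
  then show ?case
  proof cases
    case b0
    show ?thesis
    proof (cases "p = 0")
      case True
      have "y_part s ` ?U \<subseteq> {0}" using y_part_0 b0 by (auto simp: annih_def)
      then have "vec.dim (y_part s ` ?U) = 0" by (simp only: vec.dim_eq_0)
      then show ?thesis using insert.IH[of p b] split b0 True by (simp del: vec.dim_eq_0)
    next
      case False
      then have p: "p = Suc 0" using insert.prems b0 by auto
      have "?U \<subseteq> {0}" using annih_support_0 p b0 by auto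
      then have "vec.dim ?U = 0" by (simp only: vec.dim_eq_0)
      then show ?thesis using p b0 by (simp del: vec.dim_eq_0)
    qed
  next
    case p0
    have "y_part s ` ?U = annih 0 c S"
    proof (intro equalityI subsetI)
      show "h \<in> annih 0 c S" if "h \<in> y_part s ` ?U" for h
        using that insert.hyps supported_y_part p0 by (auto simp: annih_def)
    next
      fix h :: "'k ^ 'n set" assume h: "h \<in> annih 0 c S"
      then have "h = y_part s (tensor_y s h)"
        using insert.hyps supported_off[of c S h s] by (auto simp: vec_eq_iff y_part_def tensor_y_def annih_def)
      moreover have "tensor_y s h \<in> ?U"
        using h supported_tensor_y[of c S h s] insert.hyps p0 by (auto simp: annih_def)
      ultimately show "h \<in> y_part s ` ?U" by blast
    qed
    then show ?thesis using insert.IH[of 0 c] insert.IH[of 0 b] split cS p0 by (simp del: vec.dim_eq_0)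
  next
    case lift
    have "y_part s ` ?U = annih q c S"
      using annih_y_part[of _ q c s S] y_part_annih_surj[OF _ lift(3), of _ s] insert.hyps lift by blast
    then have "vec.dim ?U = vec.dim (annih p b S :: ('k ^ 'n set) set) + vec.dim (annih q c S :: ('k ^ 'n set) set)"
      using split by simp
    moreover have "vec.dim (annih p b S :: ('k ^ 'n set) set) + (card S choose q) = card S choose b"
      using insert.IH[of p b] insert.prems lift cS by simp
    moreover have "vec.dim (annih q c S :: ('k ^ 'n set) set) + (if q = 0 then 0 else card S choose (q - 1)) = card S choose c"
      using insert.IH[of q c] insert.prems lift cS by simp
    moreover have "Suc (card S) choose q = (card S choose q) + (if q = 0 then 0 else card S choose (q - 1))"
      by (cases q) simp_all
    ultimately show ?thesis unfolding cS using lift(1,2) by simp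
  next
    case zero
    \<comment> \<open>The boundary case: the \<open>x\<close>-degree is \<open>p - 1\<close>, so the space is zero.\<close>
    then have b: "b = Suc (card S) - q" and "q \<le> Suc (card S)" using insert by auto
    have "card (insert s S) < p + b" using zero cS by simp
    then have "?U \<subseteq> {0}" using annih_eq_0 by blast
    then have "vec.dim ?U = 0" by (simp only: vec.dim_eq_0)
    moreover have "Suc (card S) choose q = Suc (card S) choose b"
      unfolding b by (rule binomial_symmetric) fact
    ultimately show ?thesis using zero(1) cS by simp
  qed
qed

section \<open>Substitution in polynomials\<close>

lemma poly_mapping_sum_single:
  fixes p :: "'a \<Rightarrow>\<^sub>0 'b::comm_monoid_add"
  shows "p = (\<Sum>m\<in>Poly_Mapping.keys p. Poly_Mapping.single m (Poly_Mapping.lookup p m))"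
  by (rule poly_mapping_eqI)
    (auto simp: lookup_sum lookup_single when_def in_keys_iff if_distrib cong: if_cong)

lemma poly_mapping_monomial_induct [case_names zero single add]:
  fixes p :: "'a \<Rightarrow>\<^sub>0 'b::comm_monoid_add"
  assumes "P 0" "\<And>m c. P (Poly_Mapping.single m c)" "\<And>p q. P p \<Longrightarrow> P q \<Longrightarrow> P (p + q)"
  shows "P p"
proof -
  have "P (\<Sum>m\<in>M. Poly_Mapping.single m (Poly_Mapping.lookup p m))" if "finite M" for M
    using that by (induction M) (auto intro: assms)
  then show ?thesis using poly_mapping_sum_single[of p] by (metis finite_keys)
qed

lemma lookup_single_mult:
  fixes p :: "('a::cancel_comm_monoid_add) \<Rightarrow>\<^sub>0 'k::comm_ring_1"
  shows "Poly_Mapping.lookup (Poly_Mapping.single m c * p) (m + n) = c * Poly_Mapping.lookup p n"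
  by (induction p rule: poly_mapping_monomial_induct)
    (auto simp: mult_single lookup_single when_def distrib_left lookup_add)

lemma lookup_single_mult_0:
  fixes p :: "('a::cancel_comm_monoid_add) \<Rightarrow>\<^sub>0 'k::comm_ring_1"
  assumes "\<And>n. l \<noteq> m + n"
  shows "Poly_Mapping.lookup (Poly_Mapping.single m c * p) l = 0"
  using assms by (induction p rule: poly_mapping_monomial_induct)
    (auto simp: mult_single lookup_single when_def distrib_left lookup_add)

lemma lookup_Const_mult: "Poly_Mapping.lookup (Const c * p) m = c * Poly_Mapping.lookup p m"
  using lookup_single_mult[of 0 c p m] by (simp add: Const_def)

lemma Const_mult: "Const (c * d) = Const c * Const d"
  by (simp add: Const_def mult_single)

lemma Const_add: "Const (c + d) = Const c + Const d"
  by (simp add: Const_def single_add)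

lemma Const_diff: "Const (c - d) = Const c - Const d"
  by (simp add: Const_def single_diff)

lemma Const_0 [simp]: "Const 0 = 0"
  by (simp add: Const_def)

lemma Const_1 [simp]: "Const 1 = 1"
  by (simp add: Const_def)

lemma Const_mult_single: "Const c * Poly_Mapping.single m d = Poly_Mapping.single m (c * d)"
  by (simp add: Const_def mult_single)

definition subst :: "('n + 'n \<Rightarrow> ('k, 'n) xy_poly) \<Rightarrow> ('k::comm_ring_1, 'n::finite) xy_poly \<Rightarrow> ('k, 'n) xy_poly"
  where "subst \<phi> p = (\<Sum>m\<in>Poly_Mapping.keys p.
    Const (Poly_Mapping.lookup p m) * (\<Prod>v\<in>UNIV. \<phi> v ^ Poly_Mapping.lookup m v))"

lemma subst_superset:
  assumes "finite M" "Poly_Mapping.keys p \<subseteq> M"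
  shows "subst \<phi> p = (\<Sum>m\<in>M. Const (Poly_Mapping.lookup p m) * (\<Prod>v\<in>UNIV. \<phi> v ^ Poly_Mapping.lookup m v))"
  unfolding subst_def using assms by (intro sum.mono_neutral_left) (auto simp: in_keys_iff)

lemma subst_single:
  "subst \<phi> (Poly_Mapping.single m c) = Const c * (\<Prod>v\<in>UNIV. \<phi> v ^ Poly_Mapping.lookup m v)"
  by (subst subst_superset[where M="{m}"]) auto

lemma subst_add: "subst \<phi> (p + q) = subst \<phi> p + subst \<phi> q"
proof -
  let ?M = "Poly_Mapping.keys p \<union> Poly_Mapping.keys q"
  have "Poly_Mapping.keys (p + q) \<subseteq> ?M" by (rule keys_add)
  then show ?thesis
    by (subst (1 2 3) subst_superset[where M="?M"])
      (auto simp: lookup_add Const_add distrib_right sum.distrib)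
qed

lemma subst_0 [simp]: "subst \<phi> 0 = 0"
  by (simp add: subst_def)

lemma subst_mult: "subst \<phi> (p * q) = subst \<phi> p * subst \<phi> q"
proof (induction p rule: poly_mapping_monomial_induct)
  case (single m c)
  show ?case
    by (induction q rule: poly_mapping_monomial_induct)
      (simp_all add: mult_single subst_single Const_mult lookup_add power_add prod.distrib
        subst_add distrib_left distrib_right mult_ac)
qed (simp_all add: subst_add distrib_right)

lemma subst_diff: "subst \<phi> (p - q) = subst \<phi> p - subst \<phi> q"
  using subst_add[of \<phi> "p - q" q] by simp

lemma subst_Const: "subst \<phi> (Const c) = Const c"
  using subst_single[of \<phi> 0 c] by (simp add: Const_def)

lemma subst_1 [simp]: "subst \<phi> 1 = 1"
  using subst_Const[of \<phi> 1] by simp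

lemma subst_Var: "subst \<phi> (Var v) = \<phi> v"
proof -
  have "(\<Prod>w\<in>UNIV. \<phi> w ^ Poly_Mapping.lookup (Poly_Mapping.single v 1) w) = (\<Prod>w\<in>{v}. \<phi> w)"
    by (rule prod.mono_neutral_cong_right) (auto simp: lookup_single when_def)
  then show ?thesis by (simp add: Var_def subst_single flip: Const_def)
qed

lemma subst_power: "subst \<phi> (p ^ n) = subst \<phi> p ^ n"
  by (induction n) (simp_all add: subst_mult)

lemma subst_sum: "subst \<phi> (\<Sum>a\<in>A. f a) = (\<Sum>a\<in>A. subst \<phi> (f a))"
  by (induction A rule: infinite_finite_induct) (simp_all add: subst_add)

lemma subst_prod: "subst \<phi> (\<Prod>a\<in>A. f a) = (\<Prod>a\<in>A. subst \<phi> (f a))"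
  by (induction A rule: infinite_finite_induct) (simp_all add: subst_mult)

lemma act_R_eq_subst: "act_R g = subst (act_Var g)"
  by (rule ext) (simp add: act_R_def subst_def)

section \<open>Powers of the ideal of minors\<close>

abbreviation minor :: "'n \<Rightarrow> 'n \<Rightarrow> ('k::comm_ring_1, 'n) xy_poly"
  where "minor i j \<equiv> xvar i * yvar j - xvar j * yvar i"

text \<open>
  The polynomials whose class modulo the squares lies in the \<open>d\<close>-th power of the ideal of minors
  (\<open>proj_Ibar_pow_iff\<close>). Adding one minor at a time makes statements about ideal powers provable by rule
  induction.
\<close>

inductive minors_power :: "nat \<Rightarrow> ('k::comm_ring_1, 'n) xy_poly \<Rightarrow> bool" where
  zero: "minors_power 0 p"
| square: "minors_power d (p * Var v ^ 2)"
| minor: "minors_power d p \<Longrightarrow> minors_power (Suc d) (minor i j * p)"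
| add: "minors_power d p \<Longrightarrow> minors_power d q \<Longrightarrow> minors_power d (p + q)"

lemma minors_power_mult: "minors_power d p \<Longrightarrow> minors_power d (r * p)"
proof (induction rule: minors_power.induct)
  case (square d p v)
  then show ?case using minors_power.square[of d "r * p" v] by (simp add: mult.assoc)
next
  case (minor d p i j)
  then show ?case using minors_power.minor[of d "r * p" i j] by (simp add: mult_ac)
qed (auto simp: distrib_left intro: minors_power.intros)

lemma minors_power_mult_right: "minors_power d p \<Longrightarrow> minors_power d (p * r)"
  using minors_power_mult[of d p r] by (simp add: mult.commute)

lemma minors_power_0: "minors_power d 0"
  using minors_power.square[of d 0] by simp

lemma minors_power_diff: "minors_power d p \<Longrightarrow> minors_power d q \<Longrightarrow> minors_power d (p - q)"
  using minors_power.add[of d p "- 1 * q"] minors_power_mult[of d q "-1"] by simp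

lemma minors_power_mult_add:
  "minors_power e q \<Longrightarrow> minors_power d p \<Longrightarrow> minors_power (d + e) (p * q)"
proof (induction arbitrary: p rule: minors_power.induct)
  case (zero q)
  then show ?case by (simp add: minors_power_mult_right)
next
  case (square e q v)
  then show ?case using minors_power.square[of "d + e" "p * q" v] by (simp add: mult.assoc)
next
  case (minor e q i j)
  then show ?case using minors_power.minor[of "d + e" "p * q" i j] by (simp add: mult_ac)
qed (auto simp: distrib_left intro: minors_power.intros)

lemma minors_power_sum:
  "(\<And>a. a \<in> A \<Longrightarrow> minors_power d (f a)) \<Longrightarrow> minors_power d (\<Sum>a\<in>A. f a)"
  by (induction A rule: infinite_finite_induct) (auto intro: minors_power.add minors_power_0)

lemma carrier_polyR [simp]: "carrier polyR = UNIV" "p \<otimes>\<^bsub>polyR\<^esub> q = p * q" "p \<oplus>\<^bsub>polyR\<^esub> q = p + q"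
  "\<zero>\<^bsub>polyR\<^esub> = 0" "\<one>\<^bsub>polyR\<^esub> = 1"
  by (simp_all add: polyR_def ring_of_type_algebra_def)

lemma cring_polyR: "cring (polyR :: ('k::comm_ring_1, 'n) xy_poly ring)"
  unfolding polyR_def by (rule cring_from_type_algebra)

interpretation polyR: cring "polyR :: ('k::comm_ring_1, 'n) xy_poly ring"
  by (rule cring_polyR)

lemma ideal_polyR_I:
  assumes "0 \<in> J" "\<And>p q. p \<in> J \<Longrightarrow> q \<in> J \<Longrightarrow> p + q \<in> J" "\<And>p r. p \<in> J \<Longrightarrow> r * p \<in> J"
  shows "ideal J polyR"
proof (rule idealI)
  show "subgroup J (add_monoid polyR)"
  proof (rule polyR.add.subgroupI)
    fix p assume "p \<in> J"
    then have "- p \<in> J" using assms(3)[of p "-1"] by simp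
    moreover have "\<ominus>\<^bsub>polyR\<^esub> p = - p" by (rule polyR.minus_equality) simp_all
    ultimately show "\<ominus>\<^bsub>polyR\<^esub> p \<in> J" by simp
  qed (use assms in auto)
qed (use assms polyR.ring_axioms in \<open>auto simp: mult.commute\<close>)

lemma ideal_Sq: "ideal Sq polyR"
  unfolding Sq_def by (rule polyR.genideal_ideal) simp

lemma ideal_minors_power: "ideal {p. minors_power d p} polyR"
  by (rule ideal_polyR_I) (auto intro: minors_power_0 minors_power.add minors_power_mult)

lemma Sq_minors_power: "p \<in> Sq \<Longrightarrow> minors_power d p"
proof -
  have "Sq \<subseteq> {p. minors_power d p}"
    unfolding Sq_def using minors_power.square[of d 1]
    by (intro polyR.genideal_minimal[OF ideal_minors_power]) auto
  then show "p \<in> Sq \<Longrightarrow> minors_power d p" by blast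
qed

lemma Sq_square: "p * Var v ^ 2 \<in> Sq"
proof -
  have "Var v ^ 2 \<in> Sq"
    unfolding Sq_def using polyR.genideal_self[of "range (\<lambda>v. Var v ^ 2)"] by auto
  then show ?thesis using ideal.I_l_closed[OF ideal_Sq, of "Var v ^ 2" p] by simp
qed

abbreviation proj :: "('k::comm_ring_1, 'n) xy_poly \<Rightarrow> ('k, 'n) xy_poly set"
  where "proj p \<equiv> Sq +>\<^bsub>polyR\<^esub> p"

lemma proj_hom: "proj \<in> ring_hom polyR Rbar"
  unfolding Rbar_def by (rule ideal.rcos_ring_hom[OF ideal_Sq])

lemma cring_Rbar: "cring (Rbar :: ('k::comm_ring_1, 'n) xy_poly set ring)"
  unfolding Rbar_def by (rule ideal.quotient_is_cring[OF ideal_Sq cring_polyR])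

interpretation Rbar: cring "Rbar :: ('k::comm_ring_1, 'n) xy_poly set ring"
  by (rule cring_Rbar)

lemma proj_simps: 
  "proj (p + q) = proj p \<oplus>\<^bsub>Rbar\<^esub> proj q" "proj (p * q) = proj p \<otimes>\<^bsub>Rbar\<^esub> proj q"
  "\<one>\<^bsub>Rbar\<^esub> = proj 1" "proj p \<in> carrier Rbar"
  using ring_hom_add[OF proj_hom, of p q] ring_hom_mult[OF proj_hom, of p q] ring_hom_one[OF proj_hom]
    ring_hom_closed[OF proj_hom, of p] by auto

lemma carrier_Rbar: "carrier Rbar = range proj"
proof -
  have "carrier Rbar = a_rcosets\<^bsub>polyR\<^esub> Sq" by (simp add: Rbar_def FactRing_def)
  then show ?thesis unfolding A_RCOSETS_def' by auto
qed

lemma mem_proj: "q \<in> proj p \<longleftrightarrow> q - p \<in> Sq"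
proof -
  have "q \<in> proj p \<longleftrightarrow> (\<exists>s\<in>Sq. q = s + p)"
    by (auto simp: a_r_coset_def r_coset_def)
  then show ?thesis by (metis add_diff_cancel diff_add_cancel)
qed

lemma polyR_minus: "p \<ominus>\<^bsub>polyR\<^esub> q = p - q"
proof -
  have "\<ominus>\<^bsub>polyR\<^esub> q = - q" by (rule polyR.minus_equality) simp_all
  then show ?thesis by (simp add: a_minus_def)
qed

lemma proj_eq_iff: "proj p = proj q \<longleftrightarrow> p - q \<in> Sq"
  using polyR.quotient_eq_iff_same_a_r_cos[OF ideal_Sq, of p q] by (simp add: polyR_minus)

lemma zero_Rbar: "\<zero>\<^bsub>Rbar\<^esub> = proj 0"
  using ring_hom_zero[OF proj_hom polyR.ring_axioms Rbar.ring_axioms] by auto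

lemma Rbar_minus: "proj p \<ominus>\<^bsub>Rbar\<^esub> proj q = proj (p - q)"
proof -
  have "\<ominus>\<^bsub>Rbar\<^esub> proj q = proj (- q)"
    by (rule Rbar.minus_equality) (simp_all add: zero_Rbar proj_simps(4) flip: proj_simps(1))
  then show ?thesis by (simp add: a_minus_def flip: proj_simps)
qed

lemma ideal_Rbar_I:
  fixes J :: "('k::comm_ring_1, 'n) xy_poly set"
  assumes "ideal J polyR"
  shows "ideal (proj ` J) Rbar"
proof (rule idealI)
  show "ring Rbar" by (rule Rbar.ring_axioms)
  note J = additive_subgroup.zero_closed[OF ideal.axioms(1)[OF assms]]
    additive_subgroup.a_closed[OF ideal.axioms(1)[OF assms]] ideal.I_l_closed[OF assms]
  show "subgroup (proj ` J) (add_monoid Rbar)"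
  proof (rule Rbar.add.subgroupI)
    fix a assume "a \<in> proj ` J"
    then obtain p where p: "p \<in> J" "a = proj p" by blast
    have "\<ominus>\<^bsub>Rbar\<^esub> a = proj (- p)" unfolding p
      by (rule Rbar.minus_equality) (simp_all add: zero_Rbar proj_simps(4) flip: proj_simps(1))
    moreover have "- p \<in> J" using J(3)[OF p(1), of "-1"] by simp
    ultimately show "\<ominus>\<^bsub>Rbar\<^esub> a \<in> proj ` J" by simp
  qed (use J proj_simps in \<open>fastforce simp flip: proj_simps\<close>)+
  fix a b :: "('k, 'n) xy_poly set"
  assume "a \<in> proj ` J" "b \<in> carrier Rbar"
  then obtain p q where p: "p \<in> J" "a = proj p" "b = proj q" by (auto simp: carrier_Rbar)
  have "q * p \<in> J" using J(3)[OF p(1), of q] by simp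
  then show "b \<otimes>\<^bsub>Rbar\<^esub> a \<in> proj ` J" "a \<otimes>\<^bsub>Rbar\<^esub> b \<in> proj ` J"
    unfolding p by (simp_all add: mult.commute[of p q] flip: proj_simps)
qed

lemma Ibar_eq: "(Ibar :: ('k::comm_ring_1, 'n) xy_poly set set) = proj ` {p. minors_power 1 p}"
proof
  have "minors_ideal \<subseteq> {p :: ('k, 'n) xy_poly. minors_power 1 p}"
    unfolding minors_ideal_def using minors_power.minor[OF minors_power.zero, of _ _ 1]
    by (intro polyR.genideal_minimal[OF ideal_minors_power]) fastforce
  then show "Ibar \<subseteq> proj ` {p :: ('k, 'n) xy_poly. minors_power 1 p}"
    unfolding Ibar_def by (intro Rbar.genideal_minimal ideal_Rbar_I ideal_minors_power) auto
  have id: "ideal (Ibar :: ('k, 'n) xy_poly set set) Rbar" unfolding Ibar_def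
    by (rule Rbar.genideal_ideal) (auto simp: proj_simps)
  have "minors_power e p \<Longrightarrow> e = 1 \<Longrightarrow> proj p \<in> Ibar" for e and p :: "('k, 'n) xy_poly"
  proof (induction rule: minors_power.induct)
    case (zero p)
    then show ?case by simp
  next
    case (square d p v)
    then have "proj (p * Var v ^ 2) = \<zero>\<^bsub>Rbar\<^esub>" using Sq_square by (simp add: zero_Rbar proj_eq_iff)
    then show ?case using id additive_subgroup.zero_closed ideal.axioms(1) by metis
  next
    case (minor d p i j)
    have "minor i j \<in> minors_ideal" unfolding minors_ideal_def
      by (rule subsetD[OF polyR.genideal_self]) auto
    then have "proj (minor i j) \<in> Ibar" unfolding Ibar_def
      by (intro subsetD[OF Rbar.genideal_self]) (auto simp: proj_simps)
    then show ?case
      using ideal.I_r_closed[OF id _ proj_simps(4)[of p]] by (simp add: proj_simps(2))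
  next
    case (add d p q)
    then show ?case using additive_subgroup.a_closed[OF ideal.axioms(1)[OF id]] by (simp add: proj_simps)
  qed
  then show "proj ` {p :: ('k, 'n) xy_poly. minors_power 1 p} \<subseteq> Ibar" by blast
qed

lemma Ibar_pow_eq: "(Ibar_pow d :: ('k::comm_ring_1, 'n) xy_poly set set) = proj ` {p. minors_power d p}"
proof (induction d)
  case 0
  show ?case using minors_power.zero by (auto simp: Ibar_pow_def ideals_set_def carrier_Rbar)
next
  case (Suc d)
  have I: "(Ibar_pow (Suc d) :: ('k, 'n) xy_poly set set) = ideal_prod Rbar (Ibar_pow d) Ibar"
    by (simp add: Ibar_pow_def ideals_set_def nat_pow_def)
  have ids: "ideal (Ibar_pow d :: ('k, 'n) xy_poly set set) Rbar" "ideal (Ibar :: ('k, 'n) xy_poly set set) Rbar"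
    unfolding Suc Ibar_eq by (rule ideal_Rbar_I[OF ideal_minors_power])+
  show ?case
  proof
    show "Ibar_pow (Suc d) \<subseteq> proj ` {p :: ('k, 'n) xy_poly. minors_power (Suc d) p}"
    proof
      fix a :: "('k, 'n) xy_poly set"
      assume "a \<in> Ibar_pow (Suc d)"
      then have "a \<in> ideal_prod Rbar (Ibar_pow d) Ibar" using I by simp
      then show "a \<in> proj ` {p. minors_power (Suc d) p}"
      proof induction
        case (prod i j)
        then obtain p q where "i = proj p" "j = proj q" "minors_power d p" "minors_power 1 q"
          unfolding Suc Ibar_eq by blast
        then show ?case using minors_power_mult_add[of 1 q d p]
          by (simp flip: proj_simps)
      next
        case (sum a b)
        then show ?case by (auto intro: minors_power.add simp flip: proj_simps)
      qed
    qed
    have "minors_power e p \<Longrightarrow> e = Suc d \<Longrightarrow> proj p \<in> Ibar_pow (Suc d)" for e and p :: "('k, 'n) xy_poly"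
    proof (induction rule: minors_power.induct)
      case (zero p)
      then show ?case by simp
    next
      case (square d p v)
      then have "proj (p * Var v ^ 2) = \<zero>\<^bsub>Rbar\<^esub>" using Sq_square by (simp add: zero_Rbar proj_eq_iff)
      then show ?case unfolding I
        using Rbar.ideal_prod_is_ideal[OF ids] additive_subgroup.zero_closed ideal.axioms(1) by metis
    next
      case (minor d' p i j)
      then have "proj p \<in> Ibar_pow d" using Suc by simp
      moreover have "proj (minor i j) \<in> Ibar" unfolding Ibar_eq
        using minors_power.minor[OF minors_power.zero, of i j 1] by auto
      moreover have "proj (minor i j * p) = proj p \<otimes>\<^bsub>Rbar\<^esub> proj (minor i j)"
        by (metis mult.commute proj_simps(2))
      ultimately show ?case unfolding I by (auto intro: ideal_prod.prod)
    next
      case (add d' p q)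
      then show ?case unfolding I by (auto simp: proj_simps intro: ideal_prod.sum)
    qed
    then show "proj ` {p :: ('k, 'n) xy_poly. minors_power (Suc d) p} \<subseteq> Ibar_pow (Suc d)" by blast
  qed
qed

lemma ideal_Ibar_pow: "ideal (Ibar_pow d) Rbar"
  unfolding Ibar_pow_eq by (rule ideal_Rbar_I[OF ideal_minors_power])

lemma proj_Ibar_pow_iff: "proj p \<in> Ibar_pow d \<longleftrightarrow> minors_power d p"
proof
  assume "proj p \<in> Ibar_pow d"
  then obtain q where q: "proj p = proj q" "minors_power d q" by (auto simp: Ibar_pow_eq)
  then have "minors_power d (p - q)" using Sq_minors_power by (simp add: proj_eq_iff)
  then show "minors_power d p" using minors_power.add[OF _ q(2), of "p - q"] by simp
qed (auto simp: Ibar_pow_eq)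

section \<open>Weight spaces of the graded pieces\<close>

abbreviation cls :: "nat \<Rightarrow> ('k::comm_ring_1, 'n) xy_poly \<Rightarrow> ('k, 'n) gr_elem"
  where "cls d p \<equiv> Ibar_pow (Suc d) +>\<^bsub>Rbar\<^esub> proj p"

lemma cring_gr_ring: "cring (gr_ring d :: ('k::comm_ring_1, 'n) gr_elem ring)"
  unfolding gr_ring_def by (rule ideal.quotient_is_cring[OF ideal_Ibar_pow cring_Rbar])

lemma cls_hom: "cls d \<in> ring_hom polyR (gr_ring d)"
  using ring_hom_trans[OF proj_hom ideal.rcos_ring_hom[OF ideal_Ibar_pow[of "Suc d"]]]
  by (simp add: gr_ring_def comp_def)

lemma cls_simps:
  "cls d (p + q) = cls d p \<oplus>\<^bsub>gr_ring d\<^esub> cls d q" "cls d (p * q) = cls d p \<otimes>\<^bsub>gr_ring d\<^esub> cls d q"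
  "cls d p \<in> carrier (gr_ring d)"
  using ring_hom_add[OF cls_hom, of p q] ring_hom_mult[OF cls_hom, of p q]
    ring_hom_closed[OF cls_hom, of p] by simp_all

lemma cls_1: "cls d 1 = \<one>\<^bsub>gr_ring d\<^esub>"
  by (rule ring_hom_one[OF cls_hom, simplified])

lemma cls_0: "cls d 0 = \<zero>\<^bsub>gr_ring d\<^esub>"
  by (rule ring_hom_zero[OF cls_hom polyR.ring_axioms cring.axioms(1)[OF cring_gr_ring], simplified])

lemma cls_eq_iff: "cls d p = cls d q \<longleftrightarrow> minors_power (Suc d) (p - q)"
  using Rbar.quotient_eq_iff_same_a_r_cos[OF ideal_Ibar_pow[of "Suc d"] proj_simps(4)[of p] proj_simps(4)[of q]]
  by (simp add: Rbar_minus proj_Ibar_pow_iff)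

lemma gr_scalar_eq: "gr_scalar d c = cls d (Const c)"
  by (simp add: gr_scalar_def)

lemma gr_comp_eq: "gr_comp d a b = cls d ` {p \<in> polyR_comp a b. minors_power d p}"
  by (auto simp: gr_comp_def Rbar_comp_def proj_Ibar_pow_iff)

definition weight :: "('n + 'n \<Rightarrow>\<^sub>0 nat) \<Rightarrow> 'n::finite \<Rightarrow>\<^sub>0 nat"
  where "weight m = (\<Sum>i\<in>UNIV. Poly_Mapping.single i
    (Poly_Mapping.lookup m (Inl i) + Poly_Mapping.lookup m (Inr i)))"

lemma lookup_weight:
  "Poly_Mapping.lookup (weight m) i = Poly_Mapping.lookup m (Inl i) + Poly_Mapping.lookup m (Inr i)"
  by (simp add: weight_def lookup_sum lookup_single when_def if_distrib cong: if_cong)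

lemma weight_add: "weight (m + n) = weight m + weight n"
  by (rule poly_mapping_eqI) (simp add: lookup_weight lookup_add)

definition torus_char :: "('n \<Rightarrow> 'k) \<Rightarrow> ('n::finite \<Rightarrow>\<^sub>0 nat) \<Rightarrow> 'k::comm_ring_1"
  where "torus_char t \<mu> = (\<Prod>i\<in>UNIV. t i ^ Poly_Mapping.lookup \<mu> i)"

lemma single_eq_prod_Var:
  "(Poly_Mapping.single m 1 :: ('k::comm_ring_1, 'n::finite) xy_poly)
    = (\<Prod>v\<in>UNIV. Var v ^ Poly_Mapping.lookup m v)"
proof -
  have pow: "Var v ^ e = (Poly_Mapping.single (Poly_Mapping.single v e) 1 :: ('k, 'n) xy_poly)" for v :: "'n + 'n" and e
    by (induction e) (simp_all add: Var_def mult_single flip: single_add)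
  have "(\<Prod>v\<in>V. Var v ^ Poly_Mapping.lookup m v)
      = (Poly_Mapping.single (\<Sum>v\<in>V. Poly_Mapping.single v (Poly_Mapping.lookup m v)) 1 :: ('k, 'n) xy_poly)" for V
    by (induction V rule: infinite_finite_induct) (simp_all add: pow mult_single)
  moreover have "(\<Sum>v\<in>UNIV. Poly_Mapping.single v (Poly_Mapping.lookup m v)) = m"
    by (rule poly_mapping_eqI) (simp add: lookup_sum lookup_single when_def if_distrib cong: if_cong)
  ultimately show ?thesis by simp
qed

lemma act_Var_diag: "act_Var (diag_mat t) v = Const (t (case v of Inl i \<Rightarrow> i | Inr i \<Rightarrow> i)) * Var v"
  by (cases v) (simp_all add: diag_mat_def if_distrib if_distribR cong: if_cong)

lemma Const_power: "Const (c ^ n) = Const c ^ n"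
  by (induction n) (simp_all add: Const_mult)

lemma Const_prod: "Const (\<Prod>a\<in>A. f a) = (\<Prod>a\<in>A. Const (f a))"
  by (induction A rule: infinite_finite_induct) (simp_all add: Const_mult)

lemma act_diag_single:
  "act_R (diag_mat t) (Poly_Mapping.single m c) = Poly_Mapping.single m (torus_char t (weight m) * c)"
proof -
  let ?t = "\<lambda>v. t (case v of Inl i \<Rightarrow> i | Inr i \<Rightarrow> i)"
  have "(\<Prod>v\<in>UNIV. ?t v ^ Poly_Mapping.lookup m v) = torus_char t (weight m)"
    unfolding UNIV_Plus_UNIV[symmetric]
    by (subst prod.Plus) (simp_all add: torus_char_def lookup_weight power_add prod.distrib)
  then have "(\<Prod>v\<in>UNIV. act_Var (diag_mat t) v ^ Poly_Mapping.lookup m v)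
      = Const (torus_char t (weight m)) * Poly_Mapping.single m 1"
    by (simp add: act_Var_diag power_mult_distrib prod.distrib
        del: act_Var.simps flip: Const_power Const_prod single_eq_prod_Var)
  then show ?thesis
    by (simp add: act_R_eq_subst subst_single Const_mult_single mult.commute[of c])
qed

lemma act_R_add: "act_R g (p + q) = act_R g p + act_R g q"
  by (simp add: act_R_eq_subst subst_add)

lemma act_R_0 [simp]: "act_R g 0 = 0"
  by (simp add: act_R_eq_subst)

lemma lookup_act_diag:
  "Poly_Mapping.lookup (act_R (diag_mat t) p) m = torus_char t (weight m) * Poly_Mapping.lookup p m"
  by (induction p rule: poly_mapping_monomial_induct)
    (auto simp: act_diag_single lookup_single when_def lookup_add act_R_add distrib_left)

lemma act_diag_inverse:
  fixes t :: "'n::finite \<Rightarrow> 'k::field"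
  assumes "\<And>i. t i \<noteq> 0"
  shows "act_R (diag_mat t) (act_R (diag_mat (\<lambda>i. inverse (t i))) p) = p"
proof (rule poly_mapping_eqI)
  fix m
  have "torus_char t (weight m) * torus_char (\<lambda>i. inverse (t i)) (weight m) = 1"
    using assms by (simp add: torus_char_def flip: prod.distrib power_mult_distrib)
  then show "Poly_Mapping.lookup (act_R (diag_mat t) (act_R (diag_mat (\<lambda>i. inverse (t i))) p)) m
      = Poly_Mapping.lookup p m"
    by (simp add: lookup_act_diag flip: mult.assoc)
qed

lemma act_diag_minors_power:
  "minors_power d p \<Longrightarrow> minors_power d (act_R (diag_mat t) p)"
proof (induction rule: minors_power.induct)
  case (square d p v)
  then show ?case
    using minors_power.square[of d "act_R (diag_mat t) p * Const (t (case v of Inl i \<Rightarrow> i | Inr i \<Rightarrow> i)) ^ 2" v]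
    by (simp add: act_R_eq_subst subst_mult subst_power subst_Var act_Var_diag power_mult_distrib mult_ac
        del: act_Var.simps)
next
  case (minor d p i j)
  have "act_R (diag_mat t) (minor i j * p) = Const (t i * t j) * (minor i j * act_R (diag_mat t) p)"
    by (simp add: act_R_eq_subst subst_mult subst_diff subst_Var act_Var_diag Const_mult algebra_simps
        del: act_Var.simps)
  then show ?case using minor minors_power.minor minors_power_mult by metis
next
  case (add d p q)
  then show ?case by (simp add: act_R_eq_subst subst_add minors_power.add)
qed (rule minors_power.zero)

lemma act_diag_Sq: "p \<in> Sq \<Longrightarrow> act_R (diag_mat t) p \<in> Sq"
proof -
  have "ideal {p. act_R (diag_mat t) p \<in> Sq} polyR"
    using additive_subgroup.zero_closed[OF ideal.axioms(1)[OF ideal_Sq]]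
      additive_subgroup.a_closed[OF ideal.axioms(1)[OF ideal_Sq]] ideal.I_l_closed[OF ideal_Sq]
    by (intro ideal_polyR_I) (auto simp: act_R_eq_subst subst_add subst_mult)
  moreover have "act_R (diag_mat t) (Var v ^ 2) \<in> Sq" for v
    using Sq_square by (simp add: act_R_eq_subst subst_power subst_Var act_Var_diag power_mult_distrib del: act_Var.simps)
  ultimately have "Idl\<^bsub>polyR\<^esub> (range (\<lambda>v. Var v ^ 2)) \<subseteq> {p. act_R (diag_mat t) p \<in> Sq}"
    by (intro polyR.genideal_minimal) auto
  then have "Sq \<subseteq> {p. act_R (diag_mat t) p \<in> Sq}" by (simp only: Sq_def)
  then show "p \<in> Sq \<Longrightarrow> act_R (diag_mat t) p \<in> Sq" by blast
qed

lemma act_diag_proj: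
  fixes t :: "'n::finite \<Rightarrow> 'k::field"
  assumes "\<And>i. t i \<noteq> 0"
  shows "act_R (diag_mat t) ` proj p = proj (act_R (diag_mat t) p)"
proof
  show "act_R (diag_mat t) ` proj p \<subseteq> proj (act_R (diag_mat t) p)"
    using act_diag_Sq[of _ t] by (auto simp: mem_proj act_R_eq_subst simp flip: subst_diff)
  show "proj (act_R (diag_mat t) p) \<subseteq> act_R (diag_mat t) ` proj p"
  proof
    fix q assume q: "q \<in> proj (act_R (diag_mat t) p)"
    let ?s = "\<lambda>i. inverse (t i)"
    have "act_R (diag_mat ?s) (act_R (diag_mat t) p) = p"
      using act_diag_inverse[of ?s p] assms by simp
    then have "act_R (diag_mat ?s) q - p = act_R (diag_mat ?s) (q - act_R (diag_mat t) p)"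
      by (simp add: act_R_eq_subst subst_diff)
    then have "act_R (diag_mat ?s) q \<in> proj p"
      using q act_diag_Sq by (simp add: mem_proj)
    then show "q \<in> act_R (diag_mat t) ` proj p"
      using act_diag_inverse[of t q] assms by (metis imageI)
  qed
qed

lemma cls_eq_image: "cls d p = proj ` {q. minors_power (Suc d) (q - p)}"
proof -
  have "cls d p = {proj r \<oplus>\<^bsub>Rbar\<^esub> proj p |r. minors_power (Suc d) r}"
    by (auto simp: a_r_coset_def' Ibar_pow_eq)
  also have "\<dots> = {proj (r + p) |r. minors_power (Suc d) r}" by (simp add: proj_simps(1))
  also have "\<dots> = proj ` {q. minors_power (Suc d) (q - p)}"
    by (force simp: image_iff)
  finally show ?thesis .
qed

text \<open>
  The direct image of a coset is a full coset, not just a subset of one, because the inverse diagonal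
  matrix preserves the ideals as well.
\<close>

lemma act_gr_cls:
  fixes t :: "'n::finite \<Rightarrow> 'k::field"
  assumes "\<And>i. t i \<noteq> 0"
  shows "act_gr (diag_mat t) (cls d p) = cls d (act_R (diag_mat t) p)"
proof -
  let ?T = "act_R (diag_mat t)"
  have "act_gr (diag_mat t) (cls d p) = (\<lambda>q. proj (?T q)) ` {q. minors_power (Suc d) (q - p)}"
    unfolding act_gr_def cls_eq_image image_image by (simp add: act_diag_proj[OF assms])
  also have "\<dots> = proj ` ?T ` {q. minors_power (Suc d) (q - p)}" by (simp add: image_image)
  also have "?T ` {q. minors_power (Suc d) (q - p)} = {q. minors_power (Suc d) (q - ?T p)}"
  proof (intro equalityI subsetI)
    fix q assume "q \<in> ?T ` {q. minors_power (Suc d) (q - p)}"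
    then show "q \<in> {q. minors_power (Suc d) (q - ?T p)}"
      using act_diag_minors_power[of "Suc d" _ t] by (auto simp: act_R_eq_subst simp flip: subst_diff)
  next
    fix q assume q: "q \<in> {q. minors_power (Suc d) (q - ?T p)}"
    let ?s = "\<lambda>i. inverse (t i)"
    have "act_R (diag_mat ?s) (?T p) = p"
      using act_diag_inverse[of ?s p] assms by simp
    then have "act_R (diag_mat ?s) q - p = act_R (diag_mat ?s) (q - ?T p)"
      by (simp add: act_R_eq_subst subst_diff)
    then have "minors_power (Suc d) (act_R (diag_mat ?s) q - p)"
      using q act_diag_minors_power by auto
    then show "q \<in> ?T ` {q. minors_power (Suc d) (q - p)}"
      using act_diag_inverse[of t q] assms by (metis imageI mem_Collect_eq)
  qed
  finally show ?thesis unfolding cls_eq_image .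
qed

definition weight_part :: "(('n \<Rightarrow>\<^sub>0 nat) \<Rightarrow> bool) \<Rightarrow> ('k::comm_ring_1, 'n::finite) xy_poly \<Rightarrow> ('k, 'n) xy_poly"
  where "weight_part W p = (\<Sum>m\<in>{m \<in> Poly_Mapping.keys p. W (weight m)}.
    Poly_Mapping.single m (Poly_Mapping.lookup p m))"

lemma lookup_weight_part:
  "Poly_Mapping.lookup (weight_part W p) m = (if W (weight m) then Poly_Mapping.lookup p m else 0)"
  by (auto simp: weight_part_def lookup_sum lookup_single when_def if_distrib in_keys_iff cong: if_cong)

lemma weight_part_add: "weight_part W (p + q) = weight_part W p + weight_part W q"
  by (rule poly_mapping_eqI) (simp add: lookup_weight_part lookup_add)

lemma weight_part_diff: "weight_part W (p - q) = weight_part W p - weight_part W q"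
  by (rule poly_mapping_eqI) (simp add: lookup_weight_part lookup_minus)

lemma weight_part_single_mult:
  "weight_part W (Poly_Mapping.single m c * p) = Poly_Mapping.single m c * weight_part (\<lambda>\<mu>. W (weight m + \<mu>)) p"
proof (rule poly_mapping_eqI)
  fix l
  show "Poly_Mapping.lookup (weight_part W (Poly_Mapping.single m c * p)) l =
    Poly_Mapping.lookup (Poly_Mapping.single m c * weight_part (\<lambda>\<mu>. W (weight m + \<mu>)) p) l"
  proof (cases "\<exists>n. l = m + n")
    case True
    then obtain n where "l = m + n" by blast
    then show ?thesis by (simp add: lookup_weight_part lookup_single_mult weight_add)
  next
    case False
    then show ?thesis by (auto simp: lookup_weight_part lookup_single_mult_0)
  qed
qed

lemma Var_square: "Var v ^ 2 = Poly_Mapping.single (Poly_Mapping.single v 2) 1"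
  unfolding power2_eq_square by (simp add: Var_def mult_single numeral_2_eq_2 flip: single_add)

lemma xy_single: "xvar i * yvar j = Poly_Mapping.single (Poly_Mapping.single (Inl i) 1 + Poly_Mapping.single (Inr j) 1) 1"
  by (simp add: Var_def mult_single)

lemma weight_xy: "weight (Poly_Mapping.single (Inl i) 1 + Poly_Mapping.single (Inr j) 1)
  = Poly_Mapping.single i 1 + Poly_Mapping.single j 1"
  by (rule poly_mapping_eqI) (simp add: lookup_weight lookup_add lookup_single when_def)

text \<open>
  Both terms of a minor have the same weight, so the ideals are generated by weight vectors.
\<close>

lemma minors_power_weight_part:
  "minors_power d p \<Longrightarrow> minors_power d (weight_part W p)"
proof (induction arbitrary: W rule: minors_power.induct)
  case (square d p v)
  have "\<exists>q. weight_part W (p * Var v ^ 2) = q * Var v ^ 2"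
    by (metis Var_square weight_part_single_mult mult.commute)
  then show ?case using minors_power.square by metis
next
  case (minor d p i j)
  define V where "V = (\<lambda>\<mu>. W (Poly_Mapping.single i 1 + Poly_Mapping.single j 1 + \<mu>))"
  have "weight_part W (xvar i * yvar j * p) = xvar i * yvar j * weight_part V p"
    by (simp only: xy_single weight_part_single_mult weight_xy V_def)
  moreover have "weight_part W (xvar j * yvar i * p) = xvar j * yvar i * weight_part V p"
    by (simp only: xy_single weight_part_single_mult weight_xy V_def
        add.commute[of "Poly_Mapping.single j 1" "Poly_Mapping.single i 1"])
  ultimately have "weight_part W (minor i j * p) = minor i j * weight_part V p"
    by (simp add: left_diff_distrib weight_part_diff)
  then show ?case using minor.IH[of V] minors_power.minor by metis
next
  case (add d p q)
  then show ?case by (simp add: weight_part_add minors_power.add)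
qed (rule minors_power.zero)

text \<open>
  Over a finite field with elements \<open>a\<close>, the polynomial \<open>(\<Prod>a. X - a) + 1\<close> has no root.
\<close>

lemma infinite_UNIV_alg_closed: "infinite (UNIV :: 'k::alg_closed_field set)"
proof
  assume fin: "finite (UNIV :: 'k set)"
  let ?p = "(\<Prod>a\<in>UNIV. [:- a, 1:]) + 1 :: 'k poly"
  have "degree (\<Prod>a\<in>(UNIV :: 'k set). [:- a, 1:]) = card (UNIV :: 'k set)"
    by (subst degree_prod_eq_sum_degree) auto
  moreover have "card (UNIV :: 'k set) > 0" using fin by (simp add: card_gt_0_iff)
  ultimately have "degree ?p > 0"
    by (subst degree_add_eq_left) auto
  then obtain x where "poly ?p x = 0" using alg_closed_imp_poly_has_root by blast
  moreover have "poly (\<Prod>a\<in>(UNIV :: 'k set). [:- a, 1:]) x = 0"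
    using fin by (auto simp: poly_prod)
  ultimately show False by simp
qed

lemma torus_char_separates:
  fixes \<mu> \<nu> :: "'n::finite \<Rightarrow>\<^sub>0 nat"
  assumes "\<mu> \<noteq> \<nu>"
  obtains t :: "'n \<Rightarrow> 'k::alg_closed_field" where "\<And>i. t i \<noteq> 0" "torus_char t \<mu> \<noteq> torus_char t \<nu>"
proof -
  obtain i where i: "Poly_Mapping.lookup \<mu> i \<noteq> Poly_Mapping.lookup \<nu> i"
    using assms by (auto simp: poly_mapping_eq_iff fun_eq_iff)
  \<comment> \<open>A coordinate \<open>c\<close> separates the two weights if it is not a root of this polynomial.\<close>
  let ?p = "monom 1 (Poly_Mapping.lookup \<mu> i) - monom 1 (Poly_Mapping.lookup \<nu> i) :: 'k poly"
  have "coeff ?p (Poly_Mapping.lookup \<mu> i) = 1" using i by simp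
  then have "?p \<noteq> 0" by (metis coeff_0 zero_neq_one)
  then have "finite (insert 0 {x. poly ?p x = 0})" using poly_roots_finite by (simp only: finite_insert)
  then obtain c where c: "c \<notin> insert 0 {x. poly ?p x = 0}"
    using infinite_UNIV_alg_closed ex_new_if_finite by blast
  define t where "t = (\<lambda>k. if k = i then c else 1)"
  have char: "torus_char t \<kappa> = c ^ Poly_Mapping.lookup \<kappa> i" for \<kappa>
    unfolding torus_char_def t_def by (simp add: if_distrib[where f="\<lambda>x. x ^ _"] cong: if_cong)
  show ?thesis
  proof
    show "t k \<noteq> 0" for k using c by (simp add: t_def)
    show "torus_char t \<mu> \<noteq> torus_char t \<nu>" using c by (simp add: char poly_monom)
  qed
qed

text \<open>
  If the class of \<open>p\<close> has weight \<open>\<mu>\<close>, then comparing components shows that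
  \<open>(torus_char t \<nu> - torus_char t \<mu>) * p\<^sub>\<nu>\<close> lies in the ideal for every weight \<open>\<nu>\<close> and torus element \<open>t\<close>.
  Choosing \<open>t\<close> to separate \<open>\<nu>\<close> from \<open>\<mu>\<close> removes all components of \<open>p\<close> except \<open>p\<^sub>\<mu>\<close>.
\<close>

lemma weight_space_gr_comp:
  "weight_space (gr_ring d) (gr_scalar d) act_gr (gr_comp d a b :: ('k::alg_closed_field, 'n::finite) gr_elem set) \<mu>
   = cls d ` {p \<in> polyR_comp a b. minors_power d p \<and> (\<forall>m\<in>Poly_Mapping.keys p. weight m = \<mu>)}"
    (is "?L = cls d ` ?R")
proof (intro equalityI subsetI)
  fix v assume "v \<in> cls d ` ?R"
  then obtain p where p: "p \<in> ?R" "v = cls d p" by blast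
  have "act_R (diag_mat t) p = Const (torus_char t \<mu>) * p" for t
    by (rule poly_mapping_eqI) (use p in \<open>auto simp: lookup_act_diag lookup_Const_mult in_keys_iff\<close>)
  then show "v \<in> ?L"
    using p by (auto simp: weight_space_def gr_comp_eq act_gr_cls gr_scalar_eq torus_char_def
        simp flip: cls_simps)
next
  fix v assume v: "v \<in> ?L"
  then obtain p where p: "p \<in> polyR_comp a b" "minors_power d p" "v = cls d p"
    by (auto simp: weight_space_def gr_comp_eq)
  have eq: "minors_power (Suc d) (act_R (diag_mat t) p - Const (torus_char t \<mu>) * p)" if "\<And>i. t i \<noteq> 0" for t
  proof -
    have "act_gr (diag_mat t) (cls d p) = gr_scalar d (torus_char t \<mu>) \<otimes>\<^bsub>gr_ring d\<^esub> cls d p"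
      using v that unfolding p(3) by (auto simp: weight_space_def torus_char_def)
    then have "cls d (act_R (diag_mat t) p) = cls d (Const (torus_char t \<mu>) * p)"
      using that by (simp add: act_gr_cls gr_scalar_eq cls_simps(2))
    then show ?thesis by (simp add: cls_eq_iff)
  qed
  have other: "minors_power (Suc d) (weight_part ((=) \<nu>) p)" if "\<nu> \<noteq> \<mu>" for \<nu>
  proof -
    obtain t :: "'n \<Rightarrow> 'k" where t: "\<And>i. t i \<noteq> 0" "torus_char t \<nu> \<noteq> torus_char t \<mu>"
      using torus_char_separates[OF \<open>\<nu> \<noteq> \<mu>\<close>] by blast
    let ?c = "torus_char t \<nu> - torus_char t \<mu>"
    have "weight_part ((=) \<nu>) (act_R (diag_mat t) p - Const (torus_char t \<mu>) * p)
        = Const ?c * weight_part ((=) \<nu>) p"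
      by (rule poly_mapping_eqI)
        (auto simp: lookup_weight_part lookup_minus lookup_act_diag lookup_Const_mult left_diff_distrib)
    moreover have "minors_power (Suc d) (act_R (diag_mat t) p - Const (torus_char t \<mu>) * p)"
      by (rule eq) (rule t(1))
    ultimately have "minors_power (Suc d) (Const ?c * weight_part ((=) \<nu>) p)"
      using minors_power_weight_part by metis
    then have "minors_power (Suc d) (Const (inverse ?c) * (Const ?c * weight_part ((=) \<nu>) p))"
      by (rule minors_power_mult)
    then show ?thesis using t(2) by (simp flip: mult.assoc Const_mult)
  qed
  have "p - weight_part ((=) \<mu>) p = (\<Sum>\<nu>\<in>weight ` Poly_Mapping.keys p - {\<mu>}. weight_part ((=) \<nu>) p)"
    by (rule poly_mapping_eqI)
      (auto simp: lookup_weight_part lookup_minus lookup_sum in_keys_iff)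
  then have "minors_power (Suc d) (p - weight_part ((=) \<mu>) p)"
    using other by (auto intro!: minors_power_sum)
  then have "v = cls d (weight_part ((=) \<mu>) p)" by (simp add: p(3) cls_eq_iff)
  moreover have "Poly_Mapping.keys (weight_part ((=) \<mu>) p) \<subseteq> {m \<in> Poly_Mapping.keys p. weight m = \<mu>}"
    by (auto simp: in_keys_iff lookup_weight_part split: if_splits)
  then have "weight_part ((=) \<mu>) p \<in> ?R"
    using p minors_power_weight_part[OF p(2)] by (auto simp: polyR_comp_def)
  ultimately show "v \<in> cls d ` ?R" by blast
qed

definition y_degree :: "('n + 'n \<Rightarrow>\<^sub>0 nat) \<Rightarrow> nat"
  where "y_degree m = (\<Sum>i\<in>UNIV. Poly_Mapping.lookup m (Inr i))"

lemma y_degree_add: "y_degree (m + n) = y_degree m + y_degree n" for m :: "'n + 'n::finite \<Rightarrow>\<^sub>0 nat"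
  by (simp add: y_degree_def lookup_add sum.distrib)

lemma y_degree_single: "y_degree (Poly_Mapping.single (Inl i) e) = 0"
  "y_degree (Poly_Mapping.single (Inr i) e) = e" for i :: "'n::finite"
  by (simp_all add: y_degree_def lookup_single when_def)

lemma keys_mult_minor:
  fixes p :: "('k::comm_ring_1, 'n) xy_poly"
  assumes "m \<in> Poly_Mapping.keys (minor i j * p)"
  obtains k l n where "m = (Poly_Mapping.single (Inl k) 1 + Poly_Mapping.single (Inr l) 1) + n" "n \<in> Poly_Mapping.keys p"
proof -
  have "Poly_Mapping.keys (minor i j :: ('k, 'n) xy_poly) \<subseteq>
    {Poly_Mapping.single (Inl i) 1 + Poly_Mapping.single (Inr j) 1, Poly_Mapping.single (Inl j) 1 + Poly_Mapping.single (Inr i) 1}"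
    unfolding xy_single by (rule subset_trans[OF keys_diff]) (auto simp: in_keys_iff lookup_single when_def)
  then show ?thesis using that assms keys_mult[of "minor i j" p] by blast
qed

lemma keys_mult_square:
  fixes p :: "('k::comm_ring_1, 'n) xy_poly"
  assumes "m \<in> Poly_Mapping.keys (p * Var v ^ 2)"
  shows "Poly_Mapping.lookup m v \<ge> 2"
proof -
  obtain n where "m = n + Poly_Mapping.single v 2"
    using assms keys_mult[of p "Var v ^ 2"] by (auto simp: Var_square split: if_splits)
  then show ?thesis by (simp add: lookup_add)
qed

lemma minors_power_y_degree:
  fixes p :: "('k::comm_ring_1, 'n::finite) xy_poly"
  assumes "minors_power d p" "m \<in> Poly_Mapping.keys p" "\<And>v. Poly_Mapping.lookup m v \<le> 1"
  shows "d \<le> y_degree m"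
  using assms
proof (induction arbitrary: m rule: minors_power.induct)
  case (square d p v)
  then show ?case using keys_mult_square[OF square(1)] square(2)[of v] by simp
next
  case (minor d p i j)
  obtain k l n where n: "m = (Poly_Mapping.single (Inl k) 1 + Poly_Mapping.single (Inr l) 1) + n" "n \<in> Poly_Mapping.keys p"
    using keys_mult_minor[OF minor.prems(1)] .
  have "Poly_Mapping.lookup n v \<le> 1" for v
    using minor.prems(2)[of v] unfolding n by (simp add: lookup_add)
  then have "d \<le> y_degree n" using minor.IH n by blast
  then show ?case unfolding n by (simp add: y_degree_add y_degree_single)
next
  case (add d p q)
  then show ?case using keys_add[of p q] by blast
qed simp

lemma not_minors_power_1: "\<not> minors_power (Suc d) (1 :: ('k::comm_ring_1, 'n::finite) xy_poly)"
proof
  assume "minors_power (Suc d) (1 :: ('k, 'n) xy_poly)"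
  from minors_power_y_degree[OF this, of 0] show False by (simp add: y_degree_def)
qed

lemma subfield_gr_scalar:
  "subfield (range (gr_scalar d)) (gr_ring d :: ('k::field, 'n::finite) gr_elem ring)"
proof -
  interpret A: cring "gr_ring d :: ('k, 'n) gr_elem ring" by (rule cring_gr_ring)
  let ?K = "ring_of_type_algebra :: 'k ring"
  interpret K: field ?K by (rule field_from_type_algebra)
  have car: "carrier ?K = UNIV" by (simp add: ring_of_type_algebra_def)
  have hom: "gr_scalar d \<in> ring_hom ?K (gr_ring d :: ('k, 'n) gr_elem ring)"
    by (rule ring_hom_memI)
      (simp_all add: ring_of_type_algebra_def gr_scalar_eq Const_mult Const_add cls_simps cls_1)
  interpret h: ring_hom_ring ?K "gr_ring d :: ('k, 'n) gr_elem ring" "gr_scalar d"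
    by (rule ring_hom_ringI2[OF K.ring_axioms A.ring_axioms hom])
  have "\<one>\<^bsub>gr_ring d :: ('k, 'n) gr_elem ring\<^esub> \<noteq> \<zero>\<^bsub>gr_ring d\<^esub>"
    using not_minors_power_1[of d] cls_eq_iff[of d "1 :: ('k, 'n) xy_poly" 0] by (simp add: cls_1 cls_0)
  then show ?thesis
    using h.img_is_subfield(2)[OF K.carrier_is_subfield] car by simp
qed

lemma dim_zero_space:
  "ring.dim (gr_ring d) (range (gr_scalar d)) {\<zero>\<^bsub>gr_ring d :: ('k::field, 'n::finite) gr_elem ring\<^esub>} = 0"
proof -
  interpret A: cring "gr_ring d :: ('k, 'n) gr_elem ring" by (rule cring_gr_ring)
  show ?thesis
    unfolding A.dim_def using A.dimension_is_inj[OF subfield_gr_scalar] A.zero_dim by blast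
qed

text \<open>
  The dimension over the subfield of scalars is defined by adjoining one line at a time. The lines
  used here are spanned by the images of vectors that extend a basis of the kernel to a basis of \<open>U\<close>.
\<close>

lemma dim_cls_image:
  fixes U :: "('k::field ^ 'm::finite) set" and h :: "'k ^ 'm \<Rightarrow> ('k, 'n::finite) xy_poly"
  assumes add: "\<And>f g. h (f + g) = h f + h g" and scale: "\<And>c f. h (c *s f) = Const c * h f"
    and U: "vec.subspace U"
  shows "ring.dim (gr_ring d) (range (gr_scalar d)) (cls d ` h ` U)
    = vec.dim U - vec.dim {f \<in> U. minors_power (Suc d) (h f)}"
proof -
  interpret A: cring "gr_ring d :: ('k, 'n) gr_elem ring" by (rule cring_gr_ring)
  let ?K = "range (gr_scalar d) :: ('k, 'n) gr_elem set"
  let ?h = "\<lambda>f. cls d (h f)"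
  have diff: "h (f - g) = h f - h g" for f g using add[of "f - g" g] by simp
  have h0: "h 0 = 0" using diff[of 0 0] by simp
  have K: "subfield ?K (gr_ring d)" by (rule subfield_gr_scalar)
  let ?N = "{f \<in> U. minors_power (Suc d) (h f)}"
  have "vec.subspace ?N"
    using U by (auto simp: vec.subspace_def add scale h0 minors_power_0 minors_power.add minors_power_mult)
  then obtain B C where BC: "B \<inter> C = {}" "vec.independent (B \<union> C)" "vec.span B = ?N" "vec.span (B \<union> C) = U"
    "card B = vec.dim ?N" "card C + vec.dim ?N = vec.dim U"
    using basis_extension[OF _ U] by blast
  have "finite C" using BC(2) vec.independent_bound_general vec.independent_mono by blast
  have "A.dimension (card C') ?K (?h ` vec.span (B \<union> C'))" if "finite C'" "C' \<subseteq> C" for C'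
    using that
  proof (induction C' rule: finite_induct)
    case empty
    have "?h f = \<zero>\<^bsub>gr_ring d\<^esub>" if "f \<in> ?N" for f
      using that by (simp add: cls_eq_iff flip: cls_0)
    moreover have "0 \<in> ?N" using U by (simp add: h0 minors_power_0 vec.subspace_0)
    ultimately have "?h ` vec.span (B \<union> {}) = {\<zero>\<^bsub>gr_ring d\<^esub>}"
      using BC(3) by auto
    then show ?case using A.zero_dim by simp
  next
    case (insert v C')
    let ?E = "?h ` vec.span (B \<union> C')"
    have notin: "?h v \<notin> ?E"
    proof
      assume "?h v \<in> ?E"
      then obtain w where w: "w \<in> vec.span (B \<union> C')" "?h v = ?h w" by blast
      have sub: "vec.span (B \<union> C') \<subseteq> U" using BC(4) vec.span_mono[of "B \<union> C'" "B \<union> C"] insert by auto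
      have "v \<in> U" using BC(4) vec.span_base[of v "B \<union> C"] insert by auto
      then have "v - w \<in> ?N"
        using w sub U by (auto simp: cls_eq_iff diff vec.subspace_diff)
      then have "v - w \<in> vec.span (B \<union> C')" using BC(3) vec.span_mono[of B "B \<union> C'"] by auto
      then have "v \<in> vec.span (B \<union> C')" using vec.span_add[OF _ w(1)] by fastforce
      moreover have "B \<union> C' \<subseteq> B \<union> C - {v}" using insert BC(1) by auto
      ultimately have "v \<in> vec.span (B \<union> C - {v})" using vec.span_mono by blast
      moreover have "v \<in> B \<union> C" using insert by blast
      ultimately show False using BC(2) vec.dependent_def by blast
    qed
    have Ecar: "?E \<subseteq> carrier (gr_ring d)" using cls_simps(3) by blast
    have "?h ` vec.span (B \<union> insert v C') = A.line_extension ?K (?h v) ?E"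
    proof (intro equalityI subsetI)
      fix u assume "u \<in> ?h ` vec.span (B \<union> insert v C')"
      then obtain f where f: "u = ?h f" "f \<in> vec.span (insert v (B \<union> C'))" by auto
      then obtain k where k: "f - k *s v \<in> vec.span (B \<union> C')"
        using vec.span_breakdown_eq by blast
      have "?h f = gr_scalar d k \<otimes>\<^bsub>gr_ring d\<^esub> ?h v \<oplus>\<^bsub>gr_ring d\<^esub> ?h (f - k *s v)"
        by (simp add: gr_scalar_eq diff scale flip: cls_simps)
      then show "u \<in> A.line_extension ?K (?h v) ?E"
        unfolding f A.line_extension_mem_iff using k by blast
    next
      fix u assume "u \<in> A.line_extension ?K (?h v) ?E"
      then obtain k g where kg: "g \<in> vec.span (B \<union> C')"
        "u = gr_scalar d k \<otimes>\<^bsub>gr_ring d\<^esub> ?h v \<oplus>\<^bsub>gr_ring d\<^esub> ?h g"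
        unfolding A.line_extension_mem_iff by blast
      then have "u = ?h (k *s v + g)" by (simp add: gr_scalar_eq add scale cls_simps)
      moreover have "k *s v + g \<in> vec.span (B \<union> insert v C')"
      proof (intro vec.span_add vec.span_scale)
        show "v \<in> vec.span (B \<union> insert v C')" by (rule vec.span_base) simp
        show "g \<in> vec.span (B \<union> insert v C')"
          using kg(1) vec.span_mono[of "B \<union> C'" "B \<union> insert v C'"] by blast
      qed
      ultimately show "u \<in> ?h ` vec.span (B \<union> insert v C')" by blast
    qed
    then show ?case
      using A.Suc_dim[OF cls_simps(3) notin insert.IH] insert by simp
  qed
  from this[OF \<open>finite C\<close> subset_refl] have "A.dimension (card C) ?K (cls d ` h ` U)"
    using BC(4) by (simp add: image_image)
  then have "A.dim ?K (cls d ` h ` U) = card C"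
    unfolding A.dim_def using A.dimension_is_inj[OF K] by blast
  then show ?thesis using BC(6) by simp
qed

section \<open>Membership of tensors in the powers of the ideal of minors\<close>

lemma minors_power_antimono: "minors_power e p \<Longrightarrow> d \<le> e \<Longrightarrow> minors_power d p"
proof (induction arbitrary: d rule: minors_power.induct)
  case (minor e p i j)
  then show ?case by (cases d) (auto intro: minors_power.intros)
qed (auto intro: minors_power.intros)

lemma char_2_add_self:
  fixes p :: "('k::comm_ring_1, 'n) xy_poly"
  assumes "CHAR('k) = 2"
  shows "p + p = 0"
proof -
  have "c + c = 0" for c :: 'k
    using of_nat_CHAR[where 'a='k] assms by (metis mult_2 mult_zero_left of_nat_numeral)
  then have "Poly_Mapping.lookup (p + p) m = Poly_Mapping.lookup 0 m" for m by (simp only: lookup_add lookup_zero)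
  then show ?thesis by (rule poly_mapping_eqI)
qed

lemma char_2_minus:
  fixes p :: "('k::comm_ring_1, 'n) xy_poly"
  assumes "CHAR('k) = 2"
  shows "p - q = p + q"
proof -
  have "p - q = p - q + (q + q)" unfolding char_2_add_self[OF assms] by (rule add_0_right[symmetric])
  also have "\<dots> = p + q" by (simp only: add.assoc[symmetric] diff_add_cancel)
  finally show ?thesis .
qed

definition exps :: "('n + 'n::finite) set \<Rightarrow> 'n + 'n \<Rightarrow>\<^sub>0 nat"
  where "exps V = (\<Sum>v\<in>V. Poly_Mapping.single v 1)"

lemma lookup_exps: "Poly_Mapping.lookup (exps V) v = (if v \<in> V then 1 else 0)"
  by (simp add: exps_def lookup_sum lookup_single when_def if_distrib cong: if_cong)

lemma prod_Var: "(\<Prod>v\<in>V. Var v) = (Poly_Mapping.single (exps V) 1 :: ('k::comm_ring_1, 'n::finite) xy_poly)"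
proof -
  have "(\<Prod>v\<in>UNIV. Var v ^ Poly_Mapping.lookup (exps V) v) = (\<Prod>v\<in>V. Var v :: ('k, 'n) xy_poly)"
    by (rule prod.mono_neutral_cong_right) (auto simp: lookup_exps)
  then show ?thesis by (simp add: single_eq_prod_Var)
qed

definition z_prod :: "'n set \<Rightarrow> ('k::comm_ring_1, 'n::finite) xy_poly"
  where "z_prod D = (\<Prod>i\<in>D. xvar i * yvar i)"

definition tensor_poly :: "'n set \<Rightarrow> 'k ^ 'n set \<Rightarrow> ('k::comm_ring_1, 'n::finite) xy_poly"
  where "tensor_poly S f = (\<Sum>B\<in>Pow S. Const (f $ B) * ((\<Prod>i\<in>S - B. xvar i) * (\<Prod>i\<in>B. yvar i)))"

text \<open>
  The exponent vector of \<open>z\<^sub>D x\<^bsub>S - B\<^esub> y\<^sub>B\<close>.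
\<close>

definition tensor_exps :: "'n set \<Rightarrow> 'n set \<Rightarrow> 'n set \<Rightarrow> 'n + 'n::finite \<Rightarrow>\<^sub>0 nat"
  where "tensor_exps D S B = exps (Inl ` (D \<union> (S - B)) \<union> Inr ` (D \<union> B))"

lemma single_tensor_exps:
  assumes "D \<inter> S = {}" "B \<subseteq> S"
  shows "z_prod D * ((\<Prod>i\<in>S - B. xvar i) * (\<Prod>i\<in>B. yvar i))
    = (Poly_Mapping.single (tensor_exps D S B) 1 :: ('k::comm_ring_1, 'n::finite) xy_poly)"
proof -
  have "(\<Prod>v\<in>Inl ` (D \<union> (S - B)) \<union> Inr ` (D \<union> B). Var v :: ('k, 'n) xy_poly)
      = (\<Prod>v\<in>Inl ` (D \<union> (S - B)). Var v) * (\<Prod>v\<in>Inr ` (D \<union> B). Var v)"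
    by (rule prod.union_disjoint) auto
  also have "\<dots> = (\<Prod>i\<in>D \<union> (S - B). xvar i) * (\<Prod>i\<in>D \<union> B. yvar i)"
    by (simp add: prod.reindex)
  also have "(\<Prod>i\<in>D \<union> (S - B). xvar i :: ('k, 'n) xy_poly) = (\<Prod>i\<in>D. xvar i) * (\<Prod>i\<in>S - B. xvar i)"
    using assms by (intro prod.union_disjoint) auto
  also have "(\<Prod>i\<in>D \<union> B. yvar i :: ('k, 'n) xy_poly) = (\<Prod>i\<in>D. yvar i) * (\<Prod>i\<in>B. yvar i)"
    using assms by (intro prod.union_disjoint) auto
  finally show ?thesis by (simp add: prod_Var tensor_exps_def z_prod_def prod.distrib mult_ac)
qed

lemma tensor_exps_eq_iff:
  assumes "D \<inter> S = {}" "B \<subseteq> S" "B' \<subseteq> S"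
  shows "tensor_exps D S B = tensor_exps D S B' \<longleftrightarrow> B = B'"
proof
  assume eq: "tensor_exps D S B = tensor_exps D S B'"
  have "i \<in> D \<union> B \<longleftrightarrow> i \<in> D \<union> B'" for i
    using arg_cong[OF eq, of "\<lambda>m. Poly_Mapping.lookup m (Inr i)"]
    by (auto simp: tensor_exps_def lookup_exps split: if_splits)
  then show "B = B'" using assms by blast
qed simp

lemma lookup_tensor_poly:
  assumes "D \<inter> S = {}"
  shows "Poly_Mapping.lookup (z_prod D * tensor_poly S f) m
    = (\<Sum>B\<in>Pow S. f $ B when m = tensor_exps D S B)"
proof -
  have "z_prod D * tensor_poly S f
    = (\<Sum>B\<in>Pow S. Const (f $ B) * (z_prod D * ((\<Prod>i\<in>S - B. xvar i) * (\<Prod>i\<in>B. yvar i))))"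
    by (simp add: tensor_poly_def sum_distrib_left mult_ac)
  also have "\<dots> = (\<Sum>B\<in>Pow S. Poly_Mapping.single (tensor_exps D S B) (f $ B))"
    using assms by (intro sum.cong) (simp_all add: single_tensor_exps Const_mult_single)
  finally show ?thesis by (simp add: lookup_sum lookup_single eq_commute when_def)
qed

lemma lookup_tensor_poly_exps:
  assumes "D \<inter> S = {}" "B \<subseteq> S"
  shows "Poly_Mapping.lookup (z_prod D * tensor_poly S f) (tensor_exps D S B) = f $ B"
proof -
  have "(\<Sum>B'\<in>Pow S. f $ B' when tensor_exps D S B = tensor_exps D S B') = (\<Sum>B'\<in>Pow S. if B' = B then f $ B' else 0)"
    using assms by (intro sum.cong) (auto simp: tensor_exps_eq_iff when_def)
  then show ?thesis using assms by (simp add: lookup_tensor_poly)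
qed

lemma lookup_tensor_exps_le_1: "Poly_Mapping.lookup (tensor_exps D S B) v \<le> 1"
  by (simp add: tensor_exps_def lookup_exps)

lemma y_degree_tensor_exps:
  assumes "D \<inter> B = {}"
  shows "y_degree (tensor_exps D S B) = card D + card B"
proof -
  define A where "A = D \<union> B"
  have "Poly_Mapping.lookup (tensor_exps D S B) (Inr i) = of_bool (i \<in> A)" for i
    by (auto simp: tensor_exps_def lookup_exps A_def)
  then have "y_degree (tensor_exps D S B) = card (D \<union> B)"
    by (simp add: y_degree_def flip: A_def)
  then show ?thesis using assms by (simp add: card_Un_disjoint)
qed

lemma z_prod_insert: "l \<notin> D \<Longrightarrow> z_prod (insert l D) = xvar l * yvar l * z_prod D"
  by (simp add: z_prod_def)

lemma minors_power_congruent: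
  assumes "minors_power d q" "p = q + (r * Var v ^ 2 + s * Var w ^ 2)"
  shows "minors_power d p"
  unfolding assms(2) by (intro minors_power.add minors_power.square assms(1))

text \<open>
  In characteristic 2 and modulo squares, \<open>minor i l * minor l j = z\<^sub>l * minor i j\<close>. So a minor absorbs
  the factors \<open>z\<^sub>l\<close> one by one, and each of them contributes one more minor.
\<close>

lemma minors_power_z_minor:
  assumes "CHAR('k) = 2" "i \<notin> D" "j \<notin> D"
  shows "minors_power (Suc (card D)) (z_prod D * minor i j :: ('k::comm_ring_1, 'n::finite) xy_poly)"
  using finite[of D] assms(2,3)
proof (induction D arbitrary: i j rule: finite_induct)
  case empty
  then show ?case using minors_power.minor[OF minors_power.zero, of i j 1] by (simp add: z_prod_def)
next
  case (insert l D)
  let ?Z = "z_prod D :: ('k, 'n) xy_poly"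
  note two = char_2_minus[OF assms(1)]
  have eq: "z_prod (insert l D) * minor i j = minor l j * (?Z * minor i l)
      + ((?Z * xvar i * xvar j) * yvar l ^ 2 + (?Z * yvar i * yvar j) * xvar l ^ 2)"
  proof -
    have "minor l j * (?Z * minor i l) = z_prod (insert l D) * (xvar i * yvar j + xvar j * yvar i)
      - ((?Z * xvar i * xvar j) * yvar l ^ 2 + (?Z * yvar i * yvar j) * xvar l ^ 2)"
      using insert by (simp add: z_prod_insert algebra_simps power2_eq_square)
    then show ?thesis
      unfolding two[of "xvar i * yvar j"] by simp
  qed
  have "minors_power (Suc (card D)) (?Z * minor i l)" using insert by auto
  from minors_power_congruent[OF minors_power.minor[OF this] eq] show ?case using insert.hyps by simp
qed

text \<open>
  A variable can absorb the factors as well: modulo squares, \<open>z\<^sub>l x\<^sub>i = - x\<^sub>l * minor l i\<close> and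
  \<open>z\<^sub>l y\<^sub>i = y\<^sub>l * minor l i\<close>.
\<close>

lemma minors_power_z_Var:
  assumes "CHAR('k) = 2" "i \<notin> D" "v = Inl i \<or> v = Inr i"
  shows "minors_power (card D) (z_prod D * Var v :: ('k::comm_ring_1, 'n::finite) xy_poly)"
proof (cases "D = {}")
  case True
  then show ?thesis by (simp add: minors_power.zero)
next
  case False
  then obtain l E where E: "D = insert l E" "l \<notin> E" by (metis Set.set_insert all_not_in_conv)
  let ?Z = "z_prod E :: ('k, 'n) xy_poly"
  have m: "minors_power (card D) (?Z * minor l i)"
    using minors_power_z_minor[OF assms(1), of l E i] E assms(2) by simp
  from assms(3) show ?thesis
  proof
    assume v: "v = Inl i"
    have "z_prod D * Var v = (- xvar l) * (?Z * minor l i) + ((?Z * yvar i) * xvar l ^ 2 + 0 * xvar l ^ 2)"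
      using E v by (simp add: z_prod_insert algebra_simps power2_eq_square)
    then show ?thesis by (rule minors_power_congruent[OF minors_power_mult[OF m]])
  next
    assume v: "v = Inr i"
    have "z_prod D * Var v = yvar l * (?Z * minor l i) + ((?Z * xvar i) * yvar l ^ 2 + 0 * yvar l ^ 2)"
      using E v by (simp add: z_prod_insert algebra_simps power2_eq_square)
    then show ?thesis by (rule minors_power_congruent[OF minors_power_mult[OF m]])
  qed
qed

text \<open>
  With no minor or variable present, two of the factors must be spent on a single minor: modulo
  squares, \<open>z\<^sub>l z\<^sub>k = y\<^sub>l x\<^sub>k * minor l k\<close>.
\<close>

lemma minors_power_z:
  assumes "CHAR('k) = 2" "d < card D"
  shows "minors_power d (z_prod D :: ('k::comm_ring_1, 'n::finite) xy_poly)"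
proof (cases d)
  case 0
  then show ?thesis by (simp add: minors_power.zero)
next
  case (Suc e)
  then have c2: "card D \<ge> 2" using assms by simp
  then obtain l E where E: "D = insert l E" "l \<notin> E"
    by (metis Set.set_insert all_not_in_conv card.empty not_numeral_le_zero)
  then have "card E \<ge> 1" using c2 by simp
  then obtain k F where F: "E = insert k F" "k \<notin> F"
    by (metis Set.set_insert all_not_in_conv card.empty not_one_le_zero)
  let ?Z = "z_prod F :: ('k, 'n) xy_poly"
  have m: "minors_power (Suc (card F)) (?Z * minor l k)"
    using minors_power_z_minor[OF assms(1), of l F k] E F by simp
  have "z_prod D = (yvar l * xvar k) * (?Z * minor l k) + ((?Z * yvar l ^ 2) * xvar k ^ 2 + 0 * xvar k ^ 2)"
    using E F by (simp add: z_prod_insert algebra_simps power2_eq_square)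
  then have "minors_power (Suc (card F)) (z_prod D :: ('k, 'n) xy_poly)"
    by (rule minors_power_congruent[OF minors_power_mult[OF m]])
  then show ?thesis using minors_power_antimono assms(2) E F by fastforce
qed

lemma tensor_poly_add: "tensor_poly S (f + g) = tensor_poly S f + tensor_poly S g"
  by (simp add: tensor_poly_def Const_add distrib_right sum.distrib)

lemma tensor_poly_diff: "tensor_poly S (f - g) = tensor_poly S f - tensor_poly S g"
  by (simp add: tensor_poly_def Const_diff left_diff_distrib sum_subtractf)

lemma tensor_poly_scale: "tensor_poly S (c *s f) = Const c * tensor_poly S f"
  by (simp add: tensor_poly_def Const_mult sum_distrib_left mult_ac)

lemma tensor_poly_0 [simp]: "tensor_poly S 0 = 0"
  by (simp add: tensor_poly_def)

lemma tensor_poly_x: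
  fixes f :: "'k::field ^ 'n::finite set"
  assumes "i \<notin> S"
  shows "tensor_poly (insert i S) (tensor_x i f) = xvar i * tensor_poly S f"
proof -
  let ?t = "\<lambda>S B. (\<Prod>i\<in>S - B. xvar i) * (\<Prod>i\<in>B. yvar i) :: ('k, 'n) xy_poly"
  have "tensor_poly (insert i S) (tensor_x i f) = (\<Sum>B\<in>Pow S. Const (f $ B) * ?t (insert i S) B)"
    unfolding tensor_poly_def
    using assms by (intro sum.mono_neutral_cong_right) (auto simp: tensor_x_def)
  also have "\<dots> = (\<Sum>B\<in>Pow S. xvar i * (Const (f $ B) * ?t S B))"
  proof (rule sum.cong)
    fix B assume "B \<in> Pow S"
    then have "insert i S - B = insert i (S - B)" "i \<notin> S - B" using assms by auto
    then show "Const (f $ B) * ?t (insert i S) B = xvar i * (Const (f $ B) * ?t S B)"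
      by (simp add: mult_ac)
  qed simp
  finally show ?thesis by (simp add: tensor_poly_def sum_distrib_left)
qed

lemma tensor_poly_y:
  fixes f :: "'k::field ^ 'n::finite set"
  assumes "i \<notin> S"
  shows "tensor_poly (insert i S) (tensor_y i f) = yvar i * tensor_poly S f"
proof -
  let ?t = "\<lambda>S B. (\<Prod>i\<in>S - B. xvar i) * (\<Prod>i\<in>B. yvar i) :: ('k, 'n) xy_poly"
  have "tensor_poly (insert i S) (tensor_y i f)
      = (\<Sum>B\<in>insert i ` Pow S. Const (tensor_y i f $ B) * ?t (insert i S) B)"
    unfolding tensor_poly_def Pow_insert by (intro sum.mono_neutral_right) (auto simp: tensor_y_def assms)
  also have "\<dots> = (\<Sum>B\<in>Pow S. Const (tensor_y i f $ insert i B) * ?t (insert i S) (insert i B))"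
    using assms by (subst sum.reindex) (auto simp: inj_on_def)
  also have "\<dots> = (\<Sum>B\<in>Pow S. yvar i * (Const (f $ B) * ?t S B))"
  proof (rule sum.cong)
    fix B assume "B \<in> Pow S"
    then have "insert i S - insert i B = S - B" "i \<notin> B" using assms by auto
    then show "Const (tensor_y i f $ insert i B) * ?t (insert i S) (insert i B) = yvar i * (Const (f $ B) * ?t S B)"
      by (simp add: mult_ac tensor_y_def)
  qed simp
  finally show ?thesis by (simp add: tensor_poly_def sum_distrib_left)
qed

lemma tensor_poly_minor:
  fixes f :: "'k::field ^ 'n::finite set"
  assumes "i \<notin> S" "j \<notin> S" "i \<noteq> j"
  shows "tensor_poly (insert i (insert j S)) (tensor_minor i j f) = minor i j * tensor_poly S f"
proof -
  have "tensor_poly (insert i (insert j S)) (tensor_x i (tensor_y j f)) = xvar i * (yvar j * tensor_poly S f)"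
    using assms by (simp add: tensor_poly_x tensor_poly_y)
  moreover have "tensor_poly (insert j (insert i S)) (tensor_x j (tensor_y i f)) = xvar j * (yvar i * tensor_poly S f)"
    using assms by (simp add: tensor_poly_x tensor_poly_y)
  ultimately show ?thesis
    by (simp add: tensor_minor_def tensor_poly_diff insert_commute left_diff_distrib mult.assoc)
qed

lemma minor_span_empty: "minor_span p b S f \<Longrightarrow> S = {} \<Longrightarrow> p = 0 \<or> f = 0"
  by (induction rule: minor_span.induct) auto

text \<open>
  For nonempty \<open>S\<close>, every product of minors and variables has a factor that can absorb \<open>z\<^sub>D\<close>.
\<close>

lemma minors_power_tensor_poly:
  assumes "CHAR('k::field) = 2"
  shows "minor_span p b S (f :: 'k ^ 'n::finite set) \<Longrightarrow> S \<noteq> {} \<Longrightarrow> D \<inter> S = {}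
    \<Longrightarrow> minors_power (card D + p) (z_prod D * tensor_poly S f)"
proof (induction rule: minor_span.induct)
  case (zero p b S)
  then show ?case by (simp add: minors_power_0)
next
  case (const c)
  then show ?case by simp
next
  case (x p b S f i)
  have "minors_power (card D + p) (xvar i * (z_prod D * tensor_poly S f))"
  proof (cases "S = {}")
    case True
    then consider "p = 0" | "f = 0" using minor_span_empty[OF x.hyps(1)] by blast
    then show ?thesis
    proof cases
      case 1
      then show ?thesis
        using minors_power_mult_right[OF minors_power_z_Var[OF assms, of i D "Inl i"], of "tensor_poly S f"] x.prems
        by (simp add: mult_ac)
    qed (simp add: minors_power_0)
  next
    case False
    then show ?thesis using x minors_power_mult by auto
  qed
  then show ?case using x.hyps by (simp add: tensor_poly_x mult_ac)
next
  case (y p b S f i)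
  have "minors_power (card D + p) (yvar i * (z_prod D * tensor_poly S f))"
  proof (cases "S = {}")
    case True
    then consider "p = 0" | "f = 0" using minor_span_empty[OF y.hyps(1)] by blast
    then show ?thesis
    proof cases
      case 1
      then show ?thesis
        using minors_power_mult_right[OF minors_power_z_Var[OF assms, of i D "Inr i"], of "tensor_poly S f"] y.prems
        by (simp add: mult_ac)
    qed (simp add: minors_power_0)
  next
    case False
    then show ?thesis using y minors_power_mult by auto
  qed
  then show ?case using y.hyps by (simp add: tensor_poly_y mult_ac)
next
  case (minor p b S f i j)
  have "minors_power (Suc (card D + p)) (minor i j * (z_prod D * tensor_poly S f))"
  proof (cases "S = {}")
    case True
    then consider "p = 0" | "f = 0" using minor_span_empty[OF minor.hyps(1)] by blast
    then show ?thesis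
    proof cases
      case 1
      then show ?thesis
        using minors_power_mult_right[OF minors_power_z_minor[OF assms, of i D j], of "tensor_poly S f"] minor.prems
        by (simp add: mult_ac)
    qed (simp add: minors_power_0)
  next
    case False
    then have "minors_power (card D + p) (z_prod D * tensor_poly S f)" using minor by auto
    then show ?thesis by (rule minors_power.minor)
  qed
  then show ?case using minor.hyps by (simp add: tensor_poly_minor mult_ac)
next
  case (add p b S f g)
  then show ?case by (simp add: tensor_poly_add distrib_left minors_power.add)
qed

text \<open>
  The action of a unipotent element of \<open>SL\<^sub>2\<close>, the group that mixes the two rows of variables.
\<close>

definition shear :: "('k::comm_ring_1, 'n::finite) xy_poly \<Rightarrow> ('k, 'n) xy_poly"
  where "shear = subst (case_sum xvar (\<lambda>i. xvar i + yvar i))"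

lemma shear_mult: "shear (p * q) = shear p * shear q"
  by (simp add: shear_def subst_mult)

text \<open>
  The shear fixes every minor. It maps squares into the ideal of squares because
  \<open>(x\<^sub>i + y\<^sub>i)\<^sup>2 = x\<^sub>i\<^sup>2 + y\<^sub>i\<^sup>2\<close> in characteristic 2.
\<close>

lemma minors_power_shear:
  assumes "CHAR('k) = 2"
  shows "minors_power d (p :: ('k::comm_ring_1, 'n::finite) xy_poly) \<Longrightarrow> minors_power d (shear p)"
proof (induction rule: minors_power.induct)
  case (zero p)
  then show ?case by (rule minors_power.zero)
next
  case (square d p v)
  show ?case
  proof (cases v)
    case (Inl i)
    then have "shear (p * Var v ^ 2) = shear p * xvar i ^ 2"
      by (simp add: shear_def subst_mult subst_power subst_Var)
    then show ?thesis by (simp add: minors_power.square)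
  next
    case (Inr i)
    have "(xvar i + yvar i) ^ 2 = (xvar i ^ 2 + yvar i ^ 2 :: ('k, 'n) xy_poly)"
      using char_2_add_self[OF assms, of "xvar i * yvar i"]
      by (simp add: power2_eq_square algebra_simps)
    moreover have "shear (p * Var v ^ 2) = shear p * (xvar i + yvar i) ^ 2"
      using Inr by (simp add: shear_def subst_mult subst_power subst_Var)
    ultimately show ?thesis by (simp add: distrib_left minors_power.square minors_power.add)
  qed
next
  case (minor d p i j)
  have "shear (minor i j * p) = minor i j * shear p"
    by (simp add: shear_def subst_mult subst_diff subst_Var algebra_simps)
  then show ?case using minor minors_power.minor by metis
next
  case (add d p q)
  then show ?case by (simp add: shear_def subst_add minors_power.add)
qed

lemma Const_sum: "Const (\<Sum>a\<in>A. f a) = (\<Sum>a\<in>A. Const (f a))"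
  by (induction A rule: infinite_finite_induct) (simp_all add: Const_add)

definition up_transform :: "'k::field ^ 'n set \<Rightarrow> 'k ^ 'n::finite set"
  where "up_transform f = (\<chi> T. upsum T f)"

lemma shear_tensor_poly:
  fixes f :: "'k::field ^ 'n::finite set"
  assumes "\<And>B. f $ B \<noteq> 0 \<Longrightarrow> B \<subseteq> S"
  shows "shear (tensor_poly S f) = tensor_poly S (up_transform f)"
proof -
  let ?t = "\<lambda>T. (\<Prod>i\<in>S - T. xvar i) * (\<Prod>i\<in>T. yvar i) :: ('k, 'n) xy_poly"
  have "shear ((\<Prod>i\<in>S - B. xvar i) * (\<Prod>i\<in>B. yvar i)) = (\<Sum>T\<in>Pow B. ?t T)" if "B \<subseteq> S" for B
  proof -
    have "shear ((\<Prod>i\<in>S - B. xvar i) * (\<Prod>i\<in>B. yvar i)) = (\<Prod>i\<in>S - B. xvar i) * (\<Prod>i\<in>B. yvar i + xvar i)"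
      by (simp add: shear_def subst_mult subst_prod subst_Var add.commute)
    also have "(\<Prod>i\<in>B. yvar i + xvar i) = (\<Sum>T\<in>Pow B. (\<Prod>i\<in>T. yvar i) * (\<Prod>i\<in>B - T. xvar i))"
      by (rule prod_add) simp
    also have "(\<Prod>i\<in>S - B. xvar i) * \<dots> = (\<Sum>T\<in>Pow B. ?t T)"
      unfolding sum_distrib_left
    proof (rule sum.cong)
      fix T assume "T \<in> Pow B"
      then have "S - T = (S - B) \<union> (B - T)" using that by auto
      moreover have "(\<Prod>i\<in>(S - B) \<union> (B - T). xvar i :: ('k, 'n) xy_poly) = (\<Prod>i\<in>S - B. xvar i) * (\<Prod>i\<in>B - T. xvar i)"
        by (rule prod.union_disjoint) auto
      ultimately show "(\<Prod>i\<in>S - B. xvar i) * ((\<Prod>i\<in>T. yvar i) * (\<Prod>i\<in>B - T. xvar i)) = ?t T"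
        by (simp add: mult_ac)
    qed simp
    finally show ?thesis .
  qed
  then have "shear (tensor_poly S f) = (\<Sum>B\<in>Pow S. \<Sum>T\<in>Pow B. Const (f $ B) * ?t T)"
    unfolding tensor_poly_def by (simp add: shear_def subst_sum subst_mult subst_Const sum_distrib_left)
  also have "\<dots> = (\<Sum>B\<in>Pow S. \<Sum>T\<in>Pow S. if T \<subseteq> B then Const (f $ B) * ?t T else 0)"
    by (intro sum.cong refl sum.mono_neutral_cong_left) auto
  also have "\<dots> = (\<Sum>T\<in>Pow S. \<Sum>B\<in>Pow S. if T \<subseteq> B then Const (f $ B) * ?t T else 0)"
    by (rule sum.swap)
  also have "\<dots> = (\<Sum>T\<in>Pow S. Const (upsum T f) * ?t T)"
  proof (rule sum.cong)
    fix T
    have "upsum T f = (\<Sum>B\<in>Pow S. if T \<subseteq> B then f $ B else 0)"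
      unfolding upsum_def using assms by (intro sum.mono_neutral_cong) auto
    then have "Const (upsum T f) * ?t T = (\<Sum>B\<in>Pow S. Const (if T \<subseteq> B then f $ B else 0) * ?t T)"
      by (simp only: Const_sum sum_distrib_right)
    also have "\<dots> = (\<Sum>B\<in>Pow S. if T \<subseteq> B then Const (f $ B) * ?t T else 0)"
      by (intro sum.cong) auto
    finally show "(\<Sum>B\<in>Pow S. if T \<subseteq> B then Const (f $ B) * ?t T else 0) = Const (upsum T f) * ?t T" ..
  qed simp
  finally show ?thesis by (simp add: tensor_poly_def up_transform_def)
qed

lemma shear_z_prod:
  "minors_power d (shear (z_prod D) - z_prod D :: ('k::comm_ring_1, 'n::finite) xy_poly)"
  using finite[of D]
proof (induction D rule: finite_induct)
  case empty
  then show ?case by (simp add: z_prod_def shear_def minors_power_0)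
next
  case (insert l D)
  have "shear (z_prod (insert l D)) = xvar l * (xvar l + yvar l) * shear (z_prod D :: ('k, 'n) xy_poly)"
    using insert.hyps by (simp add: z_prod_insert shear_def subst_mult subst_Var)
  then have "shear (z_prod (insert l D)) - z_prod (insert l D)
    = shear (z_prod D) * xvar l ^ 2 + xvar l * yvar l * (shear (z_prod D) - z_prod D :: ('k, 'n) xy_poly)"
    using insert.hyps by (simp add: z_prod_insert algebra_simps power2_eq_square)
  then show ?case using insert.IH minors_power_mult minors_power.square minors_power.add by metis
qed

text \<open>
  The sheared polynomial still lies in the \<open>d\<close>-th power, so modulo squares it has no terms of \<open>y\<close>-degree
  less than \<open>d\<close>. Its coefficient at \<open>z\<^sub>D x\<^bsub>S - T\<^esub> y\<^sub>T\<close> is \<open>upsum T f\<close>, and this monomial has \<open>y\<close>-degree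
  \<open>card D + card T\<close>.
\<close>

lemma annih_of_minors_power:
  fixes f :: "'k::field ^ 'n::finite set"
  assumes "CHAR('k) = 2" "D \<inter> S = {}" "supported b S f"
    "minors_power d (z_prod D * tensor_poly S f)"
  shows "f \<in> annih (d - card D) b S"
proof -
  have sup: "f $ B \<noteq> 0 \<Longrightarrow> B \<subseteq> S" for B using assms(3) by (auto simp: supported_def)
  \<comment> \<open>The shear changes \<open>z\<^sub>D\<close> only by a combination of squares.\<close>
  have "shear (z_prod D * tensor_poly S f) - z_prod D * tensor_poly S (up_transform f)
    = tensor_poly S (up_transform f) * (shear (z_prod D) - z_prod D)"
    by (simp add: shear_mult shear_tensor_poly[OF sup] right_diff_distrib mult.commute)
  then have "minors_power d (shear (z_prod D * tensor_poly S f) - z_prod D * tensor_poly S (up_transform f))"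
    using shear_z_prod minors_power_mult by metis
  from minors_power_diff[OF minors_power_shear[OF assms(1,4)] this]
  have mp: "minors_power d (z_prod D * tensor_poly S (up_transform f))" by simp
  have "upsum T f = 0" if T: "card T < d - card D" for T
  proof (cases "T \<subseteq> S")
    case True
    show ?thesis
    proof (rule ccontr)
      assume "upsum T f \<noteq> 0"
      then have *: "tensor_exps D S T \<in> Poly_Mapping.keys (z_prod D * tensor_poly S (up_transform f))"
        using lookup_tensor_poly_exps[OF assms(2) True, of "up_transform f"]
        by (simp add: in_keys_iff up_transform_def)
      have "D \<inter> T = {}" using assms(2) True by blast
      from minors_power_y_degree[OF mp * lookup_tensor_exps_le_1] have "d \<le> card D + card T"
        using y_degree_tensor_exps[OF \<open>D \<inter> T = {}\<close>, of S] by simp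
      then show False using T by simp
    qed
  next
    case False
    then show ?thesis unfolding upsum_def using sup by (intro sum.neutral) blast
  qed
  then show ?thesis using assms(3) by (simp add: annih_def)
qed

lemma minors_power_tensor_poly_iff:
  fixes f :: "'k::field ^ 'n::finite set"
  assumes "CHAR('k) = 2" "D \<inter> S = {}" "S \<noteq> {}" "supported b S f"
  shows "minors_power d (z_prod D * tensor_poly S f) \<longleftrightarrow> f \<in> annih (d - card D) b S"
proof
  assume "f \<in> annih (d - card D) b S"
  then have "minors_power (card D + (d - card D)) (z_prod D * tensor_poly S f)"
    using annih_minor_span minors_power_tensor_poly assms by blast
  then show "minors_power d (z_prod D * tensor_poly S f)"
    by (rule minors_power_antimono) simp
qed (use annih_of_minors_power assms in blast)

definition swap_exps :: "('n + 'n::finite \<Rightarrow>\<^sub>0 nat) \<Rightarrow> 'n + 'n \<Rightarrow>\<^sub>0 nat"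
  where "swap_exps m = (\<Sum>v\<in>UNIV. Poly_Mapping.single v (Poly_Mapping.lookup m (case_sum Inr Inl v)))"

lemma lookup_swap_exps: "Poly_Mapping.lookup (swap_exps m) v = Poly_Mapping.lookup m (case_sum Inr Inl v)"
  by (simp add: swap_exps_def lookup_sum lookup_single when_def if_distrib cong: if_cong)

lemma swap_swap: "case_sum Inr Inl (case_sum Inr Inl v) = v"
  by (cases v) auto

lemma swap_exps_swap_exps: "swap_exps (swap_exps m) = m"
  by (rule poly_mapping_eqI) (simp add: lookup_swap_exps swap_swap)

text \<open>
  The exchange of the two rows of variables; it fixes the minors up to sign.
\<close>

definition swap_xy :: "('k::comm_ring_1, 'n::finite) xy_poly \<Rightarrow> ('k, 'n) xy_poly"
  where "swap_xy = subst (case_sum yvar xvar)"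

lemma swap_xy_single: "swap_xy (Poly_Mapping.single m c) = (Poly_Mapping.single (swap_exps m) c :: ('k::comm_ring_1, 'n::finite) xy_poly)"
proof -
  let ?s = "case_sum Inr Inl :: 'n + 'n \<Rightarrow> 'n + 'n"
  have eq: "case_sum yvar xvar v = Var (?s v)" for v by (cases v) auto
  have "(\<Prod>v\<in>UNIV. Var (?s v) ^ Poly_Mapping.lookup m v)
      = (\<Prod>v\<in>UNIV. Var v ^ Poly_Mapping.lookup (swap_exps m) v :: ('k, 'n) xy_poly)"
    by (rule prod.reindex_bij_witness[where i="?s" and j="?s"]) (auto simp: swap_swap lookup_swap_exps)
  then show ?thesis
    by (simp add: swap_xy_def subst_single eq Const_mult_single flip: single_eq_prod_Var)
qed

lemma lookup_swap_xy: "Poly_Mapping.lookup (swap_xy p) m = Poly_Mapping.lookup p (swap_exps m)"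
proof (induction p rule: poly_mapping_monomial_induct)
  case (single n c)
  have "swap_exps n = m \<longleftrightarrow> n = swap_exps m" using swap_exps_swap_exps by metis
  then show ?case by (simp add: swap_xy_single lookup_single when_def)
next
  case (add p q)
  have "swap_xy (p + q) = swap_xy p + swap_xy q" by (simp add: swap_xy_def subst_add)
  then show ?case using add by (simp add: lookup_add)
qed (simp add: swap_xy_def)

definition total_degree :: "('n + 'n::finite \<Rightarrow>\<^sub>0 nat) \<Rightarrow> nat"
  where "total_degree m = (\<Sum>v\<in>UNIV. Poly_Mapping.lookup m v)"

lemma total_degree_add: "total_degree (m + n) = total_degree m + total_degree n"
  by (simp add: total_degree_def lookup_add sum.distrib)

lemma total_degree_single: "total_degree (Poly_Mapping.single v e) = e"
  by (simp add: total_degree_def lookup_single when_def)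

text \<open>
  Modulo squares, an element of the \<open>d\<close>-th power is a combination \<open>c\<close> of products of \<open>d\<close> minors plus
  terms of total degree more than \<open>2 * d\<close>. In characteristic 2 the exchange of rows fixes each minor,
  hence \<open>c\<close>; and for \<open>d > 0\<close>, writing one of the minors as \<open>x\<^sub>i y\<^sub>j + swap_xy (x\<^sub>i y\<^sub>j)\<close> exhibits \<open>c\<close> as
  \<open>q + swap_xy q\<close>.
\<close>

lemma minors_power_leading_part:
  assumes "CHAR('k) = 2" "minors_power d (p :: ('k::comm_ring_1, 'n::finite) xy_poly)"
  shows "\<exists>c q. (\<forall>m\<in>Poly_Mapping.keys (p - c). (\<forall>v. Poly_Mapping.lookup m v \<le> 1) \<longrightarrow> 2 * d < total_degree m)
    \<and> swap_xy c = c \<and> (d > 0 \<longrightarrow> c = q + swap_xy q)"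
  using assms(2)
proof (induction rule: minors_power.induct)
  case (zero p)
  let ?c = "Const (Poly_Mapping.lookup p 0)"
  have "0 < total_degree m" if "m \<in> Poly_Mapping.keys (p - ?c)" for m
  proof (rule ccontr)
    assume "\<not> 0 < total_degree m"
    then have "m = 0" by (intro poly_mapping_eqI) (simp add: total_degree_def)
    then show False using that by (simp add: in_keys_iff lookup_minus Const_def)
  qed
  then show ?case by (intro exI[of _ ?c] exI[of _ 0]) (simp add: swap_xy_def subst_Const)
next
  case (square d p v)
  have "\<not> (\<forall>w. Poly_Mapping.lookup m w \<le> 1)" if "m \<in> Poly_Mapping.keys (p * Var v ^ 2)" for m
    using keys_mult_square[OF that] by (metis not_less_eq_eq numeral_2_eq_2 One_nat_def)
  then show ?case by (intro exI[of _ 0]) (auto simp: swap_xy_def)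
next
  case (minor d p i j)
  then obtain c where c: "\<forall>m\<in>Poly_Mapping.keys (p - c). (\<forall>v. Poly_Mapping.lookup m v \<le> 1) \<longrightarrow> 2 * d < total_degree m"
    "swap_xy c = c" by blast
  have swap: "swap_xy (xvar i * yvar j * c) = xvar j * yvar i * c"
    using c(2) by (simp add: swap_xy_def subst_mult subst_Var mult_ac)
  have swap': "swap_xy (xvar j * yvar i * c) = xvar i * yvar j * c"
    using c(2) by (simp add: swap_xy_def subst_mult subst_Var mult_ac)
  have eq: "minor i j * c = xvar i * yvar j * c + swap_xy (xvar i * yvar j * c)"
    unfolding swap left_diff_distrib by (rule char_2_minus[OF assms(1)])
  have inv: "swap_xy (minor i j * c) = minor i j * c"
  proof -
    have "swap_xy (p + q) = swap_xy p + swap_xy q" for p q :: "('k, 'n) xy_poly"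
      by (simp add: swap_xy_def subst_add)
    then show ?thesis unfolding eq swap swap' by (simp only: swap swap' add.commute)
  qed
  have "2 * Suc d < total_degree m"
    if m: "m \<in> Poly_Mapping.keys (minor i j * p - minor i j * c)" "\<And>v. Poly_Mapping.lookup m v \<le> 1" for m
  proof -
    have "m \<in> Poly_Mapping.keys (minor i j * (p - c))" using m(1) by (simp add: right_diff_distrib)
    then obtain k l n where n: "m = (Poly_Mapping.single (Inl k) 1 + Poly_Mapping.single (Inr l) 1) + n" "n \<in> Poly_Mapping.keys (p - c)"
      by (rule keys_mult_minor)
    have "Poly_Mapping.lookup n v \<le> 1" for v
      using m(2)[of v] unfolding n by (simp add: lookup_add)
    then have "2 * d < total_degree n" using c(1) n by blast
    then show ?thesis unfolding n by (simp add: total_degree_add total_degree_single)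
  qed
  then show ?case using eq inv by blast
next
  case (add d p p')
  then obtain c q c' q' where
    c: "\<forall>m\<in>Poly_Mapping.keys (p - c). (\<forall>v. Poly_Mapping.lookup m v \<le> 1) \<longrightarrow> 2 * d < total_degree m"
    "swap_xy c = c" "d > 0 \<longrightarrow> c = q + swap_xy q"
    and c': "\<forall>m\<in>Poly_Mapping.keys (p' - c'). (\<forall>v. Poly_Mapping.lookup m v \<le> 1) \<longrightarrow> 2 * d < total_degree m"
    "swap_xy c' = c'" "d > 0 \<longrightarrow> c' = q' + swap_xy q'" by blast
  have swap_add: "swap_xy (p + q) = swap_xy p + swap_xy q" for p q :: "('k, 'n) xy_poly"
    by (simp add: swap_xy_def subst_add)
  have "Poly_Mapping.keys (p + p' - (c + c')) \<subseteq> Poly_Mapping.keys (p - c) \<union> Poly_Mapping.keys (p' - c')"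
    using keys_add[of "p - c" "p' - c'"] by (simp add: algebra_simps)
  then have "\<forall>m\<in>Poly_Mapping.keys (p + p' - (c + c')). (\<forall>v. Poly_Mapping.lookup m v \<le> 1) \<longrightarrow> 2 * d < total_degree m"
    using c(1) c'(1) by blast
  moreover have "d > 0 \<longrightarrow> c + c' = (q + q') + swap_xy (q + q')"
    using c(3) c'(3) by (auto simp: swap_add)
  ultimately show ?case using c(2) c'(2) swap_add by metis
qed

lemma z_prod_single: "z_prod D = (Poly_Mapping.single (tensor_exps D {} {}) 1 :: ('k::comm_ring_1, 'n::finite) xy_poly)"
  using single_tensor_exps[of D "{}" "{}"] by simp

text \<open>
  The monomial \<open>z\<^sub>D\<close> is fixed by the exchange of rows, so its coefficient in \<open>q + swap_xy q\<close> is twice its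
  coefficient in \<open>q\<close>, that is zero. As its total degree is \<open>2 * card D\<close>, it cannot lie in a power with
  exponent \<open>card D\<close> or more.
\<close>

lemma minors_power_z_iff:
  assumes "CHAR('k) = 2" "D \<noteq> {}"
  shows "minors_power d (z_prod D :: ('k::comm_ring_1, 'n::finite) xy_poly) \<longleftrightarrow> d < card D"
proof
  let ?m = "tensor_exps D {} {}"
  assume mp: "minors_power d (z_prod D :: ('k, 'n) xy_poly)"
  show "d < card D"
  proof (rule ccontr)
    assume "\<not> d < card D"
    then have d: "card D \<le> d" "d > 0" using assms(2) card_gt_0_iff[of D] by auto
    obtain c q :: "('k, 'n) xy_poly" where
      c: "\<forall>m\<in>Poly_Mapping.keys (z_prod D - c). (\<forall>v. Poly_Mapping.lookup m v \<le> 1) \<longrightarrow> 2 * d < total_degree m"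
      "c = q + swap_xy q"
      using minors_power_leading_part[OF assms(1) mp] d(2) by blast
    define V where "V = Inl ` D \<union> (Inr ` D :: ('n + 'n) set)"
    have "total_degree ?m = (\<Sum>v\<in>UNIV. of_bool (v \<in> V))"
      by (simp add: total_degree_def tensor_exps_def lookup_exps of_bool_def flip: V_def)
    also have "\<dots> = card (Inl ` D \<union> Inr ` D)" by (simp flip: V_def)
    also have "\<dots> = 2 * card D"
      by (subst card_Un_disjoint) (auto simp: card_image)
    finally have "total_degree ?m \<le> 2 * d" using d by simp
    then have "?m \<notin> Poly_Mapping.keys (z_prod D - c)" using c(1) lookup_tensor_exps_le_1[of D "{}" "{}"] by force
    then have "Poly_Mapping.lookup c ?m = 1"
      by (simp add: in_keys_iff lookup_minus z_prod_single)
    moreover have "swap_exps ?m = ?m"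
    proof (rule poly_mapping_eqI)
      fix v show "Poly_Mapping.lookup (swap_exps ?m) v = Poly_Mapping.lookup ?m v"
        by (cases v) (auto simp: lookup_swap_exps tensor_exps_def lookup_exps)
    qed
    then have "Poly_Mapping.lookup c ?m = Poly_Mapping.lookup (q + q) ?m"
      unfolding c(2) lookup_add lookup_swap_xy by (simp only:)
    then have "Poly_Mapping.lookup c ?m = 0" by (simp only: char_2_add_self[OF assms(1)] lookup_zero)
    ultimately show False by simp
  qed
qed (use minors_power_z assms in blast)

section \<open>Coefficients of the truncated Schur polynomials\<close>

definition set_exps :: "'n set \<Rightarrow> 'n::finite \<Rightarrow>\<^sub>0 nat"
  where "set_exps U = (\<Sum>i\<in>U. Poly_Mapping.single i 1)"

lemma lookup_set_exps: "Poly_Mapping.lookup (set_exps U) i = (if i \<in> U then 1 else 0)"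
  by (simp add: set_exps_def lookup_sum lookup_single when_def if_distrib cong: if_cong)

lemma h2_eq: "h2 m = (\<Sum>U | int (card U) = m. Poly_Mapping.single (set_exps U) 1)"
  unfolding h2_def
proof (rule sum.reindex_bij_witness[where i="set_exps" and j="\<lambda>e. {i. Poly_Mapping.lookup e i = 1}"])
  fix e :: "'a \<Rightarrow>\<^sub>0 nat"
  assume "e \<in> {e. (\<Sum>j\<in>UNIV. int (Poly_Mapping.lookup e j)) = m \<and> (\<forall>j. Poly_Mapping.lookup e j < 2)}"
  then have e: "(\<Sum>j\<in>UNIV. int (Poly_Mapping.lookup e j)) = m" "\<And>j. Poly_Mapping.lookup e j < 2" by auto
  have eq: "Poly_Mapping.lookup e i = of_bool (i \<in> {i. Poly_Mapping.lookup e i = 1})" for i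
    using e(2)[of i] by auto
  show exps: "set_exps {i. Poly_Mapping.lookup e i = 1} = e"
  proof (rule poly_mapping_eqI)
    fix i show "Poly_Mapping.lookup (set_exps {i. Poly_Mapping.lookup e i = 1}) i = Poly_Mapping.lookup e i"
      using e(2)[of i] by (auto simp: lookup_set_exps)
  qed
  have "int (card {i. Poly_Mapping.lookup e i = 1}) = (\<Sum>i\<in>UNIV. int (of_bool (i \<in> {i. Poly_Mapping.lookup e i = 1})))"
    by simp
  also have "\<dots> = m" unfolding e(1)[symmetric] by (intro sum.cong refl) (metis eq)
  finally show "{i. Poly_Mapping.lookup e i = 1} \<in> {U. int (card U) = m}" by simp
  show "Poly_Mapping.single (set_exps {i. Poly_Mapping.lookup e i = 1}) 1 = Poly_Mapping.single e 1"
    by (simp only: exps)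
next
  fix U :: "'a set" assume U: "U \<in> {U. int (card U) = m}"
  show "{i. Poly_Mapping.lookup (set_exps U) i = 1} = U" by (auto simp: lookup_set_exps)
  have "(\<Sum>j\<in>UNIV. int (Poly_Mapping.lookup (set_exps U) j)) = (\<Sum>j\<in>UNIV. of_bool (j \<in> U))"
    by (intro sum.cong) (auto simp: lookup_set_exps)
  then show "set_exps U \<in> {e. (\<Sum>j\<in>UNIV. int (Poly_Mapping.lookup e j)) = m \<and> (\<forall>j. Poly_Mapping.lookup e j < 2)}"
    using U by (auto simp: lookup_set_exps)
qed

definition doubles :: "('n::finite \<Rightarrow>\<^sub>0 nat) \<Rightarrow> 'n set"
  where "doubles \<mu> = {i. Poly_Mapping.lookup \<mu> i = 2}"

definition singles :: "('n::finite \<Rightarrow>\<^sub>0 nat) \<Rightarrow> 'n set"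
  where "singles \<mu> = {i. Poly_Mapping.lookup \<mu> i = 1}"

definition int_choose :: "nat \<Rightarrow> int \<Rightarrow> int"
  where "int_choose s k = (if k < 0 then 0 else int (s choose nat k))"

text \<open>
  The weights of the monomials of total degree \<open>k\<close> in which no variable is squared.
\<close>

definition admissible :: "('n::finite \<Rightarrow>\<^sub>0 nat) \<Rightarrow> nat \<Rightarrow> bool"
  where "admissible \<mu> k \<longleftrightarrow> (\<forall>i. Poly_Mapping.lookup \<mu> i \<le> 2) \<and> card (singles \<mu>) + 2 * card (doubles \<mu>) = k"

text \<open>
  If \<open>U\<close> and \<open>V\<close> are the supports of two squarefree monomials with product \<open>t\<^sup>\<mu>\<close>, then both
  contain all doubled indices and each further index of \<open>\<mu>\<close> belongs to exactly one of them. So the pair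
  is determined by the part of \<open>V\<close> inside \<open>singles \<mu>\<close>.
\<close>

lemma lookup_h2_mult:
  fixes \<mu> :: "'n::finite \<Rightarrow>\<^sub>0 nat"
  assumes "u + v = int k"
  shows "Poly_Mapping.lookup (h2 u * h2 v) \<mu>
    = (if admissible \<mu> k then int_choose (card (singles \<mu>)) (v - int (card (doubles \<mu>))) else 0)"
proof -
  let ?D = "doubles \<mu>" and ?S = "singles \<mu>"
  let ?P = "{(U, V). int (card U) = u \<and> int (card V) = v \<and> set_exps U + set_exps V = \<mu>}"
  have "h2 u * h2 v = (\<Sum>(U, V)\<in>{U. int (card U) = u} \<times> {V :: 'n set. int (card V) = v}.
      Poly_Mapping.single (set_exps U + set_exps V) 1)"
    unfolding h2_eq sum_product by (simp add: mult_single sum.cartesian_product)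
  then have "Poly_Mapping.lookup (h2 u * h2 v) \<mu> =
    (\<Sum>(U, V)\<in>{U. int (card U) = u} \<times> {V. int (card V) = v}. if set_exps U + set_exps V = \<mu> then 1 else 0)"
    by (simp add: lookup_sum lookup_single when_def case_prod_unfold eq_commute)
  also have "\<dots> = (\<Sum>UV\<in>?P. 1)"
    by (rule sum.mono_neutral_cong_right) auto
  finally have card: "Poly_Mapping.lookup (h2 u * h2 v) \<mu> = int (card ?P)" by simp
  have exps: "set_exps U + set_exps V = \<mu> \<longleftrightarrow>
    (\<forall>i. (if i \<in> U then 1 else 0) + (if i \<in> V then 1 else 0) = Poly_Mapping.lookup \<mu> i)" for U V
    by (simp add: poly_mapping_eq_iff fun_eq_iff lookup_add lookup_set_exps)
  show ?thesis
  proof (cases "admissible \<mu> k")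
    case False
    have "?P = {}"
    proof (rule ccontr)
      assume "?P \<noteq> {}"
      then obtain U V where UV: "int (card U) = u" "int (card V) = v" "set_exps U + set_exps V = \<mu>" by auto
      then have l: "(if i \<in> U then 1 else 0) + (if i \<in> V then 1 else 0) = Poly_Mapping.lookup \<mu> i" for i
        using exps by blast
      have "Poly_Mapping.lookup \<mu> i \<le> 2" for i unfolding l[symmetric] by simp
      moreover have "U \<union> V = ?S \<union> ?D" "U \<inter> V = ?D"
        using l by (auto simp: singles_def doubles_def simp flip: l split: if_splits)
      then have "card U + card V = card (?S \<union> ?D) + card ?D" by (metis card_Un_Int finite)
      then have "card U + card V = card ?S + card ?D + card ?D"
        by (subst (asm) card_Un_disjoint) (auto simp: singles_def doubles_def)
      ultimately have "admissible \<mu> k" using UV assms by (simp add: admissible_def)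
      then show False using False by simp
    qed
    then show ?thesis using card False by simp
  next
    case True
    then have le: "Poly_Mapping.lookup \<mu> i \<le> 2" for i by (simp add: admissible_def)
    have k: "card ?S + 2 * card ?D = k" using True by (simp add: admissible_def)
    have disj: "?D \<inter> ?S = {}" by (auto simp: singles_def doubles_def)
    have cV: "card (?D \<union> B) = card ?D + card B" if "B \<subseteq> ?S" for B
      using that disj by (intro card_Un_disjoint) auto
    have cU: "card (?D \<union> (?S - B)) + card B = card ?D + card ?S" if "B \<subseteq> ?S" for B
    proof -
      have "card (?D \<union> (?S - B)) = card ?D + card (?S - B)" using disj by (intro card_Un_disjoint) auto
      moreover have "card (?S - B) + card B = card ?S"
        using that by (metis card_Diff_subset card_mono finite le_add_diff_inverse2)
      ultimately show ?thesis by simp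
    qed
    have "bij_betw (\<lambda>B. (?D \<union> (?S - B), ?D \<union> B)) {B. B \<subseteq> ?S \<and> int (card ?D + card B) = v} ?P"
    proof (rule bij_betwI[where g="\<lambda>(U, V). V - ?D"])
      show "(\<lambda>B. (?D \<union> (?S - B), ?D \<union> B)) \<in> {B. B \<subseteq> ?S \<and> int (card ?D + card B) = v} \<rightarrow> ?P"
      proof
        fix B assume B: "B \<in> {B. B \<subseteq> ?S \<and> int (card ?D + card B) = v}"
        have "int (card (?D \<union> (?S - B))) = u" using B cU[of B] k assms by auto
        moreover have "(if i \<in> ?D \<union> (?S - B) then 1 else 0) + (if i \<in> ?D \<union> B then 1 else 0) = Poly_Mapping.lookup \<mu> i" for i
          using B le[of i] by (auto simp: singles_def doubles_def)
        ultimately show "(?D \<union> (?S - B), ?D \<union> B) \<in> ?P"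
          using B cV[of B] exps by auto
      qed
      have l: "(if i \<in> U then 1 else 0) + (if i \<in> V then 1 else 0) = Poly_Mapping.lookup \<mu> i"
        if "(U, V) \<in> ?P" for U V i using that exps by auto
      have UV: "U = ?D \<union> (?S - (V - ?D))" "V = ?D \<union> (V - ?D)" "V - ?D \<subseteq> ?S" if "(U, V) \<in> ?P" for U V
        using l[OF that] by (auto simp: singles_def doubles_def simp flip: l[OF that] split: if_splits)
      show "(\<lambda>(U, V). V - ?D) \<in> ?P \<rightarrow> {B. B \<subseteq> ?S \<and> int (card ?D + card B) = v}"
      proof
        fix UV assume "UV \<in> ?P"
        moreover obtain U V where "UV = (U, V)" by (cases UV)
        ultimately show "(case UV of (U, V) \<Rightarrow> V - ?D) \<in> {B. B \<subseteq> ?S \<and> int (card ?D + card B) = v}"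
          using UV[of U V] cV[of "V - ?D"] by auto
      qed
      show "(case (?D \<union> (?S - B), ?D \<union> B) of (U, V) \<Rightarrow> V - ?D) = B"
        if "B \<in> {B. B \<subseteq> ?S \<and> int (card ?D + card B) = v}" for B using that disj by auto
      show "(\<lambda>B. (?D \<union> (?S - B), ?D \<union> B)) (case UV of (U, V) \<Rightarrow> V - ?D) = UV" if "UV \<in> ?P" for UV
      proof -
        obtain U V where eq: "UV = (U, V)" by (cases UV)
        then have "(U, V) \<in> ?P" using that by simp
        from UV(1,2)[OF this] show ?thesis unfolding eq prod.case by simp
      qed
    qed
    then have "card ?P = card {B. B \<subseteq> ?S \<and> int (card ?D + card B) = v}" by (simp add: bij_betw_same_card)
    also have "int \<dots> = int_choose (card ?S) (v - int (card ?D))"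
    proof (cases "v < int (card ?D)")
      case True
      then have "{B. B \<subseteq> ?S \<and> int (card ?D + card B) = v} = {}" by auto
      then show ?thesis using True by (simp add: int_choose_def)
    next
      case False
      then have "{B. B \<subseteq> ?S \<and> int (card ?D + card B) = v} = {B. B \<subseteq> ?S \<and> card B = nat (v - int (card ?D))}"
        by auto
      then show ?thesis using False by (simp add: int_choose_def n_subsets)
    qed
    finally show ?thesis using card True by simp
  qed
qed

lemma lookup_s2:
  fixes \<mu> :: "'n::finite \<Rightarrow>\<^sub>0 nat"
  assumes "u + v = int k"
  shows "Poly_Mapping.lookup (s2 u v) \<mu> = (if admissible \<mu> k then
    int_choose (card (singles \<mu>)) (v - int (card (doubles \<mu>)))
    - int_choose (card (singles \<mu>)) (v - int (card (doubles \<mu>)) - 1) else 0)"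
proof -
  have "(s2 u v :: 'n t_poly) = h2 u * h2 v - h2 (u + 1) * h2 (v - 1)"
    by (simp add: s2_def det_2 vector_def)
  then show ?thesis
    using lookup_h2_mult[of u v k \<mu>] lookup_h2_mult[of "u + 1" "v - 1" k \<mu>] assms
    by (simp add: lookup_minus) (simp add: algebra_simps)
qed

lemma int_choose_symmetric: "int_choose s (int s - k) = int_choose s k"
proof -
  consider "k < 0" | "k > int s" | "0 \<le> k" "k \<le> int s" by linarith
  then show ?thesis
  proof cases
    case 1
    then show ?thesis by (simp add: int_choose_def)
  next
    case 2
    then show ?thesis by (simp add: int_choose_def)
  next
    case 3
    then obtain j where "k = int j" "j \<le> s" by (metis nat_eq_iff nat_le_iff)
    then show ?thesis by (simp add: int_choose_def binomial_symmetric[of j s] flip: of_nat_diff)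
  qed
qed

lemma int_choose_Suc: "int_choose (Suc s) k = int_choose s k + int_choose s (k - 1)"
proof (cases "k \<le> 0")
  case True
  then show ?thesis by (auto simp: int_choose_def)
next
  case False
  then obtain j where "k = int (Suc j)" by (metis gr0_implies_Suc not_le pos_int_cases)
  then show ?thesis by (simp add: int_choose_def nat_add_distrib)
qed

text \<open>
  By Pascal's rule the \<open>j\<close>-th difference is \<open>K\<^sub>j - K\<^bsub>j+2\<^esub>\<close> with \<open>K\<^sub>j = (2 * r - 1) choose (r - j)\<close>, so the
  sum telescopes to \<open>K\<^sub>0 - K\<^sub>1\<close>, which is zero by the symmetry of the binomial coefficients.
\<close>

lemma alternating_sum_int_choose:
  assumes "r \<le> a" "r > 0"
  shows "(\<Sum>j=0..a. (-1) ^ j * (int_choose (2 * r) (int r - int j) - int_choose (2 * r) (int r - int j - 1))) = 0"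
proof -
  obtain q where q: "2 * r = Suc q" using assms(2) by (metis not0_implies_Suc mult_is_0 not_gr0 numeral_2_eq_2 Zero_not_Suc)
  \<comment> \<open>Here \<open>q = 2 * r - 1\<close>.\<close>
  define K where "K j = int_choose q (int r - int j)" for j
  have t: "int_choose (2 * r) (int r - int j) - int_choose (2 * r) (int r - int j - 1) = K j - K (Suc (Suc j))" for j
    unfolding q int_choose_Suc K_def by (simp add: algebra_simps)
  have "(\<Sum>j=0..n. (-1) ^ j * (K j - K (Suc (Suc j)))) = K 0 - K 1 + (-1) ^ n * (K (Suc n) - K (Suc (Suc n)))" for n
    by (induction n) (simp_all add: algebra_simps)
  moreover have "K (Suc a) = 0" "K (Suc (Suc a)) = 0" using assms by (simp_all add: K_def int_choose_def)
  moreover have "K 0 = K 1"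
  proof -
    have "int q - int r = int r - 1" using q by simp
    then show ?thesis using int_choose_symmetric[of q "int r"] by (simp add: K_def)
  qed
  ultimately show ?thesis by (simp add: t)
qed

section \<open>Dimensions of the weight spaces\<close>

lemma doubles_singles_disjoint: "doubles \<mu> \<inter> singles \<mu> = {}"
  by (auto simp: doubles_def singles_def)

lemma minors_power_of_squares:
  fixes p :: "('k::comm_ring_1, 'n::finite) xy_poly"
  assumes "\<And>m. m \<in> Poly_Mapping.keys p \<Longrightarrow> \<exists>v. Poly_Mapping.lookup m v > 1"
  shows "minors_power d p"
proof -
  have "minors_power d (Poly_Mapping.single m c :: ('k, 'n) xy_poly)" if v: "Poly_Mapping.lookup m v > 1" for m v c
  proof -
    define n where "n = m - Poly_Mapping.single v 2"
    have m: "m = n + Poly_Mapping.single v 2"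
      by (rule poly_mapping_eqI) (use v in \<open>auto simp: n_def lookup_add lookup_minus lookup_single when_def\<close>)
    have "Poly_Mapping.single m c = Poly_Mapping.single n c * Var v ^ 2"
      by (simp add: Var_square m mult_single)
    then show ?thesis by (simp add: minors_power.square)
  qed
  then have "minors_power d (\<Sum>m\<in>Poly_Mapping.keys p. Poly_Mapping.single m (Poly_Mapping.lookup p m))"
    using assms by (intro minors_power_sum) blast
  then show ?thesis by (simp flip: poly_mapping_sum_single)
qed

lemma squarefree_exps:
  assumes "weight m = \<mu>" "\<And>v. Poly_Mapping.lookup m v \<le> 1"
  obtains B where "B \<subseteq> singles \<mu>" "m = tensor_exps (doubles \<mu>) (singles \<mu>) B" "\<And>i. Poly_Mapping.lookup \<mu> i \<le> 2"
proof
  let ?B = "{i \<in> singles \<mu>. Poly_Mapping.lookup m (Inr i) = 1}"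
  show "?B \<subseteq> singles \<mu>" by blast
  have w: "Poly_Mapping.lookup \<mu> i = Poly_Mapping.lookup m (Inl i) + Poly_Mapping.lookup m (Inr i)" for i
    using assms(1) by (simp flip: lookup_weight)
  show "Poly_Mapping.lookup \<mu> i \<le> 2" for i
    using w[of i] assms(2)[of "Inl i"] assms(2)[of "Inr i"] by simp
  show "m = tensor_exps (doubles \<mu>) (singles \<mu>) ?B"
  proof (rule poly_mapping_eqI)
    fix v
    show "Poly_Mapping.lookup m v = Poly_Mapping.lookup (tensor_exps (doubles \<mu>) (singles \<mu>) ?B) v"
    proof (cases v)
      case (Inl i)
      then show ?thesis
        using w[of i] assms(2)[of "Inl i"] assms(2)[of "Inr i"]
        by (auto simp: tensor_exps_def lookup_exps doubles_def singles_def)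
    next
      case (Inr i)
      then show ?thesis
        using w[of i] assms(2)[of "Inl i"] assms(2)[of "Inr i"]
        by (auto simp: tensor_exps_def lookup_exps doubles_def singles_def)
    qed
  qed
qed

lemma x_degree_tensor_exps:
  assumes "D \<inter> S = {}"
  shows "(\<Sum>i\<in>UNIV. Poly_Mapping.lookup (tensor_exps D S B) (Inl i)) = card D + card (S - B)"
proof -
  define A where "A = D \<union> (S - B)"
  have "Poly_Mapping.lookup (tensor_exps D S B) (Inl i) = of_bool (i \<in> A)" for i
    by (auto simp: tensor_exps_def lookup_exps A_def)
  then have "(\<Sum>i\<in>UNIV. Poly_Mapping.lookup (tensor_exps D S B) (Inl i)) = card (D \<union> (S - B))"
    by (simp flip: A_def)
  also have "\<dots> = card D + card (S - B)" using assms by (intro card_Un_disjoint) auto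
  finally show ?thesis .
qed

lemma weight_tensor_exps:
  assumes "\<And>i. Poly_Mapping.lookup \<mu> i \<le> 2" "B \<subseteq> singles \<mu>"
  shows "weight (tensor_exps (doubles \<mu>) (singles \<mu>) B) = \<mu>"
proof (rule poly_mapping_eqI)
  fix i
  show "Poly_Mapping.lookup (weight (tensor_exps (doubles \<mu>) (singles \<mu>) B)) i = Poly_Mapping.lookup \<mu> i"
    using assms(1)[of i] assms(2)
    by (auto simp: lookup_weight tensor_exps_def lookup_exps doubles_def singles_def)
qed

abbreviation weight_vectors :: "nat \<Rightarrow> nat \<Rightarrow> nat \<Rightarrow> ('n \<Rightarrow>\<^sub>0 nat) \<Rightarrow> ('k::comm_ring_1, 'n::finite) xy_poly set"
  where "weight_vectors d a b \<mu> \<equiv> {p \<in> polyR_comp a b. minors_power d p \<and> (\<forall>m\<in>Poly_Mapping.keys p. weight m = \<mu>)}"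

lemma weight_vector_squarefree:
  assumes "p \<in> weight_vectors d a b \<mu>" "m \<in> Poly_Mapping.keys p" "\<And>v. Poly_Mapping.lookup m v \<le> 1"
  obtains B where "B \<subseteq> singles \<mu>" "m = tensor_exps (doubles \<mu>) (singles \<mu>) B"
    "admissible \<mu> (a + b)" "b = card (doubles \<mu>) + card B"
proof -
  have "weight m = \<mu>" using assms by blast
  then obtain B where B: "B \<subseteq> singles \<mu>" "m = tensor_exps (doubles \<mu>) (singles \<mu>) B" "\<And>i. Poly_Mapping.lookup \<mu> i \<le> 2"
    using squarefree_exps assms(3) by metis
  have disj: "doubles \<mu> \<inter> B = {}" using B(1) doubles_singles_disjoint by blast
  have "a = card (doubles \<mu>) + card (singles \<mu> - B)"
    using assms x_degree_tensor_exps[OF doubles_singles_disjoint, of \<mu> B] B(2) by (auto simp: polyR_comp_def)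
  moreover have b: "b = card (doubles \<mu>) + card B"
    using assms y_degree_tensor_exps[OF disj, of "singles \<mu>"] B(2) by (auto simp: polyR_comp_def y_degree_def)
  moreover have "card (singles \<mu> - B) + card B = card (singles \<mu>)"
    using B(1) by (metis card_Diff_subset card_mono finite le_add_diff_inverse2)
  ultimately have "admissible \<mu> (a + b)" using B(3) by (simp add: admissible_def)
  then show ?thesis using that B b by blast
qed

lemma weight_vectors_0: "0 \<in> weight_vectors d a b \<mu>"
  by (simp add: polyR_comp_def minors_power_0)

lemma image_eq_singleton: "x \<in> A \<Longrightarrow> (\<And>y. y \<in> A \<Longrightarrow> f y = c) \<Longrightarrow> f ` A = {c}"
  by auto

text \<open>
  All monomials of such a weight and bidegree are divisible by the square of a variable.
\<close>

lemma cls_weight_vectors_trivial: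
  assumes "\<not> (admissible \<mu> (a + b) \<and> card (doubles \<mu>) \<le> b)"
  shows "cls d ` (weight_vectors d a b \<mu> :: ('k::comm_ring_1, 'n::finite) xy_poly set) = {\<zero>\<^bsub>gr_ring d\<^esub>}"
proof -
  have "cls d p = \<zero>\<^bsub>gr_ring d\<^esub>" if p: "p \<in> weight_vectors d a b \<mu>" for p :: "('k, 'n) xy_poly"
  proof -
    have "\<exists>v. Poly_Mapping.lookup m v > 1" if "m \<in> Poly_Mapping.keys p" for m
    proof (rule ccontr)
      assume "\<not> (\<exists>v. Poly_Mapping.lookup m v > 1)"
      then have "Poly_Mapping.lookup m v \<le> 1" for v by (simp add: not_less)
      from weight_vector_squarefree[OF p that this] show False using assms by (metis le_add1)
    qed
    then have "minors_power (Suc d) p" by (rule minors_power_of_squares)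
    then show ?thesis by (simp add: cls_eq_iff flip: cls_0)
  qed
  then show ?thesis by (rule image_eq_singleton[OF weight_vectors_0])
qed

lemma tensor_poly_weight_vector:
  assumes "admissible \<mu> (a + b)" "b = card (doubles \<mu>) + c" "supported c (singles \<mu>) f"
    "minors_power d (z_prod (doubles \<mu>) * tensor_poly (singles \<mu>) f)"
  shows "z_prod (doubles \<mu>) * tensor_poly (singles \<mu>) f \<in> weight_vectors d a b \<mu>"
proof -
  let ?p = "z_prod (doubles \<mu>) * tensor_poly (singles \<mu>) f"
  have key: "(\<Sum>i\<in>UNIV. Poly_Mapping.lookup m (Inl i)) = a \<and> (\<Sum>i\<in>UNIV. Poly_Mapping.lookup m (Inr i)) = b \<and> weight m = \<mu>"
    if m: "m \<in> Poly_Mapping.keys ?p" for m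
  proof -
    have "(\<Sum>B\<in>Pow (singles \<mu>). f $ B when m = tensor_exps (doubles \<mu>) (singles \<mu>) B) \<noteq> 0"
      using m by (simp add: in_keys_iff lookup_tensor_poly[OF doubles_singles_disjoint])
    then obtain B where "(f $ B when m = tensor_exps (doubles \<mu>) (singles \<mu>) B) \<noteq> 0"
      by (metis (no_types, lifting) sum.not_neutral_contains_not_neutral)
    then have B: "m = tensor_exps (doubles \<mu>) (singles \<mu>) B" "f $ B \<noteq> 0" by auto
    then have sub: "B \<subseteq> singles \<mu>" "card B = c" using assms(3) by (auto simp: supported_def)
    have disj: "doubles \<mu> \<inter> B = {}" using sub doubles_singles_disjoint by blast
    have "card (singles \<mu> - B) + card B = card (singles \<mu>)"
      using sub(1) by (metis card_Diff_subset card_mono finite le_add_diff_inverse2)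
    then show ?thesis
      using assms(1,2) B(1) sub weight_tensor_exps[OF _ sub(1)] y_degree_tensor_exps[OF disj, of "singles \<mu>"]
        x_degree_tensor_exps[OF doubles_singles_disjoint, of \<mu> B]
      by (simp add: admissible_def y_degree_def)
  qed
  then show ?thesis using assms(4) by (auto simp: polyR_comp_def)
qed

text \<open>
  Monomials divisible by the square of a variable lie in all powers, so they can be dropped from a
  weight vector; the remaining terms are \<open>z\<^sub>D x\<^bsub>S - B\<^esub> y\<^sub>B\<close> with \<open>card B = c\<close>.
\<close>

lemma cls_weight_vectors:
  fixes \<mu> :: "'n::finite \<Rightarrow>\<^sub>0 nat"
  assumes "admissible \<mu> (a + b)" "b = card (doubles \<mu>) + c"
  shows "cls d ` (weight_vectors d a b \<mu> :: ('k::field, 'n) xy_poly set)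
    = cls d ` (\<lambda>f. z_prod (doubles \<mu>) * tensor_poly (singles \<mu>) f)
      ` {f. supported c (singles \<mu>) f \<and> minors_power d (z_prod (doubles \<mu>) * tensor_poly (singles \<mu>) f)}"
    (is "cls d ` ?W = cls d ` ?h ` ?U")
proof
  show "cls d ` ?h ` ?U \<subseteq> cls d ` ?W"
    using tensor_poly_weight_vector[OF assms] by blast
  show "cls d ` ?W \<subseteq> cls d ` ?h ` ?U"
  proof
    fix x assume "x \<in> cls d ` ?W"
    then obtain p where p: "p \<in> ?W" "x = cls d p" by blast
    define f :: "'k ^ 'n set" where "f = (\<chi> B. if B \<subseteq> singles \<mu>
      then Poly_Mapping.lookup p (tensor_exps (doubles \<mu>) (singles \<mu>) B) else 0)"
    have diff: "minors_power e (p - ?h f)" for e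
    proof (rule minors_power_of_squares, rule ccontr)
      fix m assume m: "m \<in> Poly_Mapping.keys (p - ?h f)" "\<not> (\<exists>v. Poly_Mapping.lookup m v > 1)"
      then have le: "Poly_Mapping.lookup m v \<le> 1" for v by (simp add: not_less)
      have "m \<in> Poly_Mapping.keys p \<or> m \<in> Poly_Mapping.keys (?h f)"
        using m(1) keys_diff[of p "?h f"] by blast
      then obtain B where B: "B \<subseteq> singles \<mu>" "m = tensor_exps (doubles \<mu>) (singles \<mu>) B"
      proof
        assume "m \<in> Poly_Mapping.keys p"
        from weight_vector_squarefree[OF p(1) this le] show ?thesis using that by metis
      next
        assume "m \<in> Poly_Mapping.keys (?h f)"
        then have "(\<Sum>B\<in>Pow (singles \<mu>). f $ B when m = tensor_exps (doubles \<mu>) (singles \<mu>) B) \<noteq> 0"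
          by (simp add: in_keys_iff lookup_tensor_poly[OF doubles_singles_disjoint])
        then obtain B where "B \<in> Pow (singles \<mu>)" "(f $ B when m = tensor_exps (doubles \<mu>) (singles \<mu>) B) \<noteq> 0"
          by (metis (no_types, lifting) sum.not_neutral_contains_not_neutral)
        then show ?thesis using that by auto
      qed
      have "Poly_Mapping.lookup (p - ?h f) m = 0"
        unfolding lookup_minus B(2) lookup_tensor_poly_exps[OF doubles_singles_disjoint B(1)]
        using B(1) by (simp add: f_def)
      then show False using m(1) by (simp add: in_keys_iff)
    qed
    have "supported c (singles \<mu>) f"
      unfolding supported_def
    proof (intro allI impI)
      fix B assume "f $ B \<noteq> 0"
      then have B: "B \<subseteq> singles \<mu>" "tensor_exps (doubles \<mu>) (singles \<mu>) B \<in> Poly_Mapping.keys p"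
        by (auto simp: f_def in_keys_iff split: if_splits)
      obtain B' where "B' \<subseteq> singles \<mu>" "tensor_exps (doubles \<mu>) (singles \<mu>) B = tensor_exps (doubles \<mu>) (singles \<mu>) B'"
        "b = card (doubles \<mu>) + card B'"
        using weight_vector_squarefree[OF p(1) B(2) lookup_tensor_exps_le_1] by metis
      then show "B \<subseteq> singles \<mu> \<and> card B = c"
        using B(1) tensor_exps_eq_iff[OF doubles_singles_disjoint B(1), of B'] assms(2) by simp
    qed
    moreover have "minors_power d (?h f)"
      using minors_power_diff[of d p "p - ?h f"] p(1) diff by simp
    moreover have "x = cls d (?h f)" using diff p(2) by (simp add: cls_eq_iff)
    ultimately show "x \<in> cls d ` ?h ` ?U" by blast
  qed
qed

abbreviation weight_dim :: "nat \<Rightarrow> nat \<Rightarrow> nat \<Rightarrow> 'k::field itself \<Rightarrow> ('n::finite \<Rightarrow>\<^sub>0 nat) \<Rightarrow> nat"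
  where "weight_dim d a b K \<mu> \<equiv> ring.dim (gr_ring d) (range (gr_scalar d))
    (cls d ` (weight_vectors d a b \<mu> :: ('k, 'n) xy_poly set))"

lemma weight_dim_trivial:
  assumes "\<not> (admissible \<mu> (a + b) \<and> card (doubles \<mu>) \<le> b)"
  shows "weight_dim d a b TYPE('k::field) (\<mu> :: 'n::finite \<Rightarrow>\<^sub>0 nat) = 0"
  by (simp only: cls_weight_vectors_trivial[OF assms] dim_zero_space)

lemma weight_dim_eq_diff:
  fixes \<mu> :: "'n::finite \<Rightarrow>\<^sub>0 nat"
  assumes "admissible \<mu> (a + b)" "b = card (doubles \<mu>) + c"
    and "\<And>d. vec.subspace {f :: 'k ^ 'n set. supported c (singles \<mu>) f \<and> minors_power d (z_prod (doubles \<mu>) * tensor_poly (singles \<mu>) f)}"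
  shows "weight_dim d a b TYPE('k::field) \<mu>
    = vec.dim {f :: 'k ^ 'n set. supported c (singles \<mu>) f \<and> minors_power d (z_prod (doubles \<mu>) * tensor_poly (singles \<mu>) f)}
    - vec.dim {f :: 'k ^ 'n set. supported c (singles \<mu>) f \<and> minors_power (Suc d) (z_prod (doubles \<mu>) * tensor_poly (singles \<mu>) f)}"
proof -
  let ?h = "\<lambda>f :: 'k ^ 'n set. z_prod (doubles \<mu>) * tensor_poly (singles \<mu>) f"
  let ?U = "\<lambda>d. {f. supported c (singles \<mu>) f \<and> minors_power d (?h f)}"
  have "{f \<in> ?U d. minors_power (Suc d) (?h f)} = ?U (Suc d)"
    using minors_power_antimono[of "Suc d" _ d] by auto
  moreover have "ring.dim (gr_ring d) (range (gr_scalar d)) (cls d ` ?h ` ?U d)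
    = vec.dim (?U d) - vec.dim {f \<in> ?U d. minors_power (Suc d) (?h f)}"
    by (rule dim_cls_image)
      (simp_all add: tensor_poly_add tensor_poly_scale distrib_left mult.left_commute assms(3))
  ultimately show ?thesis by (simp only: cls_weight_vectors[OF assms(1,2)])
qed

text \<open>
  The weight space is a quotient of two spaces \<open>annih\<close> for consecutive values of \<open>p\<close>, and the term
  \<open>card (singles \<mu>) choose c\<close> of both dimensions cancels. If \<open>d < card (doubles \<mu>)\<close>, the two spaces
  coincide.
\<close>

lemma weight_dim_singles:
  fixes \<mu> :: "'n::finite \<Rightarrow>\<^sub>0 nat"
  assumes char: "CHAR('k) = 2" and adm: "admissible \<mu> (a + b)" "card (doubles \<mu>) \<le> b" "singles \<mu> \<noteq> {}"
    and ab: "b \<le> a" "d \<le> b"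
  shows "weight_dim d a b TYPE('k::field) \<mu> + (if card (doubles \<mu>) < d then card (singles \<mu>) choose (d - card (doubles \<mu>) - 1) else 0)
    = (if card (doubles \<mu>) \<le> d then card (singles \<mu>) choose (d - card (doubles \<mu>)) else 0)"
proof -
  let ?D = "doubles \<mu>" and ?S = "singles \<mu>"
  obtain c where c: "b = card ?D + c" using adm(2) le_Suc_ex by blast
  have U: "{f :: 'k ^ 'n set. supported c ?S f \<and> minors_power e (z_prod ?D * tensor_poly ?S f)}
      = annih (e - card ?D) c ?S" for e
    using minors_power_tensor_poly_iff[OF char doubles_singles_disjoint adm(3), of c _ e]
    by (auto simp: annih_def)
  have dim: "weight_dim d a b TYPE('k) \<mu> = vec.dim (annih (d - card ?D) c ?S :: ('k ^ 'n set) set)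
      - vec.dim (annih (Suc d - card ?D) c ?S :: ('k ^ 'n set) set)"
    using weight_dim_eq_diff[OF adm(1) c, where ?'k = 'k and d = d] unfolding U by (simp add: subspace_annih)
  have size: "card ?S + 2 * card ?D = a + b" using adm(1) by (simp add: admissible_def)
  show ?thesis
  proof (cases "card ?D \<le> d")
    case False
    then show ?thesis using dim by simp
  next
    case True
    then obtain p where p: "d = card ?D + p" using le_Suc_ex by blast
    have "vec.dim (annih p c ?S :: ('k ^ 'n set) set) + (if p = 0 then 0 else card ?S choose (p - 1)) = card ?S choose c"
      by (rule dim_annih) (use p c size ab in auto)
    moreover have "vec.dim (annih (Suc p) c ?S :: ('k ^ 'n set) set) + (if Suc p = 0 then 0 else card ?S choose (Suc p - 1)) = card ?S choose c"
      by (rule dim_annih) (use p c size ab in auto)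
    moreover have "vec.dim (annih (Suc p) c ?S :: ('k ^ 'n set) set) \<le> vec.dim (annih p c ?S :: ('k ^ 'n set) set)"
      by (rule vec.dim_subset) (auto simp: annih_def)
    ultimately show ?thesis using dim p by (auto simp: Suc_diff_le)
  qed
qed

text \<open>
  Modulo squares, the only monomial of such a weight is \<open>z\<^sub>D\<close>, and it lies in exactly the powers with
  exponent less than \<open>card D\<close>.
\<close>

lemma weight_dim_no_singles:
  fixes \<mu> :: "'n::finite \<Rightarrow>\<^sub>0 nat"
  assumes char: "CHAR('k) = 2" and adm: "admissible \<mu> (a + b)" "card (doubles \<mu>) \<le> b" "singles \<mu> = {}"
    and ab: "b \<le> a" "1 \<le> a"
  shows "weight_dim d a b TYPE('k::field) \<mu> = (if Suc d = card (doubles \<mu>) then 1 else 0)"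
proof -
  let ?D = "doubles \<mu>"
  have b: "b = card ?D" and a: "a = card ?D" using adm ab by (simp_all add: admissible_def)
  then have ne: "?D \<noteq> {}" using ab(2) by auto
  have c: "b = card ?D + 0" using b by simp
  have tp: "tensor_poly {} f = Const (f $ {})" for f :: "'k ^ 'n set" by (simp add: tensor_poly_def)
  have iff: "minors_power e (z_prod ?D * tensor_poly {} f) \<longleftrightarrow> f $ {} = 0 \<or> e < card ?D" for e and f :: "'k ^ 'n set"
  proof
    assume mp: "minors_power e (z_prod ?D * tensor_poly {} f)"
    show "f $ {} = 0 \<or> e < card ?D"
    proof (cases "f $ {} = 0")
      case False
      have "z_prod ?D = Const (inverse (f $ {})) * (z_prod ?D * tensor_poly {} f)"
        using False by (simp add: tp mult.left_commute flip: Const_mult)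
      then have "minors_power e (z_prod ?D :: ('k, 'n) xy_poly)" using mp minors_power_mult by metis
      then show ?thesis using minors_power_z_iff[OF char ne] by blast
    qed simp
  next
    assume "f $ {} = 0 \<or> e < card ?D"
    then show "minors_power e (z_prod ?D * tensor_poly {} f)"
      using minors_power_z_iff[OF char ne] minors_power_mult_right by (auto simp: tp minors_power_0)
  qed
  have U: "{f :: 'k ^ 'n set. supported 0 {} f \<and> minors_power e (z_prod ?D * tensor_poly {} f)}
      = (if e < card ?D then annih 0 0 {} else {0})" for e
    unfolding iff by (auto simp: annih_def vec_eq_iff supported_def)
  have "weight_dim d a b TYPE('k) \<mu> = vec.dim (if d < card ?D then annih 0 0 {} else {0} :: ('k ^ 'n set) set)
      - vec.dim (if Suc d < card ?D then annih 0 0 {} else {0} :: ('k ^ 'n set) set)"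
    using weight_dim_eq_diff[OF adm(1) c, where ?'k = 'k and d = d] unfolding adm(3) U
    by (simp add: subspace_annih vec.subspace_0 vec.subspace_single_0)
  then show ?thesis by (auto simp: dim_annih_empty)
qed

section \<open>The character\<close>

lemma finite_bounded_exps: "finite {\<mu> :: 'n::finite \<Rightarrow>\<^sub>0 nat. \<forall>i. Poly_Mapping.lookup \<mu> i \<le> k}"
proof (rule finite_imageD)
  have "Poly_Mapping.lookup ` {\<mu> :: 'n \<Rightarrow>\<^sub>0 nat. \<forall>i. Poly_Mapping.lookup \<mu> i \<le> k} \<subseteq> (\<Pi>\<^sub>E i\<in>UNIV. {..k})"
    by (auto simp: PiE_def)
  then show "finite (Poly_Mapping.lookup ` {\<mu> :: 'n \<Rightarrow>\<^sub>0 nat. \<forall>i. Poly_Mapping.lookup \<mu> i \<le> k})"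
    by (rule finite_subset) (simp add: finite_PiE)
  show "inj_on Poly_Mapping.lookup {\<mu> :: 'n \<Rightarrow>\<^sub>0 nat. \<forall>i. Poly_Mapping.lookup \<mu> i \<le> k}"
    by (intro inj_onI) (simp only: lookup_inject)
qed

text \<open>
  The sum that defines the character ranges over finitely many weights, since all entries of a weight
  with a nonzero weight space are at most 2.
\<close>

lemma lookup_gl_character:
  "Poly_Mapping.lookup (gl_character (gr_ring d) (gr_scalar d) act_gr
      (gr_comp d a b :: ('k::alg_closed_field, 'n::finite) gr_elem set)) \<mu>
    = int (weight_dim d a b TYPE('k) \<mu>)"
proof -
  let ?ws = "\<lambda>\<mu>. cls d ` (weight_vectors d a b \<mu> :: ('k, 'n) xy_poly set)"
  let ?M = "{\<nu>. ?ws \<nu> \<noteq> {\<zero>\<^bsub>gr_ring d\<^esub>}}"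
  have adm: "admissible \<nu> (a + b) \<and> card (doubles \<nu>) \<le> b" if "\<nu> \<in> ?M" for \<nu>
    using that cls_weight_vectors_trivial[of \<nu> a b d] by blast
  have "finite ?M"
    by (rule finite_subset[OF _ finite_bounded_exps[of 2]]) (use adm in \<open>auto simp: admissible_def\<close>)
  then have "Poly_Mapping.lookup (gl_character (gr_ring d) (gr_scalar d) act_gr (gr_comp d a b :: ('k, 'n) gr_elem set)) \<mu>
    = (if \<mu> \<in> ?M then int (weight_dim d a b TYPE('k) \<mu>) else 0)"
    unfolding gl_character_def weight_space_gr_comp
    by (simp add: lookup_sum lookup_single when_def)
  moreover have "weight_dim d a b TYPE('k) \<mu> = 0" if "\<mu> \<notin> ?M"
  proof -
    have "?ws \<mu> = {\<zero>\<^bsub>gr_ring d\<^esub>}" using that by blast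
    then show ?thesis by (simp only: dim_zero_space)
  qed
  ultimately show ?thesis by auto
qed

lemma int_weight_dim:
  assumes "CHAR('k::field) = 2" "b \<le> a" "d \<le> b" "1 \<le> a"
  shows "int (weight_dim d a b TYPE('k) (\<mu> :: 'n::finite \<Rightarrow>\<^sub>0 nat)) =
    (if admissible \<mu> (a + b) \<and> card (doubles \<mu>) \<le> b then
      if singles \<mu> = {} then (if Suc d = card (doubles \<mu>) then 1 else 0)
      else int_choose (card (singles \<mu>)) (int d - int (card (doubles \<mu>)))
        - int_choose (card (singles \<mu>)) (int d - int (card (doubles \<mu>)) - 1)
    else 0)"
proof (cases "admissible \<mu> (a + b) \<and> card (doubles \<mu>) \<le> b")
  case False
  show ?thesis unfolding weight_dim_trivial[OF False] if_not_P[OF False] by simp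
next
  case True
  show ?thesis
  proof (cases "singles \<mu> = {}")
    case s: True
    then show ?thesis
      using True weight_dim_no_singles[OF assms(1) conjunct1[OF True] conjunct2[OF True] s assms(2,4), of d] by simp
  next
    case s: False
    let ?D = "card (doubles \<mu>)" and ?s = "card (singles \<mu>)"
    have "int_choose ?s (int d - int ?D) = int (if ?D \<le> d then ?s choose (d - ?D) else 0)"
      by (auto simp: int_choose_def nat_diff_distrib)
    moreover have "int_choose ?s (int d - int ?D - 1) = int (if ?D < d then ?s choose (d - ?D - 1) else 0)"
      by (auto simp: int_choose_def nat_diff_distrib)
    moreover note weight_dim_singles[OF assms(1) conjunct1[OF True] conjunct2[OF True] s assms(2,3), symmetric]
    ultimately show ?thesis using True s by simp
  qed
qed

lemma lookup_sign_mult: "Poly_Mapping.lookup ((-1) ^ n * p) \<mu> = (-1) ^ n * Poly_Mapping.lookup p \<mu>"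
  for p :: "'n::finite t_poly"
  by (cases "even n") simp_all

theorem theorem1p1:
  fixes a b d :: nat
  assumes "CHAR('k::alg_closed_field) = 2"
    and "a \<ge> b" and "b \<ge> d" and "a \<ge> 1"
  shows "gl_character (gr_ring d) (gr_scalar d) act_gr (gr_comp d a b :: ('k, 'n::finite) gr_elem set) =
    (if a = b \<and> b = d then
       \<Sum>j=1..a. (-1) ^ (j - 1) * s2 (int a + int j) (int a - int j)
     else if a = b \<and> b = d + 1 then
       s2 (int a) (int a) + (\<Sum>j=2..a. (-1) ^ j * s2 (int a + int j) (int a - int j))
     else s2 (int a + int b - int d) (int d))"
    (is "?L = ?R")
proof (rule poly_mapping_eqI)
  fix \<mu> :: "'n \<Rightarrow>\<^sub>0 nat"
  define D where "D = card (doubles \<mu>)"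
  define s where "s = card (singles \<mu>)"
  \<comment> \<open>The coefficient of \<open>s2 (a + j) (a - j)\<close> at \<open>\<mu>\<close>.\<close>
  define t where "t j = int_choose s (int a - int j - int D) - int_choose s (int a - int j - int D - 1)" for j
  \<comment> \<open>The dimension of the weight space, if \<open>\<mu>\<close> is the weight of a monomial of total degree \<open>a + b\<close> without squares.\<close>
  define V where "V = (if D \<le> b then if s = 0 then (if Suc d = D then 1 else 0)
    else int_choose s (int d - int D) - int_choose s (int d - int D - 1) else 0)"
  have L: "Poly_Mapping.lookup ?L \<mu> = (if admissible \<mu> (a + b) then V else 0)"
    unfolding lookup_gl_character int_weight_dim[OF assms] V_def D_def s_def by simp
  have t: "Poly_Mapping.lookup (s2 (int a + int j) (int a - int j)) \<mu> = (if admissible \<mu> (a + a) then t j else 0)" for j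
    by (subst lookup_s2[where k="a + a"]) (simp_all add: t_def D_def s_def)
  have s2: "Poly_Mapping.lookup (s2 (int a + int b - int d) (int d)) \<mu>
      = (if admissible \<mu> (a + b) then int_choose s (int d - int D) - int_choose s (int d - int D - 1) else 0)"
    by (subst lookup_s2[where k="a + b"]) (simp_all add: D_def s_def)
  have size: "s + 2 * D = a + b" if "admissible \<mu> (a + b)"
    using that by (simp add: admissible_def s_def D_def)
  have R1: "Poly_Mapping.lookup (\<Sum>j=1..a. (-1) ^ (j - 1) * s2 (int a + int j) (int a - int j)) \<mu>
      = (if admissible \<mu> (a + a) then \<Sum>j=1..a. (-1) ^ (j - 1) * t j else 0)"
    by (cases "admissible \<mu> (a + a)")
      (simp_all only: lookup_sum lookup_sign_mult t if_True if_False mult_zero_right sum.neutral_const)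
  have R2: "Poly_Mapping.lookup (s2 (int a) (int a) + (\<Sum>j=2..a. (-1) ^ j * s2 (int a + int j) (int a - int j))) \<mu>
      = (if admissible \<mu> (a + a) then t 0 + (\<Sum>j=2..a. (-1) ^ j * t j) else 0)"
    using t[of 0] by (cases "admissible \<mu> (a + a)")
      (simp_all only: lookup_add lookup_sum lookup_sign_mult t if_True if_False mult_zero_right
        sum.neutral_const of_nat_0 add_0_right diff_0_right)
  have t_0: "t j = 0" if "a < D + j" for j using that by (simp add: t_def int_choose_def)
  have first: "(\<Sum>j=1..a. (-1) ^ (j - 1) * t j) = t 0 - (\<Sum>j=0..a. (-1) ^ j * t j)"
  proof -
    have "(\<Sum>j=0..a. (-1) ^ j * t j) = t 0 + (\<Sum>j=1..a. (-1) ^ j * t j)"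
      by (simp add: sum.atLeast_Suc_atMost)
    also have "(\<Sum>j=1..a. (-1) ^ j * t j) = - (\<Sum>j=1..a. (-1) ^ (j - 1) * t j)"
      unfolding sum_negf[symmetric]
    proof (rule sum.cong)
      fix j assume "j \<in> {1..a}"
      then show "(-1) ^ j * t j = - ((-1) ^ (j - 1) * t j)" by (cases j) auto
    qed simp
    finally show ?thesis by simp
  qed
  have second: "t 0 + (\<Sum>j=2..a. (-1) ^ j * t j) = t 1 + (\<Sum>j=0..a. (-1) ^ j * t j)"
    using assms(4) by (simp add: sum.atLeast_Suc_atMost numeral_2_eq_2)
  have alt: "(\<Sum>j=0..a. (-1) ^ j * t j) = 0" if "s = 2 * (a - D)" "D < a"
  proof -
    have "t j = int_choose (2 * (a - D)) (int (a - D) - int j) - int_choose (2 * (a - D)) (int (a - D) - int j - 1)" for j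
      using that by (simp add: t_def of_nat_diff algebra_simps)
    then show ?thesis using alternating_sum_int_choose[of "a - D" a] that by simp
  qed
  \<comment> \<open>For \<open>a = b = D\<close>, where \<open>z\<^sub>D\<close> is the only monomial, the alternating sum does not vanish; this accounts for the two exceptional cases.\<close>
  have alt': "(\<Sum>j=0..a. (-1) ^ j * t j) = t 0" if "a \<le> D"
    using that t_0 by (simp add: sum.atLeast_Suc_atMost)
  have s_eq: "s = 2 * (a - D)" if "a = b" "admissible \<mu> (a + b)" "D < a"
    using size that by simp
  consider (1) "a = b" "b = d" | (2) "a = b" "b = d + 1"
    | (3) "\<not> (a = b \<and> b = d)" "\<not> (a = b \<and> b = d + 1)"
    by blast
  then show "Poly_Mapping.lookup ?L \<mu> = Poly_Mapping.lookup ?R \<mu>"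
  proof cases
    case 1
    have "V = t 0 - (\<Sum>j=0..a. (-1) ^ j * t j)" if adm: "admissible \<mu> (a + b)"
    proof (cases "D < a")
      case True
      have "V = t 0" using True 1 s_eq[OF 1(1) adm True] by (simp add: V_def t_def)
      then show ?thesis using alt[OF s_eq[OF 1(1) adm True] True] by simp
    next
      case False
      then have "V = 0" using size[OF adm] 1 by (auto simp: V_def)
      then show ?thesis using alt' False by simp
    qed
    then show ?thesis unfolding L if_P[OF conjI[OF 1]] R1 first using 1(1) by simp
  next
    case 2
    then have not1: "\<not> (a = b \<and> b = d)" by simp
    have "V = t 1 + (\<Sum>j=0..a. (-1) ^ j * t j)" if adm: "admissible \<mu> (a + b)"
    proof (cases "D < a")
      case True
      have "int a - 1 = int d" using 2 by simp
      then have "V = t 1" using True 2(1) s_eq[OF 2(1) adm True] by (simp add: V_def t_def)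
      then show ?thesis using alt[OF s_eq[OF 2(1) adm True] True] by simp
    next
      case False
      then have "V = t 0" using size[OF adm] 2 by (auto simp: V_def t_def int_choose_def)
      then show ?thesis using alt' t_0[of 1] False by simp
    qed
    then show ?thesis unfolding L if_not_P[OF not1] if_P[OF conjI[OF 2]] R2 second using 2(1) by simp
  next
    case 3
    have "V = int_choose s (int d - int D) - int_choose s (int d - int D - 1)" if adm: "admissible \<mu> (a + b)"
    proof (cases "D \<le> b \<and> s \<noteq> 0")
      case False
      \<comment> \<open>If \<open>D \<le> b\<close> and there are no indices of weight 1, then \<open>a = b = D\<close>, and \<open>b - d\<close> is at least 2.\<close>
      then have "d < D \<and> (D \<le> b \<longrightarrow> Suc d \<noteq> D)" using 3 size[OF adm] assms by auto
      then show ?thesis using False by (auto simp: V_def int_choose_def)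
    qed (simp add: V_def)
    then show ?thesis unfolding L if_not_P[OF 3(1)] if_not_P[OF 3(2)] s2 by simp
  qed
qed

end
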